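(* Let $f:\mathbb{R}^d\to\mathbb{R}$ satisfy the following assumptions. (1) $f\in C^2(\mathbb{R}^d)$ and there exists $M>0$ such that $\|\nabla^2 f(x)\|\le M$ for all $x\in\mathbb{R}^d$. (2) For every $x^*\in\mathrm{Crit}_s(f)$, the Hessian $\nabla^2 f(x^* )$ is non-degenerate (all its eigenvalues are nonzero). (3) For every $x^*\in\mathrm{Crit}_s(f)$, with $H=\nabla^2 f(x^* )$, one has $\mathcal{P}_+^H(\omega)e_i\neq 0$ for every $i\in\{1,\dots,d\}$ and almost every $\omega\in\Omega$. (4) Every $x^*\in\mathrm{Crit}(f)$ is an isolated critical point of $f$. Suppose moreover that $0<\alpha_{\min}<\alpha_{\max}<1/M$. Then for any $x_0\in\mathbb{R}^d\setminus\mathrm{Crit}_s(f)$ with bounded level set $L(x_0)=\{x\in\mathbb{R}^d:f(x)\le f(x_0)\}$, with probability $1$ the sequence $\{x_t\}_{t\in\mathbb{N}}$ is convergent with limit in $\mathrm{Crit}(f)\setminus\mathrm{Crit}_s(f)$.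
   Context: $\mathbb{N}=\{0,1,2,\dots\}$; $e_1,\dots,e_d$ is the standard basis of $\mathbb{R}^d$; $\|\cdot\|$ is the Euclidean norm on vectors and the operator norm on matrices. Probability space: for $t\in\mathbb{N}$ let $(\Omega_t,\Sigma_t,\mathbb{P}_t)$ be $\{1,\dots,d\}\times[\alpha_{\min},\alpha_{\max}]$ with the product of the two uniform distributions, and let $(\Omega,\mathcal{F},\mathbb{P})$ be the product of all these spaces over $t\in\mathbb{N}$. Write $\omega=((i_0,\alpha_0),(i_1,\alpha_1),\dots)\in\Omega$, and let $\tau:\Omega\to\Omega$ be the left shift. Randomized coordinate gradient descent: given $x_0\in\mathbb{R}^d$ and $\omega\in\Omega$, $x_{t+1}=x_t-\alpha_t e_{i_t}e_{i_t}^{\top}\nabla f(x_t)$ for $t\in\mathbb{N}$. $\mathrm{Crit}(f)=\{x\in\mathbb{R}^d:\nabla f(x)=0\}$ and $\mathrm{Crit}_s(f)=\{x\in\mathbb{R}^d:\nabla f(x)=0,\ \lambda_{\min}(\nabla^2 f(x))<0\}$. Linearized system: for a symmetric matrix $H\in\mathbb{R}^{d\times d}$ with $\alpha_{\max}|H_{ii}|<1$ for all $i$, let $A^H(\omega)=I-\alpha_0 e_{i_0}e_{i_0}^{\top}H$ and $\Phi^H(t,\omega)=A^H(\tau^{t-1}\omega)\cdots A^H(\tau\omega)A^H(\omega)$. By the multiplicative ergodic theorem, for almost every $\omega$ the limit $\Lambda^H(\omega)=\lim_{t\to\infty}\bigl(\Phi^H(t,\omega)^{\top}\Phi^H(t,\omega)\bigr)^{1/2t}$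 exists and is positive definite. Write its distinct eigenvalues as $e^{\lambda_1}>\dots>e^{\lambda_p}$ (the $\lambda_i$ are the Lyapunov exponents) with eigenspaces $V_i^H(\omega)$. Then $W_+^H(\omega)=\bigoplus_{\lambda_i>0}V_i^H(\omega)$ and $\mathcal{P}_+^H(\omega)$ is the orthogonal projection onto $W_+^H(\omega)$. *)

theory Defs
  imports "HOL-Probability.Probability"
begin

section \<open>Gradient, Hessian and critical points\<close>

definition grad :: "(real ^ 'n \<Rightarrow> real) \<Rightarrow> real ^ 'n \<Rightarrow> real ^ 'n" where
  "grad f x = (THE D. GDERIV f x :> D)"

definition hessian :: "(real ^ 'n \<Rightarrow> real) \<Rightarrow> real ^ 'n \<Rightarrow> real ^ 'n ^ 'n" where
  "hessian f x = jacobian (grad f) (at x)"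

definition C2 :: "(real ^ 'n \<Rightarrow> real) \<Rightarrow> bool" where
  "C2 f \<longleftrightarrow> (\<forall>x. f differentiable at x) \<and> (\<forall>x. grad f differentiable at x)
     \<and> continuous_on UNIV (hessian f)"

definition eigenvals :: "real ^ 'n ^ 'n \<Rightarrow> real set" where
  "eigenvals A = {\<mu>. \<exists>v. v \<noteq> 0 \<and> A *v v = \<mu> *\<^sub>R v}"

definition eigenspace :: "real ^ 'n ^ 'n \<Rightarrow> real \<Rightarrow> (real ^ 'n) set" where
  "eigenspace A \<mu> = {v. A *v v = \<mu> *\<^sub>R v}"

text \<open>Meant for symmetric matrices, where the set of real eigenvalues is finite and nonempty.\<close>

definition lambda_min :: "real ^ 'n ^ 'n \<Rightarrow> real" where
  "lambda_min A = Min (eigenvals A)"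

definition Crit :: "(real ^ 'n \<Rightarrow> real) \<Rightarrow> (real ^ 'n) set" where
  "Crit f = {x. grad f x = 0}"

definition Crit_s :: "(real ^ 'n \<Rightarrow> real) \<Rightarrow> (real ^ 'n) set" where
  "Crit_s f = {x. grad f x = 0 \<and> lambda_min (hessian f x) < 0}"

section \<open>The probability space and the randomized coordinate gradient descent\<close>

type_synonym 'n sample = "nat \<Rightarrow> 'n \<times> real"

definition step_space :: "real \<Rightarrow> real \<Rightarrow> ('n::finite \<times> real) measure" where
  "step_space a b =
     uniform_count_measure (UNIV :: 'n set)
       \<Otimes>\<^sub>M uniform_measure (restrict_space lborel {a..b}) {a..b}"

definition sample_space :: "real \<Rightarrow> real \<Rightarrow> 'n::finite sample measure" where
  "sample_space a b = Pi\<^sub>M (UNIV :: nat set) (\<lambda>_. step_space a b)"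

definition shift :: "'n sample \<Rightarrow> 'n sample" where
  "shift \<omega> = (\<lambda>t. \<omega> (Suc t))"

text \<open>The matrix \<open>e\<^sub>i e\<^sub>i\<^sup>T\<close>.\<close>

definition coord_proj :: "'n::finite \<Rightarrow> real ^ 'n ^ 'n" where
  "coord_proj i = (columnvector (axis i 1) :: real ^ 1 ^ 'n) ** (rowvector (axis i 1) :: real ^ 'n ^ 1)"

primrec rcgd :: "(real ^ 'n \<Rightarrow> real) \<Rightarrow> real ^ 'n \<Rightarrow> 'n::finite sample \<Rightarrow> nat \<Rightarrow> real ^ 'n" where
  "rcgd f x0 \<omega> 0 = x0"
| "rcgd f x0 \<omega> (Suc t) =
     rcgd f x0 \<omega> t
       - snd (\<omega> t) *\<^sub>R (coord_proj (fst (\<omega> t)) *v grad f (rcgd f x0 \<omega> t))"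

section \<open>The linearized random dynamical system\<close>

definition lin_step :: "real ^ 'n ^ 'n \<Rightarrow> 'n::finite sample \<Rightarrow> real ^ 'n ^ 'n" where
  "lin_step H \<omega> = mat 1 - snd (\<omega> 0) *\<^sub>R (coord_proj (fst (\<omega> 0)) ** H)"

primrec cocycle :: "real ^ 'n ^ 'n \<Rightarrow> nat \<Rightarrow> 'n::finite sample \<Rightarrow> real ^ 'n ^ 'n" where
  "cocycle H 0 \<omega> = mat 1"
| "cocycle H (Suc t) \<omega> = lin_step H ((shift ^^ t) \<omega>) ** cocycle H t \<omega>"

text \<open>The power \<open>^\<close> on the type \<open>real ^ 'n ^ 'n\<close> is taken entrywise, hence the iterated product.\<close>

definition mat_pow :: "real ^ 'n ^ 'n \<Rightarrow> nat \<Rightarrow> real ^ 'n ^ 'n" where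
  "mat_pow A k = (((**) A) ^^ k) (mat 1)"

definition pos_semidef :: "real ^ 'n ^ 'n \<Rightarrow> bool" where
  "pos_semidef A \<longleftrightarrow> transpose A = A \<and> (\<forall>v. 0 \<le> v \<bullet> (A *v v))"

text \<open>\<open>S\<^bsup>1/k\<^esup>\<close> for positive semidefinite \<open>S\<close> and \<open>k > 0\<close>.\<close>

definition mat_root :: "nat \<Rightarrow> real ^ 'n ^ 'n \<Rightarrow> real ^ 'n ^ 'n" where
  "mat_root k S = (THE B. pos_semidef B \<and> mat_pow B k = S)"

text \<open>The limit exists almost surely by the multiplicative ergodic theorem; where it does not
  exist, the value is unspecified.\<close>

definition Lambda :: "real ^ 'n ^ 'n \<Rightarrow> 'n::finite sample \<Rightarrow> real ^ 'n ^ 'n" where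
  "Lambda H \<omega> = lim (\<lambda>t. mat_root (2 * t) (transpose (cocycle H t \<omega>) ** cocycle H t \<omega>))"

definition lyapunov_exponents :: "real ^ 'n ^ 'n \<Rightarrow> 'n::finite sample \<Rightarrow> real set" where
  "lyapunov_exponents H \<omega> = {l. exp l \<in> eigenvals (Lambda H \<omega>)}"

text \<open>Eigenspaces to distinct eigenvalues are independent, so the span of their union is their
  direct sum.\<close>

definition W_plus :: "real ^ 'n ^ 'n \<Rightarrow> 'n::finite sample \<Rightarrow> (real ^ 'n) set" where
  "W_plus H \<omega> =
     span (\<Union>l\<in>{l \<in> lyapunov_exponents H \<omega>. l > 0}. eigenspace (Lambda H \<omega>) (exp l))"

definition orth_proj :: "(real ^ 'n) set \<Rightarrow> real ^ 'n \<Rightarrow> real ^ 'n" where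
  "orth_proj W v = (THE w. w \<in> W \<and> v - w \<in> W\<^sup>\<bottom>)"

definition P_plus :: "real ^ 'n ^ 'n \<Rightarrow> 'n::finite sample \<Rightarrow> real ^ 'n \<Rightarrow> real ^ 'n" where
  "P_plus H \<omega> = orth_proj (W_plus H \<omega>)"

end

theory Submission
  imports Defs "HOL-Real_Asymp.Real_Asymp"
begin

text \<open>Convergence to a critical point is a supermartingale argument: every step decreases \<open>f\<close> by at
  least a constant times the squared partial derivative it uses, so the expected sum of the
  \<open>\<parallel>\<nabla>f(x\<^sub>t)\<parallel>\<^sup>2\<close> is finite; the critical points in the compact level set are finitely many, and the
  steps tend to \<open>0\<close>.

  A strict saddle \<open>x\<^sup>*\<close> with Hessian \<open>H\<close> is avoided because \<open>f\<close> is monotone along the iteration: it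
  suffices that from every point near \<open>x\<^sup>*\<close> the value drops below \<open>f(x\<^sup>*)\<close> within a bounded number of
  steps with probability bounded below. By compactness of the sphere this holds once every
  \<open>v \<noteq> 0\<close> has a finite word of linearized coordinate steps making the form \<open>v \<bullet> Hv\<close> negative. The
  vectors without such a word form a subspace, invariant under all steps, on which the form is
  positive definite; if it is nonzero it contains some \<open>e\<^sub>i\<close>, whose orbits under the cocycle are
  bounded. Then \<open>e\<^sub>i\<close> is orthogonal to \<open>W\<^sub>+\<close>, against the projection hypothesis.

  That last step needs the limit matrix \<open>\<Lambda>\<close> to exist almost surely, since \<open>Lambda\<close> is an unspecified
  matrix elsewhere; so the multiplicative ergodic theorem is proved for this cocycle, from the
  subadditive ergodic theorem and Raghunathan's argument.\<close>

section \<open>The subadditive ergodic theorem\<close>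

text \<open>The linearization describes the iteration only for finitely many steps and only relative
  to the distance from the saddle, so the escape has to come from finitely many words. These use one
  fixed step size \<open>b0\<close> inside the interval, so that each word, with slightly perturbed
  step sizes, has positive probability; boundedness of orbits is however required for every step
  size that the cocycle may draw. The bridge: a step moves a vector only along some
  \<open>e_i\<close>, so if it moves a vector of the subspace at all, \<open>e_i\<close> itself lies
  in the subspace, and steps of every size preserve it. The ergodic theorem is proved for processes
  bounded by \<open>C * n\<close>, a bound supplied by the uniform estimates on a coordinate step
  and on its inverse. Exterior powers are replaced by determinants in which some rows are moved by
  the matrix while the others range over unit vectors; constant factors disappear after taking
  logarithms and dividing by the time.\<close>

definition linf :: "(nat \<Rightarrow> real) \<Rightarrow> real" where
  "linf a = real_of_ereal (liminf (\<lambda>n. ereal (a n)))"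

text \<open>For a bounded sequence the cast to the reals loses nothing; an infinite liminf would be
  cast to 0.\<close>

lemma ereal_linf:
  assumes "\<And>n. \<bar>a n\<bar> \<le> C"
  shows "ereal (linf a) = liminf (\<lambda>n. ereal (a n))" "\<bar>linf a\<bar> \<le> C"
proof -
  let ?L = "liminf (\<lambda>n. ereal (a n))"
  have le: "a n \<le> C" "- C \<le> a n" for n
    using assms[of n] by auto
  have "ereal (- C) \<le> ?L"
    by (intro Liminf_bounded) (use le in auto)
  moreover have "?L \<le> limsup (\<lambda>n. ereal (a n))"
    by (intro Liminf_le_Limsup) auto
  moreover have "limsup (\<lambda>n. ereal (a n)) \<le> ereal C"
    by (intro Limsup_bounded) (use le in auto)
  ultimately have *: "ereal (- C) \<le> ?L" "?L \<le> ereal C" by auto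
  then have "\<bar>?L\<bar> \<noteq> \<infinity>" by auto
  then show eq: "ereal (linf a) = ?L"
    unfolding linf_def by (simp add: ereal_real)
  then show "\<bar>linf a\<bar> \<le> C"
    using * unfolding eq[symmetric] by simp
qed

lemma eventually_gt_linf:
  assumes "\<And>n. \<bar>a n\<bar> \<le> C" "c < linf a"
  shows "eventually (\<lambda>n. c < a n) sequentially"
proof -
  have "ereal c < liminf (\<lambda>n. ereal (a n))"
    by (subst ereal_linf(1)[OF assms(1), symmetric]) (use assms(2) in simp_all)
  then have "eventually (\<lambda>n. ereal c < ereal (a n)) sequentially"
    by (rule less_LiminfD)
  then show ?thesis by simp
qed

lemma frequently_lt_linf:
  assumes "\<And>n. \<bar>a n\<bar> \<le> C" "linf a < c"
  shows "frequently (\<lambda>n. a n < c) sequentially"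
proof (rule ccontr)
  assume "\<not> ?thesis"
  then have "eventually (\<lambda>n. ereal c \<le> ereal (a n)) sequentially"
    by (simp add: not_frequently not_less)
  then have "ereal c \<le> liminf (\<lambda>n. ereal (a n))"
    by (rule Liminf_bounded)
  then show False
    by (subst (asm) ereal_linf(1)[OF assms(1), symmetric]) (use assms(2) in simp_all)
qed

lemma linf_le_linfI:
  assumes "\<And>n. \<bar>a n\<bar> \<le> C" "\<And>n. \<bar>b n\<bar> \<le> C'"
    and "d \<longlonglongrightarrow> 0" "eventually (\<lambda>n. a n \<le> b n + d n) sequentially"
  shows "linf a \<le> linf b"
proof (rule ccontr)
  assume H: "\<not> ?thesis"
  define e where "e = (linf a - linf b) / 3"
  have e: "e > 0" "linf b + e \<le> linf a - e" using H by (auto simp: e_def field_simps)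
  have 1: "frequently (\<lambda>n. b n < linf b + e) sequentially"
    using frequently_lt_linf[where a=b and C=C' and c="linf b + e"] assms(2) e by simp
  have 2: "eventually (\<lambda>n. linf a - e / 2 < a n) sequentially"
    using eventually_gt_linf[where a=a and C=C and c="linf a - e / 2"] assms(1) e by simp
  have 3: "eventually (\<lambda>n. d n < e / 2) sequentially"
    using assms(3) e(1) by (intro order_tendstoD(2)) auto
  have "frequently (\<lambda>n. b n < linf b + e \<and> (linf a - e / 2 < a n \<and> d n < e / 2 \<and> a n \<le> b n + d n)) sequentially"
    by (rule frequently_eventually_frequently[OF 1]) (intro eventually_conj 2 3 assms(4))
  then obtain n where "b n < linf b + e" "linf a - e / 2 < a n" "d n < e / 2" "a n \<le> b n + d n"
    using frequently_ex by blast
  with e show False by linarith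
qed

text \<open>\<open>- linf (\<lambda>n. - a n)\<close> is the limsup, so this is liminf below limsup;
  \<open>convergent_linf\<close> is the case of equality.\<close>

lemma linf_add_uminus_le_0:
  assumes "\<And>n. \<bar>a n\<bar> \<le> C"
  shows "linf a + linf (\<lambda>n. - a n) \<le> 0"
proof (rule ccontr)
  assume H: "\<not> ?thesis"
  define e where "e = (linf a + linf (\<lambda>n. - a n)) / 2"
  have e: "e > 0" using H by (simp add: e_def)
  have "eventually (\<lambda>n. linf a - e < a n) sequentially"
    by (rule eventually_gt_linf[OF assms]) (use e in simp)
  moreover have "eventually (\<lambda>n. linf (\<lambda>n. - a n) - e < - a n) sequentially"
    by (rule eventually_gt_linf[where C=C]) (use e assms in auto)
  ultimately have "eventually (\<lambda>n. False) sequentially"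
    by eventually_elim (use e in \<open>auto simp: e_def field_simps\<close>)
  then show False by simp
qed

lemma convergent_linf:
  assumes "\<And>n. \<bar>a n\<bar> \<le> C" "linf a + linf (\<lambda>n. - a n) = 0"
  shows "convergent a"
proof -
  have "a \<longlonglongrightarrow> linf a"
  proof (rule order_tendstoI)
    fix c assume "c < linf a" then show "eventually (\<lambda>n. c < a n) sequentially"
      by (rule eventually_gt_linf[OF assms(1)])
  next
    fix c assume "linf a < c"
    then have "eventually (\<lambda>n. - c < - a n) sequentially"
      by (intro eventually_gt_linf[where C=C]) (use assms in auto)
    then show "eventually (\<lambda>n. a n < c) sequentially" by simp
  qed
  then show ?thesis by (rule convergentI)
qed

lemma borel_measurable_linf [measurable]:
  assumes [measurable]: "\<And>n. a n \<in> borel_measurable M"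
  shows "(\<lambda>x. linf (\<lambda>n. a n x)) \<in> borel_measurable M"
  unfolding linf_def by measurable

text \<open>Steele's covering argument: good positions start blocks on which \<open>G\<close> grows at rate at most \<open>c\<close>,
  and each bad position is skipped at bounded cost.\<close>

lemma subadditive_block_bound:
  fixes G :: "nat \<Rightarrow> nat \<Rightarrow> real"
  assumes sub: "\<And>k a b. G k (a + b) \<le> G k a + G (k + a) b"
    and bd: "\<And>k l. G k l \<le> C * real l"
    and good: "\<And>k. k \<notin> B \<Longrightarrow> \<exists>l\<ge>1. l \<le> N \<and> G k l \<le> real l * c"
    and c: "\<bar>c\<bar> \<le> D" and C: "0 \<le> C"
  shows "G k n \<le> real n * c + (C + D) * real (card (B \<inter> {k..<k+n})) + (C + D) * real N"
proof (induction n arbitrary: k rule: less_induct)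
  case (less n)
  have D: "0 \<le> D" using c by linarith
  show ?case
  proof (cases "n \<le> N")
    case True
    \<comment> \<open>A stretch of length at most \<open>N\<close> need not contain a complete
      block; the last summand of the bound pays for it.\<close>
    have "G k n - real n * c \<le> C * real n + D * real n"
      using bd[of k n] c mult_left_mono[of "- c" D "real n"] by (simp add: algebra_simps abs_le_iff)
    also have "\<dots> \<le> (C + D) * real N"
      using True C D by (simp add: distrib_right add_mono mult_left_mono)
    moreover have "0 \<le> (C + D) * real (card (B \<inter> {k..<k+n}))"
      using C D by simp
    ultimately show ?thesis by linarith
  next
    case False
    show ?thesis
    proof (cases "k \<in> B")
      case True
      have n: "n = 1 + (n - 1)" "n - 1 < n" using False by auto
      have card: "card (B \<inter> {k..<k+n}) = Suc (card (B \<inter> {k+1..<k+1+(n-1)}))"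
      proof -
        have "B \<inter> {k..<k+n} = insert k (B \<inter> {k+1..<k+1+(n-1)})"
          using n True by auto
        then show ?thesis by simp
      qed
      have "G k n \<le> G k 1 + G (k + 1) (n - 1)"
        using sub[of k 1 "n - 1"] n(1) by simp
      also have "\<dots> \<le> C + (real (n - 1) * c + (C + D) * real (card (B \<inter> {k+1..<k+1+(n-1)})) + (C + D) * real N)"
        using bd[of k 1] less.IH[OF n(2), of "k+1"] by (intro add_mono) auto
      also have "\<dots> \<le> real n * c + (C + D) * real (card (B \<inter> {k..<k+n})) + (C + D) * real N"
        unfolding card using n c by (auto simp: algebra_simps of_nat_diff)
      finally show ?thesis .
    next
      case notB: False
      obtain l where l: "l \<ge> 1" "l \<le> N" "G k l \<le> real l * c"
        using good[OF notB] by blast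
      have n: "n = l + (n - l)" "n - l < n" using False l by auto
      have card: "card (B \<inter> {k+l..<k+l+(n-l)}) \<le> card (B \<inter> {k..<k+n})"
        using n by (intro card_mono) auto
      have "G k n \<le> G k l + G (k + l) (n - l)"
        using sub[of k l "n - l"] n(1) by simp
      also have "\<dots> \<le> real l * c + (real (n - l) * c + (C + D) * real (card (B \<inter> {k+l..<k+l+(n-l)})) + (C + D) * real N)"
        using l(3) less.IH[OF n(2), of "k+l"] by (intro add_mono) auto
      also have "\<dots> \<le> real l * c + (real (n - l) * c + (C + D) * real (card (B \<inter> {k..<k+n})) + (C + D) * real N)"
        using card C D by (intro add_mono mult_left_mono order_refl) auto
      also have "\<dots> = real n * c + (C + D) * real (card (B \<inter> {k..<k+n})) + (C + D) * real N"
        using n by (simp add: algebra_simps of_nat_diff)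
      finally show ?thesis .
    qed
  qed
qed

text \<open>For each offset \<open>r < m\<close>, cutting the interval into blocks of length
  \<open>m\<close> bounds \<open>G k n\<close>; over all \<open>m\<close> offsets every window of
  length \<open>m\<close> occurs once. \<open>S\<close> collects the tails left after the offsets:
  splitting one block off its longest tail turns the family at \<open>k\<close> into the family at
  \<open>k + 1\<close>. The error is \<open>C * m\<close> per offset for the initial piece, and
  twice that for the short tails at the end.\<close>

lemma subadditive_average_bound:
  fixes G :: "nat \<Rightarrow> nat \<Rightarrow> real"
  assumes sub: "\<And>k a b. G k (a + b) \<le> G k a + G (k + a) b"
    and bd: "\<And>k l. \<bar>G k l\<bar> \<le> C * real l" and C: "0 \<le> C" and "m \<le> n"
  shows "real m * G k n \<le> (\<Sum>j<n. G (k + j) m) + 3 * C * (real m)\<^sup>2"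
proof -
  define S where "S k n = (\<Sum>r<m. G (k + r) (n - r))" for k n
  have S: "S k n \<le> (\<Sum>j<n. G (k + j) m) + 2 * C * (real m)\<^sup>2" for k n
  proof (induction n arbitrary: k)
    case 0
    have "S k 0 \<le> 0"
      unfolding S_def using bd[of _ 0] by (intro sum_nonpos) (auto dest: abs_le_D1)
    also have "0 \<le> 2 * C * (real m)\<^sup>2" using C by simp
    finally show ?case by simp
  next
    case (Suc n)
    show ?case
    proof (cases "m \<le> Suc n")
      case True
      show ?thesis
      proof (cases m)
        case 0
        then show ?thesis using bd[of _ 0] by (simp add: S_def sum_nonneg)
      next
        case (Suc m')
        have "S k (Suc n) = G k (Suc n) + (\<Sum>r<m'. G (k + Suc r) (Suc n - Suc r))"
          unfolding S_def Suc by (subst sum.lessThan_Suc_shift) simp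
        also have "G k (Suc n) \<le> G k m + G (k + m) (Suc n - m)"
          using sub[of k m "Suc n - m"] True by simp
        also have "G k m + G (k + m) (Suc n - m) + (\<Sum>r<m'. G (k + Suc r) (Suc n - Suc r))
            = G k m + S (k + 1) n"
          unfolding S_def Suc by simp
        also have "\<dots> \<le> G k m + ((\<Sum>j<n. G (k + 1 + j) m) + 2 * C * (real m)\<^sup>2)"
          using Suc.IH[of "k + 1"] by simp
        also have "\<dots> = (\<Sum>j<Suc n. G (k + j) m) + 2 * C * (real m)\<^sup>2"
          by (subst sum.lessThan_Suc_shift) simp
        finally show ?thesis by simp
      qed
    next
      case False
      \<comment> \<open>With fewer than \<open>m\<close> positions left, the tails sum to at most
        \<open>C * m^2\<close> and the windows to at least the negative of it.\<close>
      have "S k (Suc n) \<le> (\<Sum>r<m. C * real m)"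
        unfolding S_def
      proof (rule sum_mono)
        fix r
        have "G (k + r) (Suc n - r) \<le> C * real (Suc n - r)"
          using bd[of "k+r" "Suc n - r"] by linarith
        also have "\<dots> \<le> C * real m" using False C by (intro mult_left_mono) auto
        finally show "G (k + r) (Suc n - r) \<le> C * real m" .
      qed
      moreover have "(\<Sum>j<Suc n. - (C * real m)) \<le> (\<Sum>j<Suc n. G (k + j) m)"
        using bd[of _ m] by (intro sum_mono) (smt (verit))
      moreover have "(\<Sum>j<Suc n. C * real m) \<le> (\<Sum>j<m. C * real m)"
        using False C by (intro sum_mono2) auto
      ultimately show ?thesis by (simp add: sum_negf power2_eq_square algebra_simps)
    qed
  qed
  have "real m * G k n = (\<Sum>r<m. G k n)" by simp
  also have "\<dots> \<le> (\<Sum>r<m. C * real m + G (k + r) (n - r))"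
  proof (rule sum_mono)
    fix r assume r: "r \<in> {..<m}"
    have "G k n \<le> G k r + G (k + r) (n - r)"
      using sub[of k r "n - r"] r \<open>m \<le> n\<close> by simp
    moreover have "G k r \<le> C * real r" using bd[of k r] by linarith
    moreover have "C * real r \<le> C * real m" using r C by (intro mult_left_mono) auto
    ultimately show "G k n \<le> C * real m + G (k + r) (n - r)" by linarith
  qed
  also have "\<dots> = C * (real m)\<^sup>2 + S k n"
    by (simp add: sum.distrib S_def power2_eq_square)
  finally show ?thesis using S[of k n] by simp
qed


text \<open>Subadditivity gives only one half of \<open>g_shift\<close>. The two-sided bound makes
  the liminf of \<open>g n / n\<close> invariant under \<open>T\<close> at every point, with no
  exceptional null set.\<close>

locale bounded_subadditive = prob_space M for M :: "'a measure" +
  fixes T :: "'a \<Rightarrow> 'a" and g :: "nat \<Rightarrow> 'a \<Rightarrow> real" and C :: real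
  assumes T_measurable [measurable]: "T \<in> measurable M M"
    and T_distr: "distr M M T = M"
    and g_measurable [measurable]: "\<And>n. g n \<in> borel_measurable M"
    and g_subadditive: "\<And>m n \<omega>. \<omega> \<in> space M \<Longrightarrow> g (m + n) \<omega> \<le> g m \<omega> + g n ((T ^^ m) \<omega>)"
    and g_bound: "\<And>n \<omega>. \<omega> \<in> space M \<Longrightarrow> \<bar>g n \<omega>\<bar> \<le> C * real n"
    and g_shift: "\<And>n \<omega>. \<omega> \<in> space M \<Longrightarrow> \<bar>g (Suc n) \<omega> - g n (T \<omega>)\<bar> \<le> C"
begin

lemma C_nonneg: "0 \<le> C"
proof -
  obtain \<omega> where "\<omega> \<in> space M" using not_empty by blast
  from g_bound[OF this, of 1] show ?thesis by simp
qed

lemma T_space: "\<omega> \<in> space M \<Longrightarrow> T \<omega> \<in> space M"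
  using measurable_space[OF T_measurable] .

lemma T_pow_measurable [measurable]: "(T ^^ n) \<in> measurable M M"
  by (induction n) (simp_all add: measurable_comp[OF _ T_measurable, unfolded comp_def])

lemma T_pow_space: "\<omega> \<in> space M \<Longrightarrow> (T ^^ n) \<omega> \<in> space M"
  using measurable_space[OF T_pow_measurable] .

lemma T_pow_distr: "distr M M (T ^^ n) = M"
proof (induction n)
  case (Suc n)
  have "distr M M (T ^^ Suc n) = distr (distr M M (T ^^ n)) M T"
    by (subst distr_distr) (auto simp: comp_def)
  then show ?case using Suc T_distr by (simp del: funpow.simps)
qed (simp add: distr_id)

lemma integral_T_pow:
  fixes h :: "'a \<Rightarrow> real"
  assumes [measurable]: "h \<in> borel_measurable M"
  shows "(\<integral>\<omega>. h ((T ^^ n) \<omega>) \<partial>M) = (\<integral>\<omega>. h \<omega> \<partial>M)"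
  by (subst (2) T_pow_distr[of n, symmetric]) (simp add: integral_distr)

lemma integrable_bounded:
  fixes h :: "'a \<Rightarrow> real"
  assumes "h \<in> borel_measurable M" "\<And>\<omega>. \<omega> \<in> space M \<Longrightarrow> \<bar>h \<omega>\<bar> \<le> B"
  shows "integrable M h"
  by (rule integrable_const_bound[of _ B]) (use assms in auto)

lemma g_integrable: "integrable M (g n)"
  by (rule integrable_bounded) (use g_bound in auto)

definition low :: "'a \<Rightarrow> real" where
  "low \<omega> = linf (\<lambda>n. g n \<omega> / real n)"

lemma g_avg_bound: "\<omega> \<in> space M \<Longrightarrow> \<bar>g n \<omega> / real n\<bar> \<le> C"
  using g_bound[of \<omega> n] C_nonneg by (cases "n = 0") (auto simp: field_simps)

lemma low_measurable [measurable]: "low \<in> borel_measurable M"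
  unfolding low_def by measurable

lemma low_bound: "\<omega> \<in> space M \<Longrightarrow> \<bar>low \<omega>\<bar> \<le> C"
  unfolding low_def by (rule ereal_linf(2)) (rule g_avg_bound)

lemma low_integrable: "integrable M low"
  by (rule integrable_bounded) (use low_bound in auto)

lemma g_shift_avg:
  assumes "\<omega> \<in> space M" "n \<ge> 1"
  shows "\<bar>g (Suc n) \<omega> / real (Suc n) - g n (T \<omega>) / real n\<bar> \<le> 2 * C / real (Suc n)"
proof -
  have "g (Suc n) \<omega> / real (Suc n) - g n (T \<omega>) / real n
      = ((g (Suc n) \<omega> - g n (T \<omega>)) - g n (T \<omega>) / real n) / real (Suc n)"
    using assms(2) by (simp add: field_simps)
  moreover have "\<bar>(g (Suc n) \<omega> - g n (T \<omega>)) - g n (T \<omega>) / real n\<bar> \<le> 2 * C"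
    using g_shift[OF assms(1), of n] g_avg_bound[OF T_space[OF assms(1)], of n] by linarith
  ultimately show ?thesis by (simp add: divide_right_mono)
qed

lemma linf_Suc:
  assumes "\<And>n. \<bar>a n\<bar> \<le> B"
  shows "linf (\<lambda>n. a (Suc n)) = linf a"
  unfolding linf_def using liminf_shift[of "\<lambda>n. ereal (a n)"] by simp

lemma low_T:
  assumes "\<omega> \<in> space M"
  shows "low (T \<omega>) = low \<omega>"
proof -
  have d: "(\<lambda>n. 2 * C / real (Suc n)) \<longlonglongrightarrow> 0"
    by real_asymp
  have le: "eventually (\<lambda>n. g (Suc n) \<omega> / real (Suc n) \<le> g n (T \<omega>) / real n + 2 * C / real (Suc n)
      \<and> g n (T \<omega>) / real n \<le> g (Suc n) \<omega> / real (Suc n) + 2 * C / real (Suc n)) sequentially"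
    using eventually_ge_at_top[of 1]
    by eventually_elim (use g_shift_avg[OF assms] in \<open>auto simp: abs_le_iff algebra_simps\<close>)
  have "low \<omega> = linf (\<lambda>n. g (Suc n) \<omega> / real (Suc n))"
    unfolding low_def by (subst linf_Suc[of "\<lambda>n. g n \<omega> / real n" C]) (use g_avg_bound[OF assms] in auto)
  also have "\<dots> = low (T \<omega>)"
    unfolding low_def
    by (intro antisym linf_le_linfI[OF _ _ d, where C=C and C'=C])
      (use g_avg_bound[OF assms] g_avg_bound[OF T_space[OF assms]] le in \<open>auto elim: eventually_mono simp del: abs_divide of_nat_Suc\<close>)
  finally show ?thesis by simp
qed

lemma low_T_pow: "\<omega> \<in> space M \<Longrightarrow> low ((T ^^ n) \<omega>) = low \<omega>"
  by (induction n) (auto simp: low_T T_pow_space)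

text \<open>The block bound is applied along an orbit with target rate \<open>low + e\<close>, which
  is the same at all its points because \<open>low\<close> is invariant. After integration the
  expected number of bad positions is \<open>n\<close> times the measure of \<open>A N\<close>,
  because \<open>T\<close> preserves the measure. Dividing by \<open>n\<close> and letting
  \<open>n\<close>, then \<open>N\<close> tend to infinity and \<open>e\<close> to 0 gives the
  claim.\<close>

lemma low_lower_bound:
  assumes \<gamma>: "\<And>n. n \<ge> 1 \<Longrightarrow> \<gamma> * real n \<le> (\<integral>\<omega>. g n \<omega> \<partial>M)"
  shows "\<gamma> \<le> (\<integral>\<omega>. low \<omega> \<partial>M)"
proof (rule field_le_epsilon)
  fix e :: real assume e: "e > 0"
  \<comment> \<open>The bad points, where no block length up to \<open>N\<close> achieves the rate.
    They decrease to the empty set, since some length always undercuts the liminf plus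
    \<open>e\<close>.\<close>
  define A where "A N = {\<omega> \<in> space M. \<forall>l\<in>{1..N}. real l * (low \<omega> + e) < g l \<omega>}" for N :: nat
  have A [measurable]: "A N \<in> sets M" for N
  proof -
    have "{\<omega> \<in> space M. real l * (low \<omega> + e) < g l \<omega>} \<in> sets M" for l
      by measurable
    then show ?thesis
      unfolding A_def by (intro sets.sets_Collect_finite_All) auto
  qed
  have "(\<lambda>N. measure M (A N)) \<longlonglongrightarrow> measure M (\<Inter>N. A N)"
    by (rule finite_Lim_measure_decseq) (auto simp: A_def decseq_def)
  moreover have "(\<Inter>N. A N) = {}"
  proof -
    have "\<exists>l\<ge>1. g l \<omega> \<le> real l * (low \<omega> + e)" if "\<omega> \<in> space M" for \<omega>
    proof -
      have "frequently (\<lambda>n. g n \<omega> / real n < low \<omega> + e) sequentially"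
        unfolding low_def by (rule frequently_lt_linf) (use that e g_avg_bound in auto)
      from frequently_eventually_frequently[OF this eventually_ge_at_top[of 1]]
      obtain n where "g n \<omega> / real n < low \<omega> + e" "n \<ge> 1"
        by (auto dest: frequently_ex)
      then show ?thesis by (intro exI[of _ n]) (auto simp: field_simps)
    qed
    then have "\<exists>l. \<omega> \<notin> A l" if \<omega>: "\<omega> \<in> space M" for \<omega>
    proof -
      obtain l where "l \<ge> 1" "g l \<omega> \<le> real l * (low \<omega> + e)"
        using \<open>\<And>\<omega>. \<omega> \<in> space M \<Longrightarrow> _\<close> \<omega> by blast
      then have "\<omega> \<notin> A l" by (auto simp: A_def not_less intro!: bexI[of _ l])
      then show ?thesis ..
    qed
    then show ?thesis by (auto simp: A_def)
  qed
  ultimately have lim: "(\<lambda>N. measure M (A N)) \<longlonglongrightarrow> 0" by simp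
  \<comment> \<open>This is the constant \<open>C + D\<close> of the block bound, with
    \<open>D = C + e\<close> bounding the rate \<open>low + e\<close>.\<close>
  let ?D = "2 * C + e"
  have D: "?D \<ge> 0" using C_nonneg e by simp
  have main: "\<gamma> \<le> (\<integral>\<omega>. low \<omega> \<partial>M) + e + ?D * measure M (A N)" for N
  proof (rule field_le_epsilon)
    fix e' :: real assume e': "e' > 0"
    \<comment> \<open>So long that the unfinished last block contributes at most \<open>e'\<close>
      to the average.\<close>
    obtain n :: nat where n: "n \<ge> 1" "?D * real N / e' \<le> real n"
      using real_arch_simple[of "max 1 (?D * real N / e')"] by auto
    have pt: "g n \<omega> \<le> real n * (low \<omega> + e) + ?D * (\<Sum>j<n. indicator (A N) ((T ^^ j) \<omega>)) + ?D * real N"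
      if \<omega>: "\<omega> \<in> space M" for \<omega>
    proof -
      have "g n ((T ^^ 0) \<omega>) \<le> real n * (low \<omega> + e)
          + (C + (C + e)) * real (card ({j. (T ^^ j) \<omega> \<in> A N} \<inter> {0..<0+n})) + (C + (C + e)) * real N"
      proof (rule subadditive_block_bound[where G="\<lambda>k l. g l ((T ^^ k) \<omega>)"])
        show "g (a + b) ((T ^^ k) \<omega>) \<le> g a ((T ^^ k) \<omega>) + g b ((T ^^ (k + a)) \<omega>)" for k a b
          using g_subadditive[OF T_pow_space[OF \<omega>], of a b k] by (simp add: funpow_add add.commute[of k a])
        show "g l ((T ^^ k) \<omega>) \<le> C * real l" for k l
          using g_bound[OF T_pow_space[OF \<omega>], of l k] by simp
        show "\<exists>l\<ge>1. l \<le> N \<and> g l ((T ^^ k) \<omega>) \<le> real l * (low \<omega> + e)"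
          if "k \<notin> {j. (T ^^ j) \<omega> \<in> A N}" for k
          using that \<omega> by (auto simp: A_def T_pow_space low_T_pow not_less)
        show "\<bar>low \<omega> + e\<bar> \<le> C + e" using low_bound[OF \<omega>] e by linarith
        show "0 \<le> C" by (rule C_nonneg)
      qed
      moreover have "real (card ({j. (T ^^ j) \<omega> \<in> A N} \<inter> {0..<0+n})) = (\<Sum>j<n. indicator (A N) ((T ^^ j) \<omega>))"
      proof -
        have "(\<Sum>j<n. indicator (A N) ((T ^^ j) \<omega>)) = (\<Sum>j<n. indicator {j. (T ^^ j) \<omega> \<in> A N} j :: real)"
          by (intro sum.cong) (auto simp: indicator_def)
        also have "\<dots> = real (card ({j. (T ^^ j) \<omega> \<in> A N} \<inter> {0..<0+n}))"
          using sum.inter_restrict[of "{..<n}" "\<lambda>_. 1 :: real" "{j. (T ^^ j) \<omega> \<in> A N}"]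
          by (simp add: indicator_def of_bool_def Int_commute atLeast0LessThan)
        finally show ?thesis by simp
      qed
      ultimately show ?thesis by (simp add: algebra_simps)
    qed
    have int1: "integrable M (\<lambda>\<omega>. indicator (A N) ((T ^^ j) \<omega>) :: real)" for j
      by (rule integrable_bounded[of _ 1]) (auto simp: indicator_def)
    have "\<gamma> * real n \<le> (\<integral>\<omega>. g n \<omega> \<partial>M)" using \<gamma>[OF n(1)] .
    also have "\<dots> \<le> (\<integral>\<omega>. real n * (low \<omega> + e) + ?D * (\<Sum>j<n. indicator (A N) ((T ^^ j) \<omega>)) + ?D * real N \<partial>M)"
      by (intro integral_mono g_integrable) (use pt int1 low_integrable in auto)
    also have "\<dots> = real n * ((\<integral>\<omega>. low \<omega> \<partial>M) + e) + ?D * (\<Sum>j<n. (\<integral>\<omega>. indicator (A N) ((T ^^ j) \<omega>) \<partial>M)) + ?D * real N"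
      using int1 low_integrable by (simp add: integral_sum prob_space)
    also have "(\<Sum>j<n. (\<integral>\<omega>. indicator (A N) ((T ^^ j) \<omega>) \<partial>M)) = (\<Sum>j<n. measure M (A N))"
      by (intro sum.cong refl, subst integral_T_pow) auto
    finally have "\<gamma> * real n \<le> real n * ((\<integral>\<omega>. low \<omega> \<partial>M) + e + ?D * measure M (A N)) + ?D * real N"
      by (simp add: algebra_simps)
    also have "?D * real N \<le> e' * real n"
      using n(2) e' by (simp add: field_simps)
    finally have "\<gamma> * real n \<le> ((\<integral>\<omega>. low \<omega> \<partial>M) + e + ?D * measure M (A N) + e') * real n"
      by (simp add: algebra_simps)
    then show "\<gamma> \<le> (\<integral>\<omega>. low \<omega> \<partial>M) + e + ?D * measure M (A N) + e'"
      using n(1) by simp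
  qed
  have "(\<lambda>N. (\<integral>\<omega>. low \<omega> \<partial>M) + e + ?D * measure M (A N)) \<longlonglongrightarrow> (\<integral>\<omega>. low \<omega> \<partial>M) + e + ?D * 0"
    by (intro tendsto_intros lim)
  then show "\<gamma> \<le> (\<integral>\<omega>. low \<omega> \<partial>M) + e"
    using main by (auto intro!: LIMSEQ_le_const)
qed

text \<open>The Birkhoff sums of \<open>- g m\<close> are additive, so the lower bound for them is an upper bound for the
  averages of \<open>g\<close>; no separate ergodic theorem is needed.\<close>

lemma birkhoff_bounded_subadditive:
  assumes m: "m \<ge> 1"
  shows "bounded_subadditive M T (\<lambda>n \<omega>. \<Sum>j<n. - (g m ((T ^^ j) \<omega>) / real m)) C"
proof
  show "(\<Sum>j<k + n. - (g m ((T ^^ j) \<omega>) / real m))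
      \<le> (\<Sum>j<k. - (g m ((T ^^ j) \<omega>) / real m)) + (\<Sum>j<n. - (g m ((T ^^ j) ((T ^^ k) \<omega>)) / real m))" for k n \<omega>
  proof (induction n)
    case (Suc n)
    have "(T ^^ (k + n)) \<omega> = (T ^^ n) ((T ^^ k) \<omega>)"
      by (metis add.commute comp_apply funpow_add)
    then show ?case using Suc by simp
  qed simp
  show "\<bar>\<Sum>j<n. - (g m ((T ^^ j) \<omega>) / real m)\<bar> \<le> C * real n" if "\<omega> \<in> space M" for n \<omega>
  proof -
    have "\<bar>\<Sum>j<n. - (g m ((T ^^ j) \<omega>) / real m)\<bar> \<le> (\<Sum>j<n. C)"
      using g_avg_bound[OF T_pow_space[OF that], of m] by (intro order_trans[OF sum_abs] sum_mono) simp
    then show ?thesis by (simp add: mult.commute)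
  qed
  show "\<bar>(\<Sum>j<Suc n. - (g m ((T ^^ j) \<omega>) / real m)) - (\<Sum>j<n. - (g m ((T ^^ j) (T \<omega>)) / real m))\<bar> \<le> C"
    if "\<omega> \<in> space M" for n \<omega>
    using g_avg_bound[OF that, of m] by (subst sum.lessThan_Suc_shift) (simp add: funpow_swap1 del: funpow.simps(2) sum.lessThan_Suc add: funpow_Suc_right)
qed (use T_distr in auto)

definition upp :: "'a \<Rightarrow> real" where
  "upp \<omega> = - linf (\<lambda>n. - (g n \<omega> / real n))"

lemma upp_measurable [measurable]: "upp \<in> borel_measurable M"
  unfolding upp_def by measurable

lemma upp_bound: "\<omega> \<in> space M \<Longrightarrow> \<bar>upp \<omega>\<bar> \<le> C"
  unfolding upp_def abs_minus_cancel by (rule ereal_linf(2)) (use g_avg_bound in auto)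

lemma upp_integrable: "integrable M upp"
  by (rule integrable_bounded) (use upp_bound in auto)

text \<open>Up to an error of order \<open>m / n\<close>, the average \<open>g n / n\<close> lies
  below the Birkhoff average of \<open>g m / m\<close>. Negated, the liminf of the Birkhoff averages
  of \<open>- g m / m\<close> is at most \<open>- upp\<close>, and its integral is bounded below by
  that of \<open>- g m / m\<close>.\<close>

lemma integral_upp_le:
  assumes m: "m \<ge> 1"
  shows "(\<integral>\<omega>. upp \<omega> \<partial>M) * real m \<le> (\<integral>\<omega>. g m \<omega> \<partial>M)"
proof -
  interpret H: bounded_subadditive M T "\<lambda>n \<omega>. \<Sum>j<n. - (g m ((T ^^ j) \<omega>) / real m)" C
    by (rule birkhoff_bounded_subadditive[OF m])
  have le: "H.low \<omega> \<le> - upp \<omega>" if \<omega>: "\<omega> \<in> space M" for \<omega>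
  proof -
    have "H.low \<omega> \<le> linf (\<lambda>n. - (g n \<omega> / real n))"
      unfolding H.low_def
    proof (rule linf_le_linfI[where C=C and C'=C])
      show "(\<lambda>n. 3 * C * real m / real n) \<longlonglongrightarrow> 0" by real_asymp
      show "\<forall>\<^sub>F n in sequentially. (\<Sum>j<n. - (g m ((T ^^ j) \<omega>) / real m)) / real n
          \<le> - (g n \<omega> / real n) + 3 * C * real m / real n"
        using eventually_ge_at_top[of m]
      proof eventually_elim
        case (elim n)
        have "real m * g n ((T ^^ 0) \<omega>) \<le> (\<Sum>j<n. g m ((T ^^ (0 + j)) \<omega>)) + 3 * C * (real m)\<^sup>2"
        proof (rule subadditive_average_bound[where G="\<lambda>k l. g l ((T ^^ k) \<omega>)"])
          show "g (a + b) ((T ^^ k) \<omega>) \<le> g a ((T ^^ k) \<omega>) + g b ((T ^^ (k + a)) \<omega>)" for k a b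
            using g_subadditive[OF T_pow_space[OF \<omega>], of a b k] by (simp add: funpow_add add.commute[of k a])
        qed (use g_bound[OF T_pow_space[OF \<omega>]] C_nonneg elim in auto)
        then have "real m * g n \<omega> \<le> (\<Sum>j<n. g m ((T ^^ j) \<omega>)) + 3 * C * (real m)\<^sup>2" by simp
        then have "g n \<omega> \<le> ((\<Sum>j<n. g m ((T ^^ j) \<omega>)) + 3 * C * (real m)\<^sup>2) / real m"
          using m by (simp add: field_simps)
        also have "\<dots> = - (\<Sum>j<n. - (g m ((T ^^ j) \<omega>) / real m)) + 3 * C * real m"
          using m by (simp add: sum_negf sum_divide_distrib add_divide_distrib power2_eq_square)
        finally have "(\<Sum>j<n. - (g m ((T ^^ j) \<omega>) / real m)) \<le> - g n \<omega> + 3 * C * real m" by simp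
        from divide_right_mono[OF this, of "real n"] show ?case by (simp add: add_divide_distrib diff_divide_distrib)
      qed
    qed (use H.g_avg_bound[OF \<omega>] g_avg_bound[OF \<omega>] in auto)
    then show ?thesis by (simp add: upp_def)
  qed
  have "(\<integral>\<omega>. - (g m \<omega> / real m) \<partial>M) \<le> (\<integral>\<omega>. H.low \<omega> \<partial>M)"
  proof (rule H.low_lower_bound)
    fix n :: nat
    have int: "integrable M (\<lambda>\<omega>. - (g m ((T ^^ j) \<omega>) / real m))" for j
      by (rule integrable_bounded[of _ C]) (use g_avg_bound[OF T_pow_space] in auto)
    have "(\<integral>\<omega>. (\<Sum>j<n. - (g m ((T ^^ j) \<omega>) / real m)) \<partial>M) = (\<Sum>j<n. \<integral>\<omega>. - (g m ((T ^^ j) \<omega>) / real m) \<partial>M)"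
      by (rule Bochner_Integration.integral_sum) (rule int)
    also have "\<dots> = (\<Sum>j<n. \<integral>\<omega>. - (g m \<omega> / real m) \<partial>M)"
      by (intro sum.cong refl integral_T_pow) measurable
    finally show "(\<integral>\<omega>. - (g m \<omega> / real m) \<partial>M) * real n \<le> (\<integral>\<omega>. (\<Sum>j<n. - (g m ((T ^^ j) \<omega>) / real m)) \<partial>M)"
      by (simp add: mult.commute)
  qed
  also have "\<dots> \<le> (\<integral>\<omega>. - upp \<omega> \<partial>M)"
    by (intro integral_mono H.low_integrable) (use le upp_integrable in auto)
  finally show ?thesis using m by (simp add: field_simps)
qed

text \<open>The integral of \<open>upp\<close> is at most the mean of \<open>g m / m\<close> for
  each \<open>m\<close>, so it can serve as the constant of \<open>low_lower_bound\<close>. Hence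
  \<open>low\<close> and \<open>upp\<close>, which are ordered pointwise, have equal
  integrals.\<close>

theorem AE_convergent: "AE \<omega> in M. convergent (\<lambda>n. g n \<omega> / real n)"
proof -
  have "(\<integral>\<omega>. upp \<omega> \<partial>M) \<le> (\<integral>\<omega>. low \<omega> \<partial>M)"
    by (rule low_lower_bound) (rule integral_upp_le)
  moreover have nonneg: "low \<omega> \<le> upp \<omega>" if "\<omega> \<in> space M" for \<omega>
    using linf_add_uminus_le_0[of "\<lambda>n. g n \<omega> / real n" C] g_avg_bound[OF that] by (simp add: low_def upp_def)
  ultimately have "(\<integral>\<omega>. upp \<omega> - low \<omega> \<partial>M) = 0"
    using integral_mono[OF low_integrable upp_integrable nonneg]
    by (simp add: upp_integrable low_integrable)
  then have "AE \<omega> in M. upp \<omega> - low \<omega> = 0"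
    using nonneg by (subst (asm) integral_nonneg_eq_0_iff_AE) (auto intro!: AE_I2 upp_integrable low_integrable)
  then show ?thesis
    using AE_space
  proof eventually_elim
    case (elim \<omega>)
    then show ?case
      by (intro convergent_linf[of _ C]) (use g_avg_bound in \<open>auto simp: upp_def low_def\<close>)
  qed
qed

end

section \<open>Spectral theorem and roots of matrices\<close>

text \<open>The family is indexed by the coordinate type itself, so orthonormality alone already
  makes it a basis.\<close>

definition onb :: "('n::finite \<Rightarrow> real ^ 'n) \<Rightarrow> bool" where
  "onb b \<longleftrightarrow> (\<forall>i j. b i \<bullet> b j = (if i = j then 1 else 0))"

lemma onb_inner: "onb b \<Longrightarrow> b i \<bullet> b j = (if i = j then 1 else 0)"
  by (simp add: onb_def)

lemma onb_norm: "onb b \<Longrightarrow> norm (b i) = 1"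
  by (simp add: onb_def norm_eq_sqrt_inner)

lemma onb_expand:
  fixes b :: "'n::finite \<Rightarrow> real ^ 'n"
  assumes "onb b"
  shows "(\<Sum>i\<in>UNIV. (b i \<bullet> x) *\<^sub>R b i) = x"
proof -
  have inj: "inj b"
    using assms unfolding onb_def by (intro injI) (metis zero_neq_one)
  have "pairwise orthogonal (range b)"
    using assms by (auto simp: pairwise_def orthogonal_def onb_def)
  moreover have "0 \<notin> range b"
    using onb_norm[OF assms] by (metis norm_zero rangeE zero_neq_one)
  ultimately have "independent (range b)"
    by (rule pairwise_orthogonal_independent)
  moreover have "card (range b) = DIM(real ^ 'n)"
    using inj by (simp add: card_image)
  ultimately have "span (range b) = UNIV"
    using card_ge_dim_independent[of "range b" UNIV] by (auto simp: dim_UNIV)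
  then have "x \<in> span (range b)" by simp
  then show ?thesis
  proof (induction rule: span_induct)
    case base
    show ?case by (rule subspaceI) (auto simp: inner_add_right scaleR_add_left sum.distrib scaleR_sum_right[symmetric] scaleR_scaleR[symmetric] simp del: scaleR_scaleR)
  next
    case (step x)
    then obtain j where "x = b j" by auto
    then show ?case by (simp add: onb_inner[OF assms] if_distrib if_distribR cong: if_cong)
  qed
qed

lemma onb_matrix_eqI:
  fixes A B :: "real ^ 'n ^ 'n"
  assumes "onb b" "\<And>i. A *v b i = B *v b i"
  shows "A = B"
proof -
  have "A *v x = B *v x" for x
  proof -
    have "M *v x = (\<Sum>i\<in>UNIV. (b i \<bullet> x) *\<^sub>R (M *v b i))" for M :: "real ^ 'n ^ 'n"
      by (subst onb_expand[OF assms(1), of x, symmetric]) (simp add: matrix_vector_mult_scaleR linear_sum[OF matrix_vector_mul_linear])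
    then show ?thesis using assms(2) by simp
  qed
  then show ?thesis by (simp add: matrix_eq)
qed

lemma onb_reindex: "onb b \<Longrightarrow> bij \<pi> \<Longrightarrow> onb (b \<circ> \<pi>)"
  by (auto simp: onb_def bij_def inj_eq)

lemma symmetric_inner:
  fixes S :: "real ^ 'n ^ 'n"
  assumes "transpose S = S"
  shows "x \<bullet> (S *v y) = (S *v x) \<bullet> y"
  by (metis assms dot_lmul_matrix vector_transpose_matrix)

text \<open>A maximizer of the Rayleigh quotient on the unit sphere of \<open>U\<close> is an
  eigenvector: the residual \<open>w\<close> lies in \<open>U\<close> by invariance, and moving
  along it would otherwise increase the quotient.\<close>

lemma symmetric_eigenvector:
  fixes S :: "real ^ 'n ^ 'n"
  assumes S: "transpose S = S" and U: "subspace U" "\<And>x. x \<in> U \<Longrightarrow> S *v x \<in> U" "U \<noteq> {0}"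
  shows "\<exists>v\<in>U. norm v = 1 \<and> (\<exists>\<mu>. S *v v = \<mu> *\<^sub>R v)"
proof -
  let ?q = "\<lambda>x. x \<bullet> (S *v x)"
  let ?K = "U \<inter> sphere 0 1"
  have cont: "continuous_on ?K ?q"
    by (intro continuous_intros linear_continuous_on matrix_vector_mul_bounded_linear)
  have comp: "compact ?K"
    using closed_subspace[OF U(1)] by (intro closed_Int_compact) auto
  have hom: "x /\<^sub>R norm x \<in> ?K" if "x \<in> U" "x \<noteq> 0" for x
    using that U(1) by (auto simp: subspace_mul)
  obtain x where "x \<in> U" "x \<noteq> 0" using U(1,3) subspace_0 by blast
  then have "?K \<noteq> {}" using hom by blast
  then obtain v where v: "v \<in> ?K" "\<And>x. x \<in> ?K \<Longrightarrow> ?q x \<le> ?q v"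
    using continuous_attains_sup[OF comp _ cont] by blast
  define \<mu> where "\<mu> = ?q v"
  have le: "?q x \<le> \<mu> * (x \<bullet> x)" if "x \<in> U" for x
  proof (cases "x = 0")
    case False
    have "?q (x /\<^sub>R norm x) \<le> \<mu>" using v(2)[OF hom[OF that False]] by (simp add: \<mu>_def)
    also have "?q (x /\<^sub>R norm x) = ?q x / (x \<bullet> x)"
      by (simp add: matrix_vector_mult_scaleR power2_norm_eq_inner[symmetric] power2_eq_square divide_inverse)
    finally show ?thesis using False by (simp add: field_simps)
  qed simp
  define w where "w = S *v v - \<mu> *\<^sub>R v"
  have wU: "w \<in> U" using v(1) U by (auto simp: w_def subspace_diff subspace_mul)
  have vv: "v \<bullet> v = 1" using v(1) by (simp add: norm_eq_1)
  define K where "K = \<mu> * (w \<bullet> w) - ?q w"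
  \<comment> \<open>Maximality at \<open>v\<close>, tested at \<open>v + t *\<^sub>R w\<close>: the
    first-order gain cannot exceed the second-order loss.\<close>
  have ineq: "2 * t * (w \<bullet> w) \<le> t\<^sup>2 * K" for t
  proof -
    have "v + t *\<^sub>R w \<in> U" using v(1) wU U(1) by (auto intro: subspace_add subspace_mul)
    from le[OF this] have "?q v + 2 * t * (w \<bullet> (S *v v)) + t\<^sup>2 * ?q w \<le> \<mu> * (1 + 2 * t * (v \<bullet> w) + t\<^sup>2 * (w \<bullet> w))"
      using symmetric_inner[OF S, of v w]
      by (simp add: matrix_vector_right_distrib matrix_vector_mult_scaleR inner_add_left inner_add_right vv
          power2_eq_square inner_commute algebra_simps)
    moreover have "w \<bullet> (S *v v) = w \<bullet> w + \<mu> * (v \<bullet> w)"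
    proof -
      have "S *v v = w + \<mu> *\<^sub>R v" by (simp add: w_def)
      then show ?thesis by (simp add: inner_add_right inner_commute)
    qed
    ultimately show ?thesis by (simp add: K_def \<mu>_def algebra_simps)
  qed
  have "w \<bullet> w = 0"
  proof (rule ccontr)
    assume "w \<bullet> w \<noteq> 0"
    then have pos: "w \<bullet> w > 0" by simp
    \<comment> \<open>Small enough that \<open>t * K\<close> is at most
      \<open>w \<bullet> w\<close>, while the inequality demands twice as much.\<close>
    define t where "t = (w \<bullet> w) / (\<bar>K\<bar> + 1)"
    have t: "t > 0" "t * K \<le> w \<bullet> w"
    proof -
      show "t > 0" using pos by (simp add: t_def)
      have "t * K \<le> t * (\<bar>K\<bar> + 1)" using \<open>t > 0\<close> by (intro mult_left_mono) auto
      also have "\<dots> = w \<bullet> w" by (simp add: t_def)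
      finally show "t * K \<le> w \<bullet> w" .
    qed
    from ineq[of t] have "t * (2 * (w \<bullet> w)) \<le> t * (t * K)" by (simp add: power2_eq_square algebra_simps)
    then have "2 * (w \<bullet> w) \<le> t * K" using t(1) by simp
    then show False using t pos by linarith
  qed
  then have "S *v v = \<mu> *\<^sub>R v" by (simp add: w_def)
  then show ?thesis using v(1) by auto
qed

text \<open>An orthonormal set of eigenvectors of maximal size spans the space: its orthogonal
  complement is invariant, so a nonzero complement would supply one more eigenvector.\<close>

theorem spectral_theorem:
  fixes S :: "real ^ 'n ^ 'n"
  assumes S: "transpose S = S"
  obtains b :: "'n \<Rightarrow> real ^ 'n" and \<mu> where "onb b" "\<And>i. S *v b i = \<mu> i *\<^sub>R b i"
proof -
  define P where "P B \<longleftrightarrow> pairwise orthogonal B \<and> (\<forall>v\<in>B. norm v = 1 \<and> (\<exists>\<mu>. S *v v = \<mu> *\<^sub>R v))"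
    for B :: "(real ^ 'n) set"
  have fin: "finite B \<and> card B \<le> CARD('n)" if "P B" for B
  proof -
    have "0 \<notin> B" using that by (auto simp: P_def)
    then have "independent B"
      using that pairwise_orthogonal_independent by (auto simp: P_def)
    then show ?thesis using independent_bound_general[of B] dim_subset_UNIV[of B] by simp
  qed
  have "\<exists>B. P B \<and> (\<forall>B'. P B' \<longrightarrow> card B' \<le> card B)"
    by (rule ex_has_greatest_nat[of P "{}" card "CARD('n) + 1"]) (use fin in \<open>auto simp: P_def less_Suc_eq_le\<close>)
  then obtain B where B: "P B" "\<And>B'. P B' \<Longrightarrow> card B' \<le> card B" by blast
  define U where "U = {x. \<forall>v\<in>B. v \<bullet> x = 0}"
  have sub: "subspace U" by (auto simp: U_def subspace_def inner_add_right)
  have inv: "S *v x \<in> U" if "x \<in> U" for x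
    unfolding U_def
  proof safe
    fix v assume "v \<in> B"
    then obtain \<mu> where "S *v v = \<mu> *\<^sub>R v" using B(1) by (auto simp: P_def)
    then show "v \<bullet> (S *v x) = 0"
      using that \<open>v \<in> B\<close> by (simp add: symmetric_inner[OF S] U_def)
  qed
  have U0: "U = {0}"
  proof (rule ccontr)
    assume "U \<noteq> {0}"
    then obtain v where v: "v \<in> U" "norm v = 1" "\<exists>\<mu>. S *v v = \<mu> *\<^sub>R v"
      using symmetric_eigenvector[OF S sub inv] by blast
    have "P (insert v B)"
      using B(1) v by (auto simp: P_def U_def pairwise_insert orthogonal_def inner_commute)
    moreover have "v \<notin> B"
      using v(1,2) by (auto simp: U_def norm_eq_1)
    ultimately have "card (insert v B) \<le> card B" "finite B" using B(2) fin[OF B(1)] by blast+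
    then show False using \<open>v \<notin> B\<close> by simp
  qed
  have "span B = UNIV"
  proof -
    have "x \<in> span B" for x
    proof -
      obtain y z where yz: "y \<in> span B" "\<And>w. w \<in> span B \<Longrightarrow> orthogonal z w" "x = y + z"
        using orthogonal_subspace_decomp_exists by blast
      then have "z \<in> U" by (auto simp: U_def orthogonal_def inner_commute span_base)
      then show ?thesis using yz U0 by auto
    qed
    then show ?thesis by auto
  qed
  moreover have "independent B"
    using B(1) by (intro pairwise_orthogonal_independent) (auto simp: P_def)
  ultimately have "card B = CARD('n)"
    using dim_eq_card_independent[of B] by (metis DIM_cart DIM_real dim_UNIV dim_span mult.right_neutral)
  then obtain b where b: "bij_betw b (UNIV :: 'n set) B"
    using fin[OF B(1)] finite_same_card_bij[of "UNIV :: 'n set" B] by auto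
  have bB: "b i \<in> B" for i using b bij_betwE by blast
  have "b i \<bullet> b j = (if i = j then 1 else 0)" for i j
  proof (cases "i = j")
    case True
    then show ?thesis using bB[of j] B(1) by (auto simp: P_def norm_eq_1)
  next
    case False
    then have "b i \<noteq> b j" using b by (metis bij_betw_imp_inj_on injD)
    then show ?thesis using bB[of i] bB[of j] B(1) False by (auto simp: P_def pairwise_def orthogonal_def)
  qed
  then have "onb b" by (simp add: onb_def)
  moreover have "\<exists>\<mu>. \<forall>i. S *v b i = \<mu> i *\<^sub>R b i"
    using B(1) bB by (intro choice) (auto simp: P_def)
  ultimately show ?thesis using that by blast
qed

section \<open>Ordered singular values and roots of positive semidefinite matrices\<close>

lemma ex_decreasing_reindex:
  fixes \<mu> :: "'n::finite \<Rightarrow> real"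
  assumes e: "bij_betw e {..<CARD('n)} UNIV"
  obtains \<pi> where "bij \<pi>" "\<And>j k. j \<le> k \<Longrightarrow> k < CARD('n) \<Longrightarrow> \<mu> (\<pi> (e k)) \<le> \<mu> (\<pi> (e j))"
proof -
  obtain xs0 :: "'n list" where xs0: "set xs0 = UNIV" "distinct xs0"
    using finite_distinct_list[of "UNIV :: 'n set"] by auto
  define xs where "xs = sort_key (\<lambda>i. - \<mu> i) xs0"
  have xs: "set xs = UNIV" "distinct xs" "sorted (map (\<lambda>i. - \<mu> i) xs)"
    using xs0 by (auto simp: xs_def)
  have len: "length xs = CARD('n)" using xs(1,2) distinct_card by fastforce
  define \<pi> where "\<pi> = (\<lambda>i. xs ! inv_into {..<CARD('n)} e i)"
  have "bij_betw ((!) xs) {..<CARD('n)} UNIV"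
    using bij_betw_nth[OF xs(2), of "{..<CARD('n)}" UNIV] len xs(1) by simp
  from bij_betw_trans[OF bij_betw_inv_into[OF e] this]
  have "bij \<pi>" by (simp add: \<pi>_def comp_def)
  moreover have "\<pi> (e k) = xs ! k" if "k < CARD('n)" for k
    using that e by (simp add: \<pi>_def bij_betw_inv_into_left)
  moreover have "\<mu> (xs ! k) \<le> \<mu> (xs ! j)" if "j \<le> k" "k < CARD('n)" for j k
    using sorted_nth_mono[OF xs(3), of j k] that len by simp
  ultimately show ?thesis by (intro that[of \<pi>]) auto
qed

text \<open>The index type has no order, so an enumeration \<open>e\<close> fixed in advance
  supplies the ranks. Using the same \<open>e\<close> for a whole sequence of matrices, an index
  always carries the singular value of the same rank.\<close>

lemma singular_values:
  fixes A :: "real ^ 'n ^ 'n"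
  assumes e: "bij_betw e {..<CARD('n)} UNIV" and A: "invertible A"
  shows "\<exists>b s. onb b \<and> (\<forall>i. (transpose A ** A) *v b i = (s i)\<^sup>2 *\<^sub>R b i) \<and> (\<forall>i. 0 < s i)
    \<and> (\<forall>j k. j \<le> k \<longrightarrow> k < CARD('n) \<longrightarrow> s (e k) \<le> s (e j))"
proof -
  let ?S = "transpose A ** A"
  have "transpose ?S = ?S" by (simp add: matrix_transpose_mul)
  then obtain b \<mu> where b: "onb b" "\<And>i. ?S *v b i = \<mu> i *\<^sub>R b i"
    using spectral_theorem by blast
  obtain \<pi> where \<pi>: "bij \<pi>" "\<And>j k. j \<le> k \<Longrightarrow> k < CARD('n) \<Longrightarrow> \<mu> (\<pi> (e k)) \<le> \<mu> (\<pi> (e j))"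
    using ex_decreasing_reindex[OF e] by blast
  have pos: "\<mu> i > 0" for i
  proof -
    have "A *v b i \<noteq> 0"
    proof
      assume "A *v b i = 0"
      moreover obtain B where "B ** A = mat 1" using A by (auto simp: invertible_def)
      ultimately have "b i = 0"
        by (metis matrix_vector_mul_assoc matrix_vector_mul_lid matrix_vector_mult_0_right)
      then show False using onb_norm[OF b(1), of i] by simp
    qed
    then have "0 < (A *v b i) \<bullet> (A *v b i)" by simp
    also have "\<dots> = b i \<bullet> (?S *v b i)"
      by (metis dot_lmul_matrix matrix_vector_mul_assoc transpose_transpose vector_transpose_matrix)
    also have "\<dots> = \<mu> i" using b by (simp add: onb_def)
    finally show ?thesis .
  qed
  show ?thesis
    by (rule exI[of _ "b \<circ> \<pi>"], rule exI[of _ "\<lambda>i. sqrt (\<mu> (\<pi> i))"])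
      (use b pos \<pi> onb_reindex in \<open>auto simp: less_imp_le\<close>)
qed

definition outer :: "real ^ 'n \<Rightarrow> real ^ 'n \<Rightarrow> real ^ 'n ^ 'n" where
  "outer u w = (\<chi> a c. u $ a * w $ c)"

lemma outer_vector: "outer u w *v x = (w \<bullet> x) *\<^sub>R u"
  by (simp add: outer_def vec_eq_iff matrix_vector_mult_def inner_vec_def sum_distrib_left sum_distrib_right algebra_simps)

definition spec_matrix :: "('n::finite \<Rightarrow> real ^ 'n) \<Rightarrow> ('n \<Rightarrow> real) \<Rightarrow> real ^ 'n ^ 'n" where
  "spec_matrix b r = (\<Sum>i\<in>UNIV. r i *\<^sub>R outer (b i) (b i))"

lemma matrix_vector_mult_sum_left:
  fixes A :: "'a \<Rightarrow> real ^ 'n ^ 'm"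
  shows "(\<Sum>i\<in>I. A i) *v x = (\<Sum>i\<in>I. A i *v x)"
  by (induction I rule: infinite_finite_induct) (auto simp: matrix_vector_mult_add_rdistrib)

lemma spec_matrix_vector: "spec_matrix b r *v x = (\<Sum>i\<in>UNIV. (r i * (b i \<bullet> x)) *\<^sub>R b i)"
  by (simp add: spec_matrix_def matrix_vector_mult_sum_left outer_vector scaleR_matrix_vector_assoc[symmetric])

lemma spec_matrix_eigen:
  assumes "onb b"
  shows "spec_matrix b r *v b i = r i *\<^sub>R b i"
  by (simp add: spec_matrix_vector onb_inner[OF assms] if_distrib if_distribR cong: if_cong)

lemma transpose_spec_matrix: "transpose (spec_matrix b r) = spec_matrix b r"
  by (simp add: spec_matrix_def outer_def transpose_def vec_eq_iff mult.commute)

lemma pos_semidef_spec_matrix: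
  assumes "\<And>i. 0 \<le> r i"
  shows "pos_semidef (spec_matrix b r)"
  unfolding pos_semidef_def
proof (intro conjI allI transpose_spec_matrix)
  fix v
  have "v \<bullet> (spec_matrix b r *v v) = (\<Sum>i\<in>UNIV. r i * (b i \<bullet> v)\<^sup>2)"
    by (simp add: spec_matrix_vector inner_sum_right power2_eq_square inner_commute mult.assoc)
  also have "\<dots> \<ge> 0" using assms by (intro sum_nonneg) auto
  finally show "0 \<le> v \<bullet> (spec_matrix b r *v v)" .
qed

lemma mat_pow_eigen:
  assumes "A *v v = \<mu> *\<^sub>R v"
  shows "mat_pow A k *v v = (\<mu> ^ k) *\<^sub>R v"
proof (induction k)
  case (Suc k)
  have "mat_pow A (Suc k) *v v = A *v (mat_pow A k *v v)"
    by (simp add: mat_pow_def matrix_vector_mul_assoc)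
  then show ?case using Suc assms by (simp add: matrix_vector_mult_scaleR)
qed (simp add: mat_pow_def)

text \<open>\<open>mat_root\<close> is a definite description, so uniqueness has to be shown. If
  \<open>B\<close> is another root with eigenbasis \<open>c\<close>, symmetry of \<open>S\<close>
  forces \<open>\<mu> i = \<beta> j ^ k\<close> whenever \<open>b i\<close> and \<open>c j\<close>
  are not orthogonal; hence both roots act on \<open>c j\<close> by the same factor.\<close>

lemma mat_root_spec:
  fixes S :: "real ^ 'n ^ 'n"
  assumes b: "onb b" "\<And>i. S *v b i = \<mu> i *\<^sub>R b i" and \<mu>: "\<And>i. 0 \<le> \<mu> i" and k: "k > 0"
  shows "mat_root k S = spec_matrix b (\<lambda>i. root k (\<mu> i))"
  unfolding mat_root_def
proof (rule the_equality)
  let ?R = "spec_matrix b (\<lambda>i. root k (\<mu> i))"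
  show "pos_semidef ?R \<and> mat_pow ?R k = S"
  proof
    show "pos_semidef ?R" using \<mu> k by (intro pos_semidef_spec_matrix) simp
    show "mat_pow ?R k = S"
      by (rule onb_matrix_eqI[OF b(1)])
        (simp add: mat_pow_eigen[OF spec_matrix_eigen[OF b(1)]] b(2) \<mu> k)
  qed
  fix B assume B: "pos_semidef B \<and> mat_pow B k = S"
  then obtain c \<beta> where c: "onb c" "\<And>i. B *v c i = \<beta> i *\<^sub>R c i"
    using spectral_theorem[of B] by (auto simp: pos_semidef_def)
  have \<beta>: "\<beta> j \<ge> 0" for j
  proof -
    have "0 \<le> c j \<bullet> (B *v c j)" using B by (simp add: pos_semidef_def)
    then show ?thesis using c by (simp add: onb_def)
  qed
  show "B = ?R"
  proof (rule onb_matrix_eqI[OF c(1)])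
    fix j
    have SS: "transpose S = S"
    proof -
      have "S = spec_matrix b \<mu>"
        by (rule onb_matrix_eqI[OF b(1)]) (simp add: b spec_matrix_eigen)
      then show ?thesis by (simp add: transpose_spec_matrix)
    qed
    have "S *v c j = (\<beta> j ^ k) *\<^sub>R c j"
      using mat_pow_eigen[OF c(2)] B by metis
    then have eq: "\<mu> i * (b i \<bullet> c j) = \<beta> j ^ k * (b i \<bullet> c j)" for i
      using symmetric_inner[OF SS, of "b i" "c j"] b(2)[of i] by (metis inner_scaleR_left inner_scaleR_right)
    have rr: "root k (\<mu> i) * (b i \<bullet> c j) = \<beta> j * (b i \<bullet> c j)" for i
    proof (cases "b i \<bullet> c j = 0")
      case False
      then have "\<mu> i = \<beta> j ^ k" using eq[of i] by (metis mult_right_cancel)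
      then show ?thesis using k \<beta>[of j] by (simp add: real_root_power_cancel)
    qed simp
    have "?R *v c j = (\<Sum>i\<in>UNIV. (\<beta> j * (b i \<bullet> c j)) *\<^sub>R b i)"
      by (simp only: spec_matrix_vector rr)
    also have "\<dots> = \<beta> j *\<^sub>R (\<Sum>i\<in>UNIV. (b i \<bullet> c j) *\<^sub>R b i)"
      by (simp add: scaleR_sum_right)
    finally show "B *v c j = ?R *v c j" by (simp add: c onb_expand[OF b(1)])
  qed
qed

section \<open>Growth of volumes under a matrix\<close>

lemma abs_det_le:
  fixes A :: "real ^ 'n ^ 'n"
  assumes "\<And>i. norm (A $ i) \<le> B"
  shows "\<bar>det A\<bar> \<le> fact CARD('n) * B ^ CARD('n)"
proof -
  have "\<bar>det A\<bar> \<le> (\<Sum>p | p permutes (UNIV :: 'n set). B ^ CARD('n))"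
    unfolding det_def
  proof (rule order_trans[OF sum_abs], rule sum_mono)
    fix p :: "'n \<Rightarrow> 'n"
    have "\<bar>\<Prod>i\<in>UNIV. A $ i $ p i\<bar> \<le> (\<Prod>i\<in>(UNIV :: 'n set). B)"
      unfolding abs_prod
      by (intro prod_mono) (use component_le_norm_cart order_trans assms in \<open>auto simp: abs_le_iff\<close>, blast+)
    then show "\<bar>of_int (sign p) * (\<Prod>i\<in>UNIV. A $ i $ p i)\<bar> \<le> B ^ CARD('n)"
      by (simp add: abs_mult sign_def)
  qed
  also have "\<dots> = fact CARD('n) * B ^ CARD('n)"
    by (simp add: card_permutations[OF refl finite])
  finally show ?thesis .
qed

lemma det_map_rows:
  fixes A :: "real ^ 'n ^ 'n"
  shows "det (\<chi> i. A *v R i) = det A * det (\<chi> i. R i)"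
proof -
  have "(\<chi> i. A *v R i) = (\<chi> i. R i) ** transpose A"
    by (simp add: vec_eq_iff matrix_matrix_mult_def matrix_vector_mult_def transpose_def mult.commute)
  then show ?thesis by (simp add: det_mul)
qed

lemma abs_det_orthonormal_rows:
  assumes "onb b"
  shows "\<bar>det (\<chi> i. b i)\<bar> = 1"
proof -
  have "orthogonal_matrix (\<chi> i. b i)"
    using assms onb_norm[OF assms] by (auto simp: orthogonal_matrix_orthonormal_rows row_def vec_lambda_eta orthogonal_def onb_def)
  from det_orthogonal_matrix[OF this] show ?thesis by auto
qed

definition mixed :: "'n set \<Rightarrow> ('n::finite \<Rightarrow> real ^ 'n) \<Rightarrow> ('n \<Rightarrow> real ^ 'n) \<Rightarrow> real ^ 'n ^ 'n" where
  "mixed K V W = (\<chi> i. if i \<in> K then V i else W i)"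

definition unit_rows :: "('n::finite \<Rightarrow> real ^ 'n) set" where
  "unit_rows = {W. \<forall>i. norm (W i) \<le> 1}"

text \<open>The volume spanned by the \<open>V i\<close> with \<open>i\<close> in \<open>K\<close>:
  the free rows range over the unit ball, and the best choice is an orthonormal family perpendicular
  to the given vectors.\<close>

definition vol :: "'n set \<Rightarrow> ('n::finite \<Rightarrow> real ^ 'n) \<Rightarrow> real" where
  "vol K V = (SUP W\<in>unit_rows. \<bar>det (mixed K V W)\<bar>)"

lemma unit_rows_axis: "(\<lambda>i. axis i 1) \<in> unit_rows"
  by (simp add: unit_rows_def)

lemma unit_rows_onb: "onb b \<Longrightarrow> b \<in> unit_rows"
  by (simp add: unit_rows_def onb_norm)

lemma bdd_above_vol:
  fixes V :: "'n::finite \<Rightarrow> real ^ 'n"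
  shows "bdd_above ((\<lambda>W. \<bar>det (mixed K V W)\<bar>) ` unit_rows)"
proof (rule bdd_aboveI2)
  fix W :: "'n \<Rightarrow> real ^ 'n" assume W: "W \<in> unit_rows"
  define B where "B = Max (insert 1 (range (\<lambda>i. norm (V i))))"
  have "norm (V i) \<le> B" "1 \<le> B" for i
    unfolding B_def by (rule Max_ge; auto)+
  moreover have "norm (W i) \<le> 1" for i using W by (simp add: unit_rows_def)
  ultimately show "\<bar>det (mixed K V W)\<bar> \<le> fact CARD('n) * B ^ CARD('n)"
    by (intro abs_det_le) (auto simp: mixed_def intro: order_trans)
qed

lemma vol_ge: "W \<in> unit_rows \<Longrightarrow> \<bar>det (mixed K V W)\<bar> \<le> vol K V"
  unfolding vol_def by (rule cSUP_upper[OF _ bdd_above_vol])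

lemma vol_le: "(\<And>W. W \<in> unit_rows \<Longrightarrow> \<bar>det (mixed K V W)\<bar> \<le> c) \<Longrightarrow> vol K V \<le> c"
  unfolding vol_def by (rule cSUP_least) (use unit_rows_axis in auto)

lemma vol_nonneg: "0 \<le> vol K V"
  using vol_ge[OF unit_rows_axis, of K V] by linarith

lemma vol_onb:
  fixes b :: "'n::finite \<Rightarrow> real ^ 'n"
  assumes "onb b"
  shows "0 < vol K b" "vol K b \<le> fact CARD('n)"
proof -
  have "\<bar>det (mixed K b b)\<bar> \<le> vol K b"
    by (rule vol_ge[OF unit_rows_onb[OF assms]])
  then show "0 < vol K b" using abs_det_orthonormal_rows[OF assms] by (simp add: mixed_def)
  show "vol K b \<le> fact CARD('n)"
  proof (rule vol_le)
    fix W :: "'n \<Rightarrow> real ^ 'n" assume "W \<in> unit_rows"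
    then show "\<bar>det (mixed K b W)\<bar> \<le> fact CARD('n)"
      using abs_det_le[of "mixed K b W" 1] onb_norm[OF assms] by (auto simp: mixed_def unit_rows_def)
  qed
qed

lemma onb_axis: "onb (\<lambda>i. axis i 1)"
  by (auto simp: onb_def inner_axis_axis)

lemma abs_det_mixed_le:
  fixes V W :: "'n::finite \<Rightarrow> real ^ 'n"
  assumes W: "\<And>i. norm (W i) \<le> c" and c: "1 \<le> c"
  shows "\<bar>det (mixed K V W)\<bar> \<le> c ^ CARD('n) * vol K V"
proof -
  let ?c = "\<lambda>i. if i \<in> K then 1 else c"
  have "mixed K V W = (\<chi> i. ?c i *s (mixed K V (\<lambda>i. W i /\<^sub>R c) $ i))"
    using c by (simp add: mixed_def vec_eq_iff vector_scalar_mult_def)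
  then have "det (mixed K V W) = prod ?c UNIV * det (mixed K V (\<lambda>i. W i /\<^sub>R c))"
    by (simp add: det_rows_mul vec_lambda_eta)
  moreover have "\<bar>det (mixed K V (\<lambda>i. W i /\<^sub>R c))\<bar> \<le> vol K V"
    using W c by (intro vol_ge) (auto simp: unit_rows_def field_simps)
  moreover have "prod ?c UNIV \<le> (\<Prod>i\<in>(UNIV :: 'n set). c)"
    using c by (intro prod_mono) auto
  moreover have "0 \<le> prod ?c UNIV" using c by (intro prod_nonneg) auto
  ultimately show ?thesis by (simp add: abs_mult mult_mono)
qed

text \<open>For \<open>card K = k\<close> this plays the role of the norm of the \<open>k\<close>-th exterior power of \<open>A\<close>: it is
  submultiplicative, and equals the product of the \<open>k\<close> largest singular values up to constants.\<close>

definition growth :: "'n set \<Rightarrow> real ^ 'n ^ 'n \<Rightarrow> real" where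
  "growth K A = (SUP (V, W)\<in>{V. 0 < vol K V} \<times> unit_rows. \<bar>det (mixed K (\<lambda>i. A *v V i) W)\<bar> / vol K V)"

text \<open>Writing \<open>W i\<close> as \<open>A *v (B *v W i)\<close> lets \<open>A\<close> act
  on all rows at once and leave as a factor \<open>det A\<close>. Growth under \<open>A\<close> is
  thereby controlled through its inverse acting on the free rows.\<close>

lemma mixed_image:
  fixes A B :: "real ^ 'n ^ 'n"
  assumes "A ** B = mat 1"
  shows "det (mixed K (\<lambda>i. A *v V i) W) = det A * det (mixed K V (\<lambda>i. B *v W i))"
proof -
  have "mixed K (\<lambda>i. A *v V i) W = (\<chi> i. A *v (if i \<in> K then V i else B *v W i))"
    by (simp add: mixed_def matrix_vector_mul_assoc assms if_distrib[of "(*v) A"] cong: if_cong)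
  then show ?thesis by (simp add: det_map_rows mixed_def)
qed

lemma abs_det_mixed_image_le:
  fixes A B :: "real ^ 'n ^ 'n"
  assumes "A ** B = mat 1" "\<And>x. norm (B *v x) \<le> c * norm x" "1 \<le> c" "W \<in> unit_rows"
  shows "\<bar>det (mixed K (\<lambda>i. A *v V i) W)\<bar> \<le> \<bar>det A\<bar> * c ^ CARD('n) * vol K V"
proof -
  have "norm (B *v W i) \<le> c" for i
  proof -
    have "norm (B *v W i) \<le> c * norm (W i)" by (rule assms)
    also have "\<dots> \<le> c * 1" using assms by (intro mult_left_mono) (auto simp: unit_rows_def)
    finally show ?thesis by simp
  qed
  from abs_det_mixed_le[of "\<lambda>i. B *v W i" c K V, OF this assms(3)] show ?thesis
    by (simp add: mixed_image[OF assms(1)] abs_mult mult_left_mono mult.assoc)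
qed

lemma bounded_inverse:
  fixes A :: "real ^ 'n ^ 'n"
  assumes "invertible A"
  obtains B c where "A ** B = mat 1" "B ** A = mat 1" "\<And>x. norm (B *v x) \<le> c * norm x" "1 \<le> c"
proof -
  obtain B where B: "A ** B = mat 1" "B ** A = mat 1" using assms by (auto simp: invertible_def)
  obtain k where k: "\<And>x. norm (B *v x) \<le> norm x * k"
    using bounded_linear.bounded[OF matrix_vector_mul_bounded_linear[of B]] by blast
  have "norm (B *v x) \<le> max 1 k * norm x" for x
    using k[of x] mult_left_mono[of k "max 1 k" "norm x"] by (simp add: mult.commute)
  then show ?thesis using that B by fastforce
qed

lemma bdd_above_growth:
  fixes A :: "real ^ 'n ^ 'n"
  assumes "invertible A"
  shows "bdd_above ((\<lambda>(V, W). \<bar>det (mixed K (\<lambda>i. A *v V i) W)\<bar> / vol K V) ` ({V. 0 < vol K V} \<times> unit_rows))"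
proof -
  obtain B c where B: "A ** B = mat 1" "\<And>x. norm (B *v x) \<le> c * norm x" "1 \<le> c"
    using bounded_inverse[OF assms] by blast
  show ?thesis
    by (rule bdd_aboveI[of _ "\<bar>det A\<bar> * c ^ CARD('n)"])
      (use abs_det_mixed_image_le[OF B] in \<open>auto simp: field_simps\<close>)
qed

lemma growth_ge:
  assumes "invertible A" "0 < vol K V" "W \<in> unit_rows"
  shows "\<bar>det (mixed K (\<lambda>i. A *v V i) W)\<bar> / vol K V \<le> growth K A"
  unfolding growth_def using cSUP_upper[OF _ bdd_above_growth[OF assms(1)], of "(V, W)"] assms by auto

lemma growth_le:
  assumes "\<And>V W. 0 < vol K V \<Longrightarrow> W \<in> unit_rows \<Longrightarrow> \<bar>det (mixed K (\<lambda>i. A *v V i) W)\<bar> \<le> c * vol K V"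
  shows "growth K A \<le> c"
  unfolding growth_def
proof (rule cSUP_least)
  show "{V. 0 < vol K V} \<times> unit_rows \<noteq> {}" using vol_onb(1)[OF onb_axis] unit_rows_axis by blast
qed (use assms in \<open>auto simp: field_simps\<close>)

lemma vol_image_le:
  assumes A: "invertible A"
  shows "vol K (\<lambda>i. A *v V i) \<le> growth K A * vol K V"
proof (rule vol_le)
  fix W :: "'a \<Rightarrow> real ^ 'a" assume W: "W \<in> unit_rows"
  show "\<bar>det (mixed K (\<lambda>i. A *v V i) W)\<bar> \<le> growth K A * vol K V"
  proof (cases "vol K V = 0")
    \<comment> \<open>The supremum in \<open>growth\<close> ignores degenerate families; the
      estimate through the inverse shows that their images are degenerate as well.\<close>
    case True
    obtain B c where B: "A ** B = mat 1" "\<And>x. norm (B *v x) \<le> c * norm x" "1 \<le> c"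
      using bounded_inverse[OF A] by blast
    from abs_det_mixed_image_le[OF this W, of K V] True show ?thesis by simp
  next
    case False
    then have "0 < vol K V" using vol_nonneg[of K V] by simp
    from growth_ge[OF A this W] this show ?thesis by (simp add: field_simps)
  qed
qed

lemma growth_nonneg:
  assumes "invertible A"
  shows "0 \<le> growth K A"
  using growth_ge[OF assms vol_onb(1)[OF onb_axis] unit_rows_axis, of K] vol_onb(1)[OF onb_axis, of K]
  by (smt (verit) divide_nonneg_pos)

lemma growth_mult:
  fixes A B :: "real ^ 'n ^ 'n"
  assumes "invertible A" "invertible B"
  shows "growth K (A ** B) \<le> growth K A * growth K B"
proof (rule growth_le)
  fix V W :: "'n \<Rightarrow> real ^ 'n" assume "W \<in> unit_rows"
  then have "\<bar>det (mixed K (\<lambda>i. (A ** B) *v V i) W)\<bar> \<le> vol K (\<lambda>i. A *v (B *v V i))"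
    by (simp add: matrix_vector_mul_assoc[symmetric] vol_ge)
  also have "\<dots> \<le> growth K A * vol K (\<lambda>i. B *v V i)" by (rule vol_image_le[OF assms(1)])
  also have "\<dots> \<le> growth K A * (growth K B * vol K V)"
    by (intro mult_left_mono vol_image_le growth_nonneg assms)
  finally show "\<bar>det (mixed K (\<lambda>i. (A ** B) *v V i) W)\<bar> \<le> growth K A * growth K B * vol K V"
    by (simp add: mult.assoc)
qed

lemma growth_mat_1: "growth K (mat 1) = 1"
proof (rule antisym)
  show "growth K (mat 1) \<le> 1" by (rule growth_le) (simp add: vol_ge)
  have "invertible (mat 1 :: real ^ 'a ^ 'a)" by (simp add: invertible_def)
  from vol_image_le[OF this, of K "\<lambda>i. axis i 1"] show "1 \<le> growth K (mat 1)"
    using vol_onb(1)[OF onb_axis, of K] by simp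
qed

lemma growth_bound:
  fixes A B :: "real ^ 'n ^ 'n"
  assumes "A ** B = mat 1" "\<And>x. norm (B *v x) \<le> c * norm x" "1 \<le> c"
  shows "growth K A \<le> \<bar>det A\<bar> * c ^ CARD('n)"
  by (rule growth_le) (rule abs_det_mixed_image_le[OF assms])

lemma invertibleI: "A ** B = mat 1 \<Longrightarrow> invertible (A :: real ^ 'n ^ 'n)"
  by (meson invertible_def matrix_left_right_inverse)

lemma growth_pos:
  fixes A :: "real ^ 'n ^ 'n"
  assumes "invertible A"
  shows "0 < growth K A"
proof -
  obtain B where B: "A ** B = mat 1" "B ** A = mat 1" using assms by (auto simp: invertible_def)
  have "1 \<le> growth K A * growth K B"
    using growth_mult[OF assms invertibleI[OF B(2)], of K] B growth_mat_1[of K] by metis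
  then show ?thesis using growth_nonneg[OF assms, of K] by (cases "growth K A = 0") auto
qed

text \<open>The supremum runs over an uncountable family of continuous functions, so each of its
  strict superlevel sets is a union of open sets. Invertibility keeps the supremum finite.\<close>

lemma borel_measurable_growth:
  fixes A :: "'a \<Rightarrow> real ^ 'n ^ 'n"
  assumes A: "A \<in> borel_measurable M" and inv: "\<And>x. x \<in> space M \<Longrightarrow> invertible (A x)"
  shows "(\<lambda>x. growth K (A x)) \<in> borel_measurable M"
proof (rule borel_measurableI_greater)
  fix y
  let ?S = "{V. 0 < vol K V} \<times> (unit_rows :: ('n \<Rightarrow> real ^ 'n) set)"
  define U where "U = (\<Union>(V, W)\<in>?S. {B. y < \<bar>det (mixed K (\<lambda>i. B *v V i) W)\<bar> / vol K V})"
  have cont: "continuous_on UNIV (\<lambda>B. \<bar>det (mixed K (\<lambda>i. B *v V i) W)\<bar> / vol K V)"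
    for V W :: "'n \<Rightarrow> real ^ 'n"
  proof -
    have "continuous_on UNIV (\<lambda>B. mixed K (\<lambda>i. B *v V i) W $ i $ j)" for i j
      by (cases "i \<in> K") (auto simp: mixed_def matrix_vector_mult_def intro!: continuous_intros)
    note c = this
    have "continuous_on UNIV (\<lambda>B. \<bar>det (mixed K (\<lambda>i. B *v V i) W)\<bar>)"
      unfolding det_def
      by (intro continuous_on_rabs continuous_on_sum continuous_on_mult continuous_on_const continuous_on_prod c)
    then show ?thesis by (auto simp: divide_inverse intro!: continuous_on_mult)
  qed
  have "open U"
    unfolding U_def
    by (intro open_UN) (auto intro!: open_Collect_less continuous_on_const cont)
  then have "A -` U \<inter> space M \<in> sets M" using A by (simp add: measurable_sets)
  moreover have "{x \<in> space M. y < growth K (A x)} = A -` U \<inter> space M"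
  proof -
    have "y < growth K (A x) \<longleftrightarrow> A x \<in> U" if "x \<in> space M" for x
    proof -
      have "?S \<noteq> {}" using vol_onb(1)[OF onb_axis] unit_rows_axis by blast
      from less_cSUP_iff[OF this bdd_above_growth[OF inv[OF that]]]
      show ?thesis unfolding growth_def U_def by auto
    qed
    then show ?thesis by auto
  qed
  ultimately show "{x \<in> space M. y < growth K (A x)} \<in> sets M" by simp
qed

section \<open>Growth compared with products of singular values\<close>

lemma prod_le_top_prod:
  fixes s :: "'n::finite \<Rightarrow> real"
  assumes s: "\<And>i. 0 < s i" and K: "\<And>i j. i \<in> K \<Longrightarrow> j \<notin> K \<Longrightarrow> s j \<le> s i" and card: "card L = card K"
  shows "prod s L \<le> prod s K"
proof (cases "K - L = {}")
  case True
  then have "K = L" using card by (intro card_subset_eq) auto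
  then show ?thesis by simp
next
  case False
  define t where "t = Min (s ` (K - L))"
  have t: "0 < t" "\<And>i. i \<in> K - L \<Longrightarrow> t \<le> s i" "\<And>j. j \<in> L - K \<Longrightarrow> s j \<le> t"
    using False s K by (auto simp: t_def)
  have c: "card (L - K) = card (K - L)"
    using card by (simp add: card_Diff_subset_Int Int_commute)
  have "prod s (L - K) \<le> (\<Prod>i\<in>L - K. t)"
    using t s by (intro prod_mono) (auto intro: less_imp_le)
  also have "\<dots> = (\<Prod>i\<in>K - L. t)" by (simp add: c)
  also have "\<dots> \<le> prod s (K - L)"
    using t by (intro prod_mono) (auto intro: less_imp_le)
  finally have "prod s (L - K) * prod s (L \<inter> K) \<le> prod s (K - L) * prod s (L \<inter> K)"
    using s by (intro mult_right_mono prod_nonneg) (auto intro: less_imp_le)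
  moreover have "prod s L = prod s (L - K) * prod s (L \<inter> K)" "prod s K = prod s (K - L) * prod s (L \<inter> K)"
    using prod.Int_Diff[of L s K] prod.Int_Diff[of K s L] by (auto simp: Int_commute mult.commute)
  ultimately show ?thesis by simp
qed

lemma left_singular_vectors:
  fixes A :: "real ^ 'n ^ 'n"
  assumes b: "onb b" "\<And>i. (transpose A ** A) *v b i = (s i)\<^sup>2 *\<^sub>R b i" and s: "\<And>i. 0 < s i"
  shows "onb (\<lambda>i. (A *v b i) /\<^sub>R s i)"
proof -
  have "(A *v b i) \<bullet> (A *v b j) = b i \<bullet> ((transpose A ** A) *v b j)" for i j
    by (metis dot_lmul_matrix matrix_vector_mul_assoc transpose_transpose vector_transpose_matrix)
  then have "(A *v b i) \<bullet> (A *v b j) = (if i = j then (s j)\<^sup>2 else 0)" for i j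
    using onb_inner[OF b(1), of i j] by (simp add: b(2))
  then show ?thesis using s less_imp_neq[OF s] by (auto simp: onb_def power2_eq_square field_simps)
qed

lemma abs_det_singular_values:
  fixes A :: "real ^ 'n ^ 'n"
  assumes b: "onb b" "\<And>i. (transpose A ** A) *v b i = (s i)\<^sup>2 *\<^sub>R b i" and s: "\<And>i. 0 < s i"
  shows "\<bar>det A\<bar> = prod s UNIV"
proof -
  let ?u = "\<lambda>i. (A *v b i) /\<^sub>R s i"
  have "\<bar>det A\<bar> = \<bar>det (\<chi> i. A *v b i)\<bar>"
    by (simp add: det_map_rows abs_mult abs_det_orthonormal_rows[OF b(1)])
  also have "(\<chi> i. A *v b i) = (\<chi> i. s i *s ?u i)"
    using s by (simp add: vec_eq_iff less_imp_neq[symmetric])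
  also have "\<bar>det \<dots>\<bar> = prod s UNIV"
    using abs_det_orthonormal_rows[OF left_singular_vectors[OF b s]] abs_of_pos[OF s]
    by (simp add: det_rows_mul abs_mult abs_prod)
  finally show ?thesis .
qed

text \<open>Testing with the right singular vectors as \<open>V\<close> and the left ones as
  \<open>W\<close> gives a determinant of absolute value exactly \<open>prod s K\<close>; the
  factorial is the bound on the volume of an orthonormal family.\<close>

lemma growth_lower:
  fixes A :: "real ^ 'n ^ 'n"
  assumes A: "invertible A"
    and b: "onb b" "\<And>i. (transpose A ** A) *v b i = (s i)\<^sup>2 *\<^sub>R b i" and s: "\<And>i. 0 < s i"
  shows "prod s K \<le> fact CARD('n) * growth K A"
proof -
  let ?u = "\<lambda>i. (A *v b i) /\<^sub>R s i"
  let ?c = "\<lambda>i. if i \<in> K then s i else 1"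
  have u: "onb ?u" by (rule left_singular_vectors[OF b s])
  have "mixed K (\<lambda>i. A *v b i) ?u = (\<chi> i. ?c i *s ?u i)"
    using s by (simp add: mixed_def vec_eq_iff less_imp_neq[symmetric])
  then have "\<bar>det (mixed K (\<lambda>i. A *v b i) ?u)\<bar> = prod ?c UNIV"
    using abs_det_orthonormal_rows[OF u] s by (simp add: det_rows_mul abs_mult abs_prod less_imp_le prod_nonneg)
  also have "prod ?c UNIV = prod s K"
    using prod.inter_restrict[of UNIV s K] by simp
  finally have "prod s K \<le> growth K A * vol K b"
    using growth_ge[OF A vol_onb(1)[OF b(1)] unit_rows_onb[OF u], of K] vol_onb(1)[OF b(1), of K]
    by (simp add: field_simps)
  also have "\<dots> \<le> growth K A * fact CARD('n)"
    using vol_onb(2)[OF b(1)] growth_nonneg[OF A] by (intro mult_left_mono)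
  finally show ?thesis by (simp add: mult.commute)
qed

text \<open>The free rows are pulled back by the inverse and expanded in the right singular basis,
  which gives at most \<open>CARD('n \<Rightarrow> 'n)\<close> determinants. A repeated index kills
  the determinant. Otherwise \<open>det A\<close>, the product of all singular values, is divided by
  those of \<open>card (- K)\<close> distinct indices, and what remains is a product of
  \<open>card K\<close> singular values, at most the top one.\<close>

lemma growth_upper:
  fixes A :: "real ^ 'n ^ 'n"
  assumes A: "invertible A"
    and b: "onb b" "\<And>i. (transpose A ** A) *v b i = (s i)\<^sup>2 *\<^sub>R b i" and s: "\<And>i. 0 < s i"
    and K: "\<And>i j. i \<in> K \<Longrightarrow> j \<notin> K \<Longrightarrow> s j \<le> s i"
  shows "growth K A \<le> real CARD('n \<Rightarrow> 'n) * prod s K"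
proof (rule growth_le)
  fix V W :: "'n \<Rightarrow> real ^ 'n" assume W: "W \<in> unit_rows"
  let ?u = "\<lambda>i. (A *v b i) /\<^sub>R s i"
  have u: "onb ?u" by (rule left_singular_vectors[OF b s])
  obtain B where B: "A ** B = mat 1" "B ** A = mat 1" using A by (auto simp: invertible_def)
  have Bu: "B *v ?u i = b i /\<^sub>R s i" for i
    by (simp add: matrix_vector_mult_scaleR matrix_vector_mul_assoc B)
  define a where "a i j = ((?u j \<bullet> W i) / s j) *s b j" for i j
  have BW: "B *v W i = (\<Sum>j\<in>UNIV. a i j)" for i
  proof -
    have "B *v W i = B *v (\<Sum>j\<in>UNIV. (?u j \<bullet> W i) *\<^sub>R ?u j)"
      by (subst onb_expand[OF u]) simp
    also have "\<dots> = (\<Sum>j\<in>UNIV. (?u j \<bullet> W i) *\<^sub>R (B *v ?u j))"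
      by (simp only: linear_sum[OF matrix_vector_mul_linear] matrix_vector_mult_scaleR)
    also have "\<dots> = (\<Sum>j\<in>UNIV. a i j)"
      unfolding Bu a_def by (simp add: scalar_mult_eq_scaleR divide_inverse)
    finally show ?thesis .
  qed
  let ?F = "{f. (\<forall>i\<in>- K. f i \<in> (UNIV :: 'n set)) \<and> (\<forall>i. i \<notin> - K \<longrightarrow> f i = i)}"
  have "det (mixed K V (\<lambda>i. B *v W i)) = det (\<chi> i. if i \<in> - K then sum (a i) UNIV else V i)"
    unfolding mixed_def BW by (intro arg_cong[where f=det]) (auto simp: vec_eq_iff)
  also have "\<dots> = (\<Sum>f\<in>?F. det (\<chi> i. if i \<in> - K then a i (f i) else V i))"
    by (rule det_linear_rows_sum_lemma) auto
  finally have expand: "det (mixed K V (\<lambda>i. B *v W i)) = (\<Sum>f\<in>?F. det (\<chi> i. if i \<in> - K then a i (f i) else V i))" .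
  have term_le: "\<bar>det A\<bar> * \<bar>det (\<chi> i. if i \<in> - K then a i (f i) else V i)\<bar> \<le> prod s K * vol K V" for f
  proof -
    let ?c = "\<lambda>i. if i \<in> - K then (?u (f i) \<bullet> W i) / s (f i) else 1"
    have "(\<chi> i. if i \<in> - K then a i (f i) else V i) = (\<chi> i. ?c i *s (mixed K V (\<lambda>i. b (f i)) $ i))"
      by (simp add: a_def mixed_def vec_eq_iff)
    then have eq: "det (\<chi> i. if i \<in> - K then a i (f i) else V i) = prod ?c UNIV * det (mixed K V (\<lambda>i. b (f i)))"
      by (simp add: det_rows_mul vec_lambda_eta)
    show ?thesis
    proof (cases "inj_on f (- K)")
      case False
      then obtain i j where "i \<notin> K" "j \<notin> K" "i \<noteq> j" "f i = f j" by (auto simp: inj_on_def)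
      then have "det (mixed K V (\<lambda>i. b (f i))) = 0"
        by (intro det_identical_rows[of i j]) (auto simp: row_def mixed_def)
      then show ?thesis unfolding eq using s by (simp add: prod_nonneg vol_nonneg less_imp_le)
    next
      case True
      have "\<bar>prod ?c UNIV\<bar> = (\<Prod>i\<in>UNIV. \<bar>?c i\<bar>)" by (rule abs_prod)
      also have "\<dots> \<le> (\<Prod>i\<in>UNIV. if i \<in> - K then inverse (s (f i)) else 1)"
      proof (rule prod_mono, intro conjI)
        fix i
        have "\<bar>?u (f i) \<bullet> W i\<bar> \<le> norm (?u (f i)) * norm (W i)" by (rule Cauchy_Schwarz_ineq2)
        also have "\<dots> \<le> 1" using onb_norm[OF u, of "f i"] W by (auto simp: unit_rows_def)
        finally have "\<bar>?u (f i) \<bullet> W i\<bar> \<le> 1" .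
        then have "\<bar>?u (f i) \<bullet> W i\<bar> / s (f i) \<le> 1 / s (f i)"
          using s[of "f i"] by (intro divide_right_mono) auto
        then show "\<bar>?c i\<bar> \<le> (if i \<in> - K then inverse (s (f i)) else 1)"
          using s[of "f i"] by (simp add: inverse_eq_divide)
      qed simp
      also have "\<dots> = (\<Prod>i\<in>- K. inverse (s (f i)))"
        using prod.inter_restrict[of UNIV "\<lambda>i. inverse (s (f i))" "- K"] by simp
      also have "\<dots> = inverse (prod s (f ` (- K)))"
        using prod.reindex[OF True, of s] by (simp add: prod_inversef[unfolded comp_def])
      finally have c: "\<bar>prod ?c UNIV\<bar> \<le> inverse (prod s (f ` (- K)))" .
      have split: "\<bar>det A\<bar> = prod s (- (f ` (- K))) * prod s (f ` (- K))"
        unfolding abs_det_singular_values[OF b s]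
        using prod.subset_diff[of "f ` (- K)" UNIV s] by (simp add: Compl_eq_Diff_UNIV)
      have pos: "0 < prod s (f ` (- K))" using s by (intro prod_pos) auto
      have "\<bar>det A\<bar> * \<bar>prod ?c UNIV\<bar> \<le> \<bar>det A\<bar> * inverse (prod s (f ` (- K)))"
        by (rule mult_left_mono[OF c]) simp
      also have "\<dots> = prod s (- (f ` (- K)))" unfolding split using less_imp_neq[OF pos, symmetric] by (simp only: mult.assoc right_inverse mult_1_right not_False_eq_True)
      also have "\<dots> \<le> prod s K"
      proof (rule prod_le_top_prod[OF s K])
        have "card (- (f ` (- K))) = CARD('n) - card (- K)"
          using True by (simp add: Compl_eq_Diff_UNIV card_Diff_subset card_image)
        also have "\<dots> = card K"
          by (simp add: Compl_eq_Diff_UNIV card_Diff_subset card_mono)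
        finally show "card (- (f ` (- K))) = card K" .
      qed
      finally have "\<bar>det A\<bar> * \<bar>prod ?c UNIV\<bar> \<le> prod s K" .
      moreover have "\<bar>det (mixed K V (\<lambda>i. b (f i)))\<bar> \<le> vol K V"
        by (rule vol_ge) (simp add: unit_rows_def onb_norm[OF b(1)])
      ultimately have "(\<bar>det A\<bar> * \<bar>prod ?c UNIV\<bar>) * \<bar>det (mixed K V (\<lambda>i. b (f i)))\<bar> \<le> prod s K * vol K V"
        using s by (intro mult_mono) (auto simp: prod_nonneg less_imp_le)
      then show ?thesis unfolding eq by (simp add: abs_mult mult.assoc)
    qed
  qed
  have "\<bar>det (mixed K (\<lambda>i. A *v V i) W)\<bar> = \<bar>det A\<bar> * \<bar>det (mixed K V (\<lambda>i. B *v W i))\<bar>"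
    by (simp add: mixed_image[OF B(1)] abs_mult)
  also have "\<dots> \<le> \<bar>det A\<bar> * (\<Sum>f\<in>?F. \<bar>det (\<chi> i. if i \<in> - K then a i (f i) else V i)\<bar>)"
    unfolding expand by (intro mult_left_mono sum_abs) simp
  also have "\<dots> = (\<Sum>f\<in>?F. \<bar>det A\<bar> * \<bar>det (\<chi> i. if i \<in> - K then a i (f i) else V i)\<bar>)"
    by (simp add: sum_distrib_left)
  also have "\<dots> \<le> (\<Sum>f\<in>?F. prod s K * vol K V)" by (intro sum_mono term_le)
  also have "\<dots> \<le> (\<Sum>f\<in>(UNIV :: ('n \<Rightarrow> 'n) set). prod s K * vol K V)"
    using s by (intro sum_mono2) (auto simp: prod_nonneg vol_nonneg less_imp_le)
  finally show "\<bar>det (mixed K (\<lambda>i. A *v V i) W)\<bar> \<le> real CARD('n \<Rightarrow> 'n) * prod s K * vol K V" by simp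
qed

section \<open>Convergence of singular directions\<close>

lemma norm_outer:
  fixes u w :: "real ^ 'n"
  shows "norm (outer u w) \<le> norm u * norm w"
proof -
  have "(\<chi> c. u $ a * w $ c) = (u $ a) *\<^sub>R w" for a
    by (simp add: vec_eq_iff)
  then have "norm (outer u w) = L2_set (\<lambda>a. \<bar>u $ a\<bar> * norm w) UNIV"
    by (subst norm_vec_def) (simp add: outer_def)
  also have "\<dots> = norm u * norm w"
    by (subst L2_set_left_distrib[symmetric]) (simp_all add: norm_vec_def[of u])
  finally show ?thesis by simp
qed

lemma norm_outer_onb: "onb b \<Longrightarrow> norm (outer (b i) (b i)) \<le> 1"
  using norm_outer[of "b i" "b i"] by (simp add: onb_norm)

definition proj_on :: "('n::finite \<Rightarrow> real ^ 'n) \<Rightarrow> 'n set \<Rightarrow> real ^ 'n ^ 'n" where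
  "proj_on b T = (\<Sum>i\<in>T. outer (b i) (b i))"

text \<open>With \<open>P\<close> and \<open>Q\<close> the projections for \<open>b\<close> and
  \<open>c\<close>, this is \<open>Q - P = Q (I - P) - (I - Q) P\<close>. Only inner products
  between a vector inside \<open>T\<close> and one outside \<open>T\<close> enter.\<close>

lemma proj_on_diff:
  fixes b c :: "'n::finite \<Rightarrow> real ^ 'n"
  assumes b: "onb b" and c: "onb c"
  shows "proj_on c T - proj_on b T
    = (\<Sum>i\<in>T. \<Sum>j\<in>- T. (c i \<bullet> b j) *\<^sub>R outer (c i) (b j)) - (\<Sum>i\<in>T. \<Sum>j\<in>- T. (b i \<bullet> c j) *\<^sub>R outer (c j) (b i))"
proof (rule matrix_eq[THEN iffD2], rule allI)
  fix x
  have b': "(\<Sum>j\<in>- T. (b j \<bullet> x) *\<^sub>R b j) = x - (\<Sum>j\<in>T. (b j \<bullet> x) *\<^sub>R b j)"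
    using onb_expand[OF b, of x] sum.subset_diff[of T UNIV "\<lambda>j. (b j \<bullet> x) *\<^sub>R b j"]
    by (simp add: Compl_eq_Diff_UNIV eq_diff_eq)
  have c': "(\<Sum>j\<in>- T. (c j \<bullet> y) *\<^sub>R c j) = y - (\<Sum>j\<in>T. (c j \<bullet> y) *\<^sub>R c j)" for y
    using onb_expand[OF c, of y] sum.subset_diff[of T UNIV "\<lambda>j. (c j \<bullet> y) *\<^sub>R c j"]
    by (simp add: Compl_eq_Diff_UNIV eq_diff_eq)
  define y where "y = (\<Sum>j\<in>T. (b j \<bullet> x) *\<^sub>R b j)"
  have L: "(proj_on c T - proj_on b T) *v x = (\<Sum>i\<in>T. (c i \<bullet> x) *\<^sub>R c i) - y"
    by (simp add: proj_on_def matrix_vector_mult_diff_rdistrib matrix_vector_mult_sum_left outer_vector y_def)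
  have R1: "(\<Sum>i\<in>T. \<Sum>j\<in>- T. (c i \<bullet> b j) *\<^sub>R outer (c i) (b j)) *v x = (\<Sum>i\<in>T. (c i \<bullet> (x - y)) *\<^sub>R c i)"
  proof -
    have "(\<Sum>i\<in>T. \<Sum>j\<in>- T. (c i \<bullet> b j) *\<^sub>R outer (c i) (b j)) *v x
        = (\<Sum>i\<in>T. (c i \<bullet> (\<Sum>j\<in>- T. (b j \<bullet> x) *\<^sub>R b j)) *\<^sub>R c i)"
      by (simp add: matrix_vector_mult_sum_left outer_vector scaleR_matrix_vector_assoc[symmetric]
          inner_sum_right scaleR_sum_left mult.commute)
    then show ?thesis by (simp add: b' y_def)
  qed
  have R2: "(\<Sum>i\<in>T. \<Sum>j\<in>- T. (b i \<bullet> c j) *\<^sub>R outer (c j) (b i)) *v x = y - (\<Sum>j\<in>T. (c j \<bullet> y) *\<^sub>R c j)"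
  proof -
    have "(\<Sum>i\<in>T. \<Sum>j\<in>- T. (b i \<bullet> c j) *\<^sub>R outer (c j) (b i)) *v x = (\<Sum>j\<in>- T. (c j \<bullet> y) *\<^sub>R c j)"
      by (subst sum.swap) (simp add: matrix_vector_mult_sum_left outer_vector scaleR_matrix_vector_assoc[symmetric]
          inner_sum_right scaleR_sum_left mult.commute inner_commute y_def)
    then show ?thesis by (simp add: c')
  qed
  show "(proj_on c T - proj_on b T) *v x
    = ((\<Sum>i\<in>T. \<Sum>j\<in>- T. (c i \<bullet> b j) *\<^sub>R outer (c i) (b j)) - (\<Sum>i\<in>T. \<Sum>j\<in>- T. (b i \<bullet> c j) *\<^sub>R outer (c j) (b i))) *v x"
    unfolding L
    by (simp only: matrix_vector_mult_diff_rdistrib R1 R2) (simp add: inner_diff_right scaleR_diff_left sum_subtractf)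
qed

lemma norm_proj_on_diff_le:
  fixes b c :: "'n::finite \<Rightarrow> real ^ 'n"
  assumes b: "onb b" and c: "onb c"
    and le: "\<And>i j. i \<in> T \<Longrightarrow> j \<notin> T \<Longrightarrow> \<bar>c i \<bullet> b j\<bar> \<le> \<epsilon> \<and> \<bar>b i \<bullet> c j\<bar> \<le> \<epsilon>" and \<epsilon>: "0 \<le> \<epsilon>"
  shows "norm (proj_on c T - proj_on b T) \<le> 2 * (real CARD('n))\<^sup>2 * \<epsilon>"
proof -
  have outer1: "norm (outer (c i) (b j)) \<le> 1" for i j
    using norm_outer[of "c i" "b j"] by (simp add: onb_norm b c)
  have dsum: "norm (\<Sum>i\<in>T. \<Sum>j\<in>- T. F i j) \<le> (real CARD('n))\<^sup>2 * \<epsilon>"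
    if "\<And>i j. i \<in> T \<Longrightarrow> j \<notin> T \<Longrightarrow> norm (F i j) \<le> \<epsilon>" for F :: "'n \<Rightarrow> 'n \<Rightarrow> real ^ 'n ^ 'n"
  proof -
    have "norm (\<Sum>i\<in>T. \<Sum>j\<in>- T. F i j) \<le> (\<Sum>i\<in>T. \<Sum>j\<in>- T. \<epsilon>)"
      using that by (intro sum_norm_le order_trans[OF norm_sum] sum_mono) auto
    also have "\<dots> \<le> (\<Sum>i\<in>(UNIV :: 'n set). \<Sum>j\<in>(UNIV :: 'n set). \<epsilon>)"
      using \<epsilon> by (intro order_trans[OF sum_mono sum_mono2] sum_mono2 sum_nonneg) auto
    finally show ?thesis by (simp add: power2_eq_square mult.assoc)
  qed
  have "norm ((c i \<bullet> b j) *\<^sub>R outer (c i) (b j)) \<le> \<epsilon>" "norm ((b i \<bullet> c j) *\<^sub>R outer (c j) (b i)) \<le> \<epsilon>"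
    if "i \<in> T" "j \<notin> T" for i j
    using mult_mono[OF conjunct1[OF le[OF that]] outer1[of i j] \<epsilon>] mult_mono[OF conjunct2[OF le[OF that]] outer1[of j i] \<epsilon>]
    by auto
  then have "norm (\<Sum>i\<in>T. \<Sum>j\<in>- T. (c i \<bullet> b j) *\<^sub>R outer (c i) (b j)) \<le> (real CARD('n))\<^sup>2 * \<epsilon>"
    "norm (\<Sum>i\<in>T. \<Sum>j\<in>- T. (b i \<bullet> c j) *\<^sub>R outer (c j) (b i)) \<le> (real CARD('n))\<^sup>2 * \<epsilon>"
    by (intro dsum; blast)+
  from norm_triangle_mono[OF this(1) this(2)[folded norm_minus_cancel[of "sum _ _"]]]
  show ?thesis
    unfolding proj_on_diff[OF b c] by (simp add: mult_ac)
qed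

lemma norm_singular_vector:
  fixes A :: "real ^ 'n ^ 'n"
  assumes "onb b" "\<And>i. (transpose A ** A) *v b i = (s i)\<^sup>2 *\<^sub>R b i" "\<And>i. 0 < s i"
  shows "(norm (A *v x))\<^sup>2 = (\<Sum>i\<in>UNIV. (s i * (b i \<bullet> x))\<^sup>2)"
    and "norm (A *v b i) = s i" and "\<bar>b i \<bullet> x\<bar> * s i \<le> norm (A *v x)"
proof -
  have "(norm (A *v x))\<^sup>2 = x \<bullet> ((transpose A ** A) *v x)" for x
    unfolding power2_norm_eq_inner
    by (metis dot_lmul_matrix matrix_vector_mul_assoc transpose_transpose vector_transpose_matrix)
  moreover have "transpose A ** A = spec_matrix b (\<lambda>i. (s i)\<^sup>2)"
    by (rule onb_matrix_eqI[OF assms(1)]) (simp add: assms spec_matrix_eigen)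
  ultimately show *: "(norm (A *v x))\<^sup>2 = (\<Sum>i\<in>UNIV. (s i * (b i \<bullet> x))\<^sup>2)" for x
    by (simp add: spec_matrix_vector inner_sum_right power2_eq_square inner_commute mult_ac)
  have "(norm (A *v b i))\<^sup>2 = (s i)\<^sup>2"
  proof -
    have "(\<Sum>k\<in>UNIV. (s k * (b k \<bullet> b i))\<^sup>2) = (\<Sum>k\<in>UNIV. if k = i then (s i)\<^sup>2 else 0)"
      by (intro sum.cong) (auto simp: onb_inner[OF assms(1)])
    then show ?thesis unfolding * by simp
  qed
  then show "norm (A *v b i) = s i"
    using assms(3)[of i] by (simp add: power2_eq_iff_nonneg less_imp_le)
  have "(\<bar>b i \<bullet> x\<bar> * s i)\<^sup>2 = (s i * (b i \<bullet> x))\<^sup>2" by (simp add: power_mult_distrib mult.commute)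
  also have "\<dots> \<le> (norm (A *v x))\<^sup>2"
    unfolding * by (rule member_le_sum) auto
  finally show "\<bar>b i \<bullet> x\<bar> * s i \<le> norm (A *v x)"
    by (rule power2_le_imp_le) simp
qed

text \<open>Raghunathan's argument: the spectral projection onto the singular vectors with large
  exponent changes by an exponentially small amount in each step.\<close>

lemma proj_on_convergent:
  fixes A :: "nat \<Rightarrow> real ^ 'n ^ 'n" and b :: "nat \<Rightarrow> 'n \<Rightarrow> real ^ 'n"
  assumes b: "\<And>t. onb (b t)" "\<And>t i. (transpose (A t) ** A t) *v b t i = (s t i)\<^sup>2 *\<^sub>R b t i" and s: "\<And>t i. 0 < s t i"
    and step: "\<And>t x. norm (A (Suc t) *v x) \<le> C * norm (A t *v x)"
      "\<And>t x. norm (A t *v x) \<le> C * norm (A (Suc t) *v x)"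
    and lim: "\<And>i. (\<lambda>t. ln (s t i) / real t) \<longlonglongrightarrow> \<kappa> i"
    and T: "\<And>i j. i \<in> T \<Longrightarrow> j \<notin> T \<Longrightarrow> \<kappa> j < \<kappa> i"
  shows "convergent (\<lambda>t. proj_on (b t) T)"
proof -
  \<comment> \<open>A quarter of the smallest gap between exponents inside and outside
    \<open>T\<close>: blurring both by \<open>\<delta>\<close> still leaves a gap. The inserted 1
    covers the case that there is no such pair.\<close>
  define \<delta> where "\<delta> = Min (insert 1 ((\<lambda>(i, j). \<kappa> i - \<kappa> j) ` (T \<times> - T))) / 4"
  have \<delta>: "0 < \<delta>" "\<And>i j. i \<in> T \<Longrightarrow> j \<notin> T \<Longrightarrow> 4 * \<delta> \<le> \<kappa> i - \<kappa> j"
  proof -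
    show "0 < \<delta>" using T by (auto simp: \<delta>_def)
    show "4 * \<delta> \<le> \<kappa> i - \<kappa> j" if "i \<in> T" "j \<notin> T" for i j
      unfolding \<delta>_def using that by (auto intro!: Min_le)
  qed
  have C: "0 \<le> C"
  proof -
    have "0 \<le> C * norm (A 0 *v b 0 i)" for i
      using step(1)[of 0 "b 0 i"] norm_ge_zero[of "A (Suc 0) *v b 0 i"] by linarith
    then show ?thesis using norm_singular_vector(2)[OF b s, of 0] s[of 0] by (metis mult_less_0_iff not_le)
  qed
  have ev: "eventually (\<lambda>t. t \<ge> 1 \<and> (\<forall>i. s t i \<le> exp ((\<kappa> i + \<delta>) * real t) \<and> exp ((\<kappa> i - \<delta>) * real t) \<le> s t i)) sequentially"
  proof -
    have "eventually (\<lambda>t. s t i \<le> exp ((\<kappa> i + \<delta>) * real t) \<and> exp ((\<kappa> i - \<delta>) * real t) \<le> s t i) sequentially" for i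
    proof -
      have "eventually (\<lambda>t. ln (s t i) / real t < \<kappa> i + \<delta>) sequentially"
        "eventually (\<lambda>t. \<kappa> i - \<delta> < ln (s t i) / real t) sequentially"
        using order_tendstoD[OF lim[of i]] \<delta>(1) by auto
      then show ?thesis
        using eventually_ge_at_top[of 1]
      proof eventually_elim
        case (elim t)
        then have "ln (s t i) \<le> (\<kappa> i + \<delta>) * real t" "(\<kappa> i - \<delta>) * real t \<le> ln (s t i)"
          by (simp_all add: field_simps)
        then show ?case using s[of t i] by (metis exp_le_cancel_iff exp_ln)
      qed
    qed
    from eventually_all_finite[OF this] show ?thesis
      by (intro eventually_conj eventually_ge_at_top)
  qed
  \<comment> \<open>Absorbs the factor by which the exponential bounds at times \<open>t\<close> and
    \<open>Suc t\<close> differ, uniformly in the index.\<close>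
  define D where "D = C * (\<Sum>i\<in>UNIV. exp \<bar>\<kappa> i\<bar>) * exp \<delta>"
  have D: "0 \<le> D" using C by (simp add: D_def sum_nonneg)
  have expD: "C * exp \<bar>\<kappa> i\<bar> * exp \<delta> \<le> D" for i
    unfolding D_def using C by (intro mult_right_mono mult_left_mono member_le_sum) auto
  have main: "eventually (\<lambda>t. norm (proj_on (b (Suc t)) T - proj_on (b t) T)
      \<le> 2 * (real CARD('n))\<^sup>2 * (D * exp (- \<delta>) ^ t)) sequentially"
    using ev eventually_sequentially_Suc[THEN iffD2, OF ev]
  proof eventually_elim
    case (elim t)
    show ?case
    proof (rule norm_proj_on_diff_le[OF b(1) b(1)])
      show "0 \<le> D * exp (- \<delta>) ^ t" using D by simp
      fix i j assume ij: "i \<in> T" "j \<notin> T"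
      have gap: "\<kappa> j + \<delta> - (\<kappa> i - \<delta>) \<le> - 2 * \<delta>" using \<delta>(2)[OF ij] by linarith
      have gap_t: "(\<kappa> j + \<delta> - (\<kappa> i - \<delta>)) * real t \<le> - \<delta> * real t"
        using gap \<delta>(1) by (intro mult_right_mono) auto
      have pw: "exp (- \<delta>) ^ t = exp (- \<delta> * real t)" by (simp add: exp_of_nat_mult[symmetric] mult.commute)
      have *: "\<bar>u\<bar> \<le> D * exp (- \<delta>) ^ t"
        if u: "\<bar>u\<bar> * p \<le> C * q" and p: "exp x \<le> p" and q: "q \<le> exp y" and xy: "y - x \<le> \<bar>\<kappa> k\<bar> + \<delta> - \<delta> * real t" for u p q x y k
      proof -
        have "\<bar>u\<bar> * exp x \<le> \<bar>u\<bar> * p" by (intro mult_left_mono p) auto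
        also have "\<dots> \<le> C * q" by (rule u)
        also have "\<dots> \<le> C * exp y" by (intro mult_left_mono q C)
        finally have "\<bar>u\<bar> \<le> C * exp (y - x)" by (simp add: exp_diff pos_le_divide_eq)
        also have "\<dots> \<le> C * exp (\<bar>\<kappa> k\<bar> + \<delta> - \<delta> * real t)" using xy C by (intro mult_left_mono) auto
        also have "\<dots> = C * exp \<bar>\<kappa> k\<bar> * exp \<delta> * exp (- \<delta> * real t)"
          by (simp add: mult.assoc mult_exp_exp add.assoc)
        also have "\<dots> \<le> D * exp (- \<delta> * real t)" by (intro mult_right_mono expD) auto
        finally show ?thesis unfolding pw .
      qed
      \<comment> \<open>\<open>A t\<close> stretches \<open>b t j\<close> only by
        \<open>s t j\<close>, so \<open>A (Suc t)\<close> stretches it by at most \<open>C\<close>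
        times as much; this leaves little room for a component along a direction stretched by
        \<open>s (Suc t) i\<close>.\<close>
      have 1: "\<bar>b (Suc t) i \<bullet> b t j\<bar> * s (Suc t) i \<le> C * s t j"
        using norm_singular_vector(3)[OF b s, of "Suc t" i "b t j"] step(1)[of t "b t j"]
        by (simp add: norm_singular_vector(2)[OF b s])
      have 2: "\<bar>b t i \<bullet> b (Suc t) j\<bar> * s t i \<le> C * s (Suc t) j"
        using norm_singular_vector(3)[OF b s, of t i "b (Suc t) j"] step(2)[of t "b (Suc t) j"]
        by (simp add: norm_singular_vector(2)[OF b s])
      have "(\<kappa> j + \<delta>) * real t - (\<kappa> i - \<delta>) * real (Suc t) \<le> \<bar>\<kappa> i\<bar> + \<delta> - \<delta> * real t"
        using gap_t by (simp add: algebra_simps abs_if)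
      moreover have "(\<kappa> j + \<delta>) * real (Suc t) - (\<kappa> i - \<delta>) * real t \<le> \<bar>\<kappa> j\<bar> + \<delta> - \<delta> * real t"
        using gap_t by (simp add: algebra_simps abs_if)
      ultimately show "\<bar>b (Suc t) i \<bullet> b t j\<bar> \<le> D * exp (- \<delta>) ^ t \<and> \<bar>b t i \<bullet> b (Suc t) j\<bar> \<le> D * exp (- \<delta>) ^ t"
        using elim by (intro conjI *[OF 1, of "(\<kappa> i - \<delta>) * real (Suc t)" "(\<kappa> j + \<delta>) * real t"]
            *[OF 2, of "(\<kappa> i - \<delta>) * real t" "(\<kappa> j + \<delta>) * real (Suc t)"]) blast+
    qed
  qed
  have "summable (\<lambda>t. proj_on (b (Suc t)) T - proj_on (b t) T)"
  proof (rule summable_comparison_test_ev[OF main])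
    show "summable (\<lambda>t. 2 * (real CARD('n))\<^sup>2 * (D * exp (- \<delta>) ^ t))"
      using \<delta>(1) by (intro summable_mult summable_geometric) auto
  qed
  then have "convergent (\<lambda>n. \<Sum>t<n. proj_on (b (Suc t)) T - proj_on (b t) T)"
    by (simp add: summable_iff_convergent)
  then have "convergent (\<lambda>n. proj_on (b n) T - proj_on (b 0) T)"
    by (simp only: sum_lessThan_telescope[of "\<lambda>t. proj_on (b t) T"])
  then show ?thesis by (simp add: convergent_diff_const_right_iff)
qed

text \<open>Single singular vectors need not converge when exponents coincide. The projections onto
  groups of equal exponent do, being differences of two projections onto upper sets of exponents,
  and replacing the finite-time exponents by their limits changes the matrix by a null
  sequence.\<close>

theorem singular_value_root_convergent:
  fixes A :: "nat \<Rightarrow> real ^ 'n ^ 'n" and b :: "nat \<Rightarrow> 'n \<Rightarrow> real ^ 'n"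
  assumes b: "\<And>t. onb (b t)" "\<And>t i. (transpose (A t) ** A t) *v b t i = (s t i)\<^sup>2 *\<^sub>R b t i" and s: "\<And>t i. 0 < s t i"
    and step: "\<And>t x. norm (A (Suc t) *v x) \<le> C * norm (A t *v x)"
      "\<And>t x. norm (A t *v x) \<le> C * norm (A (Suc t) *v x)"
    and lim: "\<And>i. (\<lambda>t. ln (s t i) / real t) \<longlonglongrightarrow> \<kappa> i"
  shows "convergent (\<lambda>t. spec_matrix (b t) (\<lambda>i. exp (ln (s t i) / real t)))"
proof -
  have P: "convergent (\<lambda>t. proj_on (b t) {i. \<kappa> i = x})" for x
  proof -
    have "proj_on (b t) {i. \<kappa> i = x} = proj_on (b t) {i. x \<le> \<kappa> i} - proj_on (b t) {i. x < \<kappa> i}" for t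
    proof -
      have "{i. x \<le> \<kappa> i} - {i. x < \<kappa> i} = {i. \<kappa> i = x}" by auto
      moreover have "{i. x < \<kappa> i} \<subseteq> {i. x \<le> \<kappa> i}" by auto
      ultimately show ?thesis
        using sum.subset_diff[of "{i. x < \<kappa> i}" "{i. x \<le> \<kappa> i}" "\<lambda>i. outer (b t i) (b t i)"]
        by (simp add: proj_on_def)
    qed
    moreover have "convergent (\<lambda>t. proj_on (b t) {i. x \<le> \<kappa> i})" "convergent (\<lambda>t. proj_on (b t) {i. x < \<kappa> i})"
      by (rule proj_on_convergent[OF b s step lim]; simp)+
    ultimately show ?thesis by (simp add: convergent_diff)
  qed
  have main: "convergent (\<lambda>t. \<Sum>x\<in>range \<kappa>. exp x *\<^sub>R proj_on (b t) {i. \<kappa> i = x})"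
    using P by (intro convergent_sum bounded_linear.convergent[OF bounded_linear_scaleR_right])
  have eq: "(\<Sum>x\<in>range \<kappa>. exp x *\<^sub>R proj_on (b t) {i. \<kappa> i = x}) = (\<Sum>i\<in>UNIV. exp (\<kappa> i) *\<^sub>R outer (b t i) (b t i))" for t
    using sum.image_gen[of UNIV "\<lambda>i. exp (\<kappa> i) *\<^sub>R outer (b t i) (b t i)" \<kappa>]
    by (simp add: proj_on_def scaleR_sum_right)
  have "(\<lambda>t. spec_matrix (b t) (\<lambda>i. exp (ln (s t i) / real t)) - (\<Sum>i\<in>UNIV. exp (\<kappa> i) *\<^sub>R outer (b t i) (b t i))) \<longlonglongrightarrow> 0"
  proof (rule Lim_null_comparison)
    show "eventually (\<lambda>t. norm (spec_matrix (b t) (\<lambda>i. exp (ln (s t i) / real t)) - (\<Sum>i\<in>UNIV. exp (\<kappa> i) *\<^sub>R outer (b t i) (b t i)))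
      \<le> (\<Sum>i\<in>UNIV. \<bar>exp (ln (s t i) / real t) - exp (\<kappa> i)\<bar>)) sequentially"
    proof (rule always_eventually, rule allI)
      fix t
      have "spec_matrix (b t) (\<lambda>i. exp (ln (s t i) / real t)) - (\<Sum>i\<in>UNIV. exp (\<kappa> i) *\<^sub>R outer (b t i) (b t i))
          = (\<Sum>i\<in>UNIV. (exp (ln (s t i) / real t) - exp (\<kappa> i)) *\<^sub>R outer (b t i) (b t i))"
        by (simp add: spec_matrix_def scaleR_diff_left sum_subtractf)
      also have "norm \<dots> \<le> (\<Sum>i\<in>UNIV. \<bar>exp (ln (s t i) / real t) - exp (\<kappa> i)\<bar>)"
      proof (rule sum_norm_le)
        fix i
        show "norm ((exp (ln (s t i) / real t) - exp (\<kappa> i)) *\<^sub>R outer (b t i) (b t i)) \<le> \<bar>exp (ln (s t i) / real t) - exp (\<kappa> i)\<bar>"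
          using mult_left_mono[OF norm_outer_onb[OF b(1)[of t], of i], of "\<bar>exp (ln (s t i) / real t) - exp (\<kappa> i)\<bar>"] by simp
      qed
      finally show "norm (spec_matrix (b t) (\<lambda>i. exp (ln (s t i) / real t)) - (\<Sum>i\<in>UNIV. exp (\<kappa> i) *\<^sub>R outer (b t i) (b t i)))
          \<le> (\<Sum>i\<in>UNIV. \<bar>exp (ln (s t i) / real t) - exp (\<kappa> i)\<bar>)" .
    qed
    have "(\<lambda>t. \<Sum>i\<in>UNIV. \<bar>exp (ln (s t i) / real t) - exp (\<kappa> i)\<bar>) \<longlonglongrightarrow> (\<Sum>i\<in>(UNIV :: 'n set). \<bar>exp (\<kappa> i) - exp (\<kappa> i)\<bar>)"
      by (intro tendsto_intros lim)
    then show "(\<lambda>t. \<Sum>i\<in>UNIV. \<bar>exp (ln (s t i) / real t) - exp (\<kappa> i)\<bar>) \<longlonglongrightarrow> 0" by simp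
  qed
  then have "convergent (\<lambda>t. spec_matrix (b t) (\<lambda>i. exp (ln (s t i) / real t)) - (\<Sum>i\<in>UNIV. exp (\<kappa> i) *\<^sub>R outer (b t i) (b t i)))"
    by (rule convergentI)
  from convergent_add[OF this main[unfolded eq]] show ?thesis by simp
qed

section \<open>Energy along the linearized steps\<close>

definition coord_step :: "real ^ 'n ^ 'n \<Rightarrow> real \<Rightarrow> 'n::finite \<Rightarrow> real ^ 'n \<Rightarrow> real ^ 'n" where
  "coord_step H a i v = v - (a * (H *v v) $ i) *\<^sub>R axis i 1"

definition energy :: "real ^ 'n ^ 'n \<Rightarrow> real ^ 'n \<Rightarrow> real" where
  "energy H v = v \<bullet> (H *v v)"

lemma energy_coord_step:
  fixes H :: "real ^ 'n ^ 'n"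
  assumes "transpose H = H"
  shows "energy H (coord_step H a i v) = energy H v - a * (2 - a * H $ i $ i) * ((H *v v) $ i)\<^sup>2"
proof -
  note sym = symmetric_inner[OF assms]
  have ii: "(H *v axis i 1) $ i = H $ i $ i"
    by (simp add: matrix_vector_mult_basis column_def)
  let ?c = "a * (H *v v) $ i"
  have "energy H (v - ?c *\<^sub>R axis i 1) = v \<bullet> (H *v v) - 2 * ?c * (H *v v) $ i + ?c\<^sup>2 * H $ i $ i"
    unfolding energy_def
    by (simp add: matrix_vector_mult_diff_distrib matrix_vector_mult_scaleR inner_diff_left inner_diff_right
        inner_axis inner_axis' ii power2_eq_square sym[of v] algebra_simps)
  then show ?thesis
    by (simp add: coord_step_def energy_def power2_eq_square algebra_simps)
qed

lemma linear_coord_step: "linear (coord_step H a i)"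
  unfolding coord_step_def
  by (rule linearI)
    (simp_all add: matrix_vector_right_distrib matrix_vector_mult_scaleR algebra_simps scaleR_add_left scaleR_diff_right)

lemma linear_fold_coord_step: "linear (fold (coord_step H a) w)"
proof (induction w)
  case (Cons i w)
  from linear_compose[OF linear_coord_step Cons, of H a i] show ?case by (simp add: comp_def)
qed (simp add: linear_id[unfolded id_def] id_def)

lemma energy_scaleR: "energy H (c *\<^sub>R v) = c\<^sup>2 * energy H v"
  by (simp add: energy_def matrix_vector_mult_scaleR power2_eq_square)

lemma continuous_energy: "continuous_on S (energy H)"
  unfolding energy_def
  by (intro continuous_intros linear_continuous_on matrix_vector_mul_bounded_linear)

locale nondegenerate_form =
  fixes H :: "real ^ 'n ^ 'n" and a :: real
  assumes sym: "transpose H = H"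
    and nondeg: "\<And>v. H *v v = 0 \<Longrightarrow> v = 0"
    and a_pos: "0 < a"
    and a_diag: "\<And>i. a * H $ i $ i < 1"
begin

abbreviation "run \<equiv> fold (coord_step H a)"

lemma step_factor_pos:
  assumes "0 < b" "b \<le> c" "c * H $ i $ i < 1"
  shows "0 < b * (2 - b * H $ i $ i)"
proof -
  have "b * H $ i $ i < 1"
  proof (cases "0 \<le> H $ i $ i")
    case True
    then show ?thesis using mult_right_mono[OF assms(2) True] assms(3) by linarith
  next
    case False
    then have "b * H $ i $ i < 0" using assms(1) by (intro mult_pos_neg) auto
    then show ?thesis by linarith
  qed
  then show ?thesis using assms(1) by (intro mult_pos_pos) auto
qed

lemma energy_step_le: "energy H (coord_step H a i v) \<le> energy H v"
  using step_factor_pos[of a a i] a_pos a_diag[of i] unfolding energy_coord_step[OF sym]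
  by (simp add: less_imp_le)

lemma energy_run_le: "energy H (run w v) \<le> energy H v"
proof (induction w arbitrary: v)
  case (Cons i w)
  then show ?case using energy_step_le[of i v] order_trans by fastforce
qed simp

text \<open>Each step lowers the energy strictly unless its component of \<open>H *v v\<close>
  vanishes, and in that case it fixes \<open>v\<close>. Without any loss, \<open>v\<close> therefore
  stays put and every visited component is tested at \<open>v\<close> itself.\<close>

lemma energy_run_eq:
  assumes "energy H (run w v) = energy H v" "i \<in> set w"
  shows "(H *v v) $ i = 0"
  using assms
proof (induction w arbitrary: v)
  case (Cons j w)
  have "energy H v = energy H (run w (coord_step H a j v))" using Cons.prems(1) by simp
  then have eq: "energy H (coord_step H a j v) = energy H v"
    using energy_run_le[of w "coord_step H a j v"] energy_step_le[of j v] by linarith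
  then have j: "(H *v v) $ j = 0"
    using step_factor_pos[of a a j] a_pos a_diag[of j] unfolding energy_coord_step[OF sym] by simp
  then have "coord_step H a j v = v" by (simp add: coord_step_def)
  then show ?case using Cons j by auto
qed simp

definition sweep :: "'n list" where
  "sweep = (SOME w. set w = UNIV)"

lemma set_sweep: "set sweep = UNIV"
  unfolding sweep_def by (rule someI_ex) (rule finite_list[OF finite])

text \<open>The loss over a sweep is continuous, homogeneous of degree 2 and positive away from 0,
  because a sweep visits all coordinates and \<open>H\<close> is nondegenerate. Its minimum on the
  unit sphere serves as \<open>\<kappa>\<close>.\<close>

lemma sweep_decrease: "\<exists>\<kappa>>0. \<forall>v. \<kappa> * (norm v)\<^sup>2 \<le> energy H v - energy H (run sweep v)"
proof -
  let ?g = "\<lambda>v. energy H v - energy H (run sweep v)"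
  have lin: "linear (run sweep)" by (rule linear_fold_coord_step)
  have cont: "continuous_on (sphere 0 1) ?g"
    by (intro continuous_intros continuous_energy
        continuous_on_compose2[OF continuous_energy[of UNIV] linear_continuous_on] subset_UNIV)
      (use lin in \<open>simp add: linear_conv_bounded_linear\<close>)
  have ne: "sphere (0 :: real ^ 'n) 1 \<noteq> {}" by simp
  obtain u where u: "u \<in> sphere 0 1" "\<And>v. v \<in> sphere 0 1 \<Longrightarrow> ?g u \<le> ?g v"
    using continuous_attains_inf[OF compact_sphere ne cont] by blast
  have pos: "?g u > 0"
  proof (rule ccontr)
    assume "\<not> ?thesis"
    then have "energy H (run sweep u) = energy H u" using energy_run_le[of sweep u] by linarith
    then have "H *v u = 0"
      using energy_run_eq[of sweep u] set_sweep by (simp add: vec_eq_iff)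
    then show False using nondeg[of u] u(1) by simp
  qed
  have "?g u * (norm v)\<^sup>2 \<le> ?g v" for v
  proof (cases "v = 0")
    case True
    then show ?thesis using linear_0[OF lin] by (simp add: energy_def)
  next
    case False
    have "?g u \<le> ?g (v /\<^sub>R norm v)" using False by (intro u(2)) simp
    also have "\<dots> = ?g v / (norm v)\<^sup>2"
      by (simp add: linear_scale[OF lin] energy_scaleR power_inverse divide_inverse algebra_simps)
    finally show ?thesis using False by (simp add: pos_le_divide_eq)
  qed
  then show ?thesis using pos by blast
qed

section \<open>The subspace of trapped directions\<close>

definition trapped :: "(real ^ 'n) set" where
  "trapped = {v. \<forall>w. 0 \<le> energy H (run w v)}"

lemma trapped_run: "v \<in> trapped \<Longrightarrow> run w v \<in> trapped"
proof -
  assume v: "v \<in> trapped"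
  have "0 \<le> energy H (run w' (run w v))" for w'
    using v unfolding trapped_def by (auto dest: spec[of _ "w @ w'"])
  then show ?thesis by (simp add: trapped_def)
qed

lemma trapped_coord_step: "v \<in> trapped \<Longrightarrow> coord_step H a i v \<in> trapped"
  using trapped_run[of v "[i]"] by simp

abbreviation "sweeps m \<equiv> run (concat (replicate m sweep))"

text \<open>Each sweep spends at least \<open>\<kappa>\<close> times the squared norm, while energy
  that never becomes negative limits the total to the initial energy. Hence the squared norms are
  summable.\<close>

lemma sweeps_tendsto_0:
  assumes "v \<in> trapped"
  shows "(\<lambda>m. sweeps m v) \<longlonglongrightarrow> 0"
proof -
  obtain \<kappa> where \<kappa>: "\<kappa> > 0" "\<And>v. \<kappa> * (norm v)\<^sup>2 \<le> energy H v - energy H (run sweep v)"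
    using sweep_decrease by blast
  have run_Suc: "sweeps (Suc m) v = run sweep (sweeps m v)" for m
  proof -
    have "concat (replicate (Suc m) sweep) = concat (replicate m sweep) @ sweep"
      by (induction m) auto
    then show ?thesis by simp
  qed
  have sum: "\<kappa> * (\<Sum>m<n. (norm (sweeps m v))\<^sup>2) \<le> energy H v - energy H (sweeps n v)" for n
  proof (induction n)
    case (Suc n)
    then show ?case using \<kappa>(2)[of "sweeps n v"] unfolding run_Suc by (simp add: algebra_simps)
  qed simp
  have "summable (\<lambda>m. (norm (sweeps m v))\<^sup>2)"
  proof (rule summableI_nonneg_bounded[where x="energy H v / \<kappa>"])
    fix n
    have "0 \<le> energy H (sweeps n v)" using assms by (simp add: trapped_def)
    then show "(\<Sum>m<n. (norm (sweeps m v))\<^sup>2) \<le> energy H v / \<kappa>"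
      using sum[of n] \<kappa>(1) by (simp add: pos_le_divide_eq mult.commute)
  qed simp
  then have "(\<lambda>m. sqrt ((norm (sweeps m v))\<^sup>2)) \<longlonglongrightarrow> sqrt 0"
    by (intro tendsto_real_sqrt summable_LIMSEQ_zero)
  then show ?thesis by (simp add: tendsto_norm_zero_iff)
qed

text \<open>Closure under addition is invisible in the sign of a quadratic form. It follows from
  contraction: the sweeps of a sum also tend to 0, so the energy, which only decreases, has limit 0
  and was nonnegative before.\<close>

lemma subspace_trapped: "subspace trapped"
proof (rule subspaceI)
  show "0 \<in> trapped"
    by (simp add: trapped_def linear_0[OF linear_fold_coord_step] energy_def)
  show "c *\<^sub>R v \<in> trapped" if "v \<in> trapped" for c v
    using that by (simp add: trapped_def linear_scale[OF linear_fold_coord_step] energy_scaleR)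
  show "u + v \<in> trapped" if u: "u \<in> trapped" and v: "v \<in> trapped" for u v
    unfolding trapped_def
  proof safe
    fix w
    let ?z = "run w (u + v)"
    have "sweeps m ?z = sweeps m (run w u) + sweeps m (run w v)" for m
      by (simp add: linear_add[OF linear_fold_coord_step])
    then have "(\<lambda>m. sweeps m ?z) \<longlonglongrightarrow> 0"
      using tendsto_add[OF sweeps_tendsto_0[OF trapped_run[OF u]] sweeps_tendsto_0[OF trapped_run[OF v]]] by simp
    then have "(\<lambda>m. energy H (sweeps m ?z)) \<longlonglongrightarrow> energy H 0"
      using continuous_on_tendsto_compose[OF continuous_energy[of UNIV H]] by simp
    then have "energy H 0 \<le> energy H ?z"
      by (rule LIMSEQ_le_const2) (auto intro: energy_run_le)
    then show "0 \<le> energy H (run w (u + v))" by (simp add: energy_def)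
  qed
qed

text \<open>Both \<open>v\<close> and its image under a step are trapped, hence so is their
  difference, a nonzero multiple of the axis vector.\<close>

lemma trapped_contains_axis:
  assumes "v \<in> trapped" "(H *v v) $ i \<noteq> 0"
  shows "axis i 1 \<in> trapped"
proof -
  have "v - coord_step H a i v \<in> trapped"
    by (intro subspace_diff subspace_trapped trapped_coord_step assms)
  then have "(a * (H *v v) $ i) *\<^sub>R axis i (1 :: real) \<in> trapped"
    by (simp add: coord_step_def)
  from subspace_mul[OF subspace_trapped this, of "inverse (a * (H *v v) $ i)"]
  moreover have "a * (H *v v) $ i \<noteq> 0" using assms a_pos by simp
  ultimately show ?thesis by (simp only: scaleR_scaleR left_inverse not_False_eq_True scaleR_one)
qed

lemma ex_trapped_axis:
  assumes "v \<in> trapped" "v \<noteq> 0"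
  shows "\<exists>i. axis i 1 \<in> trapped"
  using nondeg[of v] assms trapped_contains_axis[OF assms(1)] by (metis vec_eq_iff zero_index)

text \<open>This passes from the fixed step size \<open>a\<close>, for which \<open>trapped\<close>
  is defined, to the random sizes of the cocycle.\<close>

lemma trapped_any_step:
  assumes "v \<in> trapped"
  shows "coord_step H b i v \<in> trapped"
proof (cases "(H *v v) $ i = 0")
  case False
  then have "(b * (H *v v) $ i) *\<^sub>R axis i 1 \<in> trapped"
    by (intro subspace_mul subspace_trapped trapped_contains_axis[OF assms])
  then show ?thesis unfolding coord_step_def by (intro subspace_diff subspace_trapped assms)
qed (use assms in \<open>simp add: coord_step_def\<close>)

lemma trapped_energy_lower: "\<exists>\<kappa>>0. \<forall>v\<in>trapped. \<kappa> * (norm v)\<^sup>2 \<le> energy H v"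
proof -
  obtain \<kappa> where \<kappa>: "\<kappa> > 0" "\<And>v. \<kappa> * (norm v)\<^sup>2 \<le> energy H v - energy H (run sweep v)"
    using sweep_decrease by blast
  have "\<kappa> * (norm v)\<^sup>2 \<le> energy H v" if "v \<in> trapped" for v
  proof -
    have "0 \<le> energy H (run sweep v)" using that by (simp add: trapped_def)
    then show ?thesis using \<kappa>(2)[of v] by linarith
  qed
  with \<kappa>(1) show ?thesis by blast
qed

text \<open>On trapped vectors the energy dominates a multiple of the squared norm, and it does not
  increase under any step of size at most \<open>amax\<close>.\<close>

lemma trapped_bounded_orbits:
  assumes v: "v \<in> trapped" and amax: "\<And>i. amax * H $ i $ i < 1"
  shows "\<exists>B. \<forall>w. (\<forall>(b, i)\<in>set w. 0 < b \<and> b \<le> amax) \<longrightarrow> norm (fold (\<lambda>(b, i). coord_step H b i) w v) \<le> B"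
proof -
  obtain \<kappa> where \<kappa>: "\<kappa> > 0" "\<And>v. v \<in> trapped \<Longrightarrow> \<kappa> * (norm v)\<^sup>2 \<le> energy H v"
    using trapped_energy_lower by blast
  have *: "fold (\<lambda>(b, i). coord_step H b i) w v \<in> trapped \<and> energy H (fold (\<lambda>(b, i). coord_step H b i) w v) \<le> energy H v"
    if "\<forall>(b, i)\<in>set w. 0 < b \<and> b \<le> amax" "v \<in> trapped" for w v
    using that
  proof (induction w arbitrary: v)
    case (Cons p w)
    obtain b i where p: "p = (b, i)" by fastforce
    then have b: "0 < b" "b \<le> amax" using Cons.prems by auto
    have "energy H (coord_step H b i v) \<le> energy H v"
      using step_factor_pos[OF b amax] unfolding energy_coord_step[OF sym] by (simp add: less_imp_le)
    moreover have "coord_step H b i v \<in> trapped" by (rule trapped_any_step) (use Cons.prems in auto)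
    ultimately show ?case using Cons.IH[of "coord_step H b i v"] Cons.prems(1) p by fastforce
  qed simp
  show ?thesis
  proof (intro exI[of _ "sqrt (energy H v / \<kappa>)"] allI impI)
    fix w :: "(real \<times> 'n) list" assume w: "\<forall>(b, i)\<in>set w. 0 < b \<and> b \<le> amax"
    let ?x = "fold (\<lambda>(b, i). coord_step H b i) w v"
    have "\<kappa> * (norm ?x)\<^sup>2 \<le> energy H v"
      using *[OF w v] \<kappa>(2)[of ?x] by linarith
    then have "(norm ?x)\<^sup>2 \<le> energy H v / \<kappa>"
      using \<kappa>(1) by (simp add: pos_le_divide_eq mult.commute)
    then show "norm ?x \<le> sqrt (energy H v / \<kappa>)"
      by (rule real_le_rsqrt)
  qed
qed

end

section \<open>The multiplicative ergodic theorem\<close>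

lemma space_step_space: "space (step_space a b :: ('n::finite \<times> real) measure) = UNIV \<times> {a..b}"
  by (simp add: step_space_def space_pair_measure space_restrict_space uniform_count_measure_def space_point_measure)

lemma prob_space_step_space:
  assumes "a < b"
  shows "prob_space (step_space a b :: ('n::finite \<times> real) measure)"
proof -
  have "prob_space (uniform_measure (restrict_space lborel {a..b}) {a..b})"
    by (rule prob_space_uniform_measure) (use assms in \<open>simp_all add: emeasure_restrict_space\<close>)
  moreover have "prob_space (uniform_count_measure (UNIV :: 'n set))"
    by (rule prob_space_uniform_count_measure) auto
  ultimately show ?thesis
    unfolding step_space_def by (simp add: prob_space_pair)
qed

lemma fst_step_space [measurable]: "fst \<in> measurable (step_space a b) (count_space (UNIV :: 'n::finite set))"
proof -
  have "fst \<in> measurable (step_space a b) (uniform_count_measure (UNIV :: 'n set))"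
    unfolding step_space_def by simp
  moreover have "measurable (step_space a b :: ('n \<times> real) measure) (uniform_count_measure (UNIV :: 'n set))
      = measurable (step_space a b) (count_space UNIV)"
    by (intro measurable_cong_sets) (auto simp: sets_uniform_count_measure)
  ultimately show ?thesis by blast
qed

lemma snd_step_space [measurable]: "snd \<in> borel_measurable (step_space a b :: ('n::finite \<times> real) measure)"
proof -
  have "snd \<in> measurable (step_space a b :: ('n \<times> real) measure) (uniform_measure (restrict_space lborel {a..b}) {a..b})"
    unfolding step_space_def by simp
  moreover have "(\<lambda>x. x) \<in> borel_measurable (uniform_measure (restrict_space lborel {a..b}) {a..b})"
    by (simp cong: measurable_cong_sets add: measurable_restrict_space1)
  ultimately show ?thesis by (rule measurable_compose)
qed

lemma sequence_space_step_space: "a < b \<Longrightarrow> sequence_space (step_space a b)"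
  by (simp add: sequence_space_def product_prob_space_def product_prob_space_axioms_def product_sigma_finite_def
      prob_space_step_space prob_space_imp_sigma_finite)

lemma prob_space_sample_space: "a < b \<Longrightarrow> prob_space (sample_space a b)"
  unfolding sample_space_def by (intro prob_space_PiM prob_space_step_space)

lemma sample_space_range:
  assumes "\<omega> \<in> space (sample_space a b)"
  shows "snd (\<omega> t) \<in> {a..b}"
proof -
  have "\<omega> t \<in> space (step_space a b)"
    using assms by (auto simp: sample_space_def space_PiM)
  then show ?thesis by (auto simp: space_step_space)
qed

lemma component_sample_space [measurable]: "(\<lambda>\<omega>. \<omega> t) \<in> measurable (sample_space a b) (step_space a b)"
  unfolding sample_space_def by simp

lemma shift_measurable [measurable]: "shift \<in> measurable (sample_space a b) (sample_space a b)"
  unfolding sample_space_def shift_def by (intro measurable_PiM_single') (auto simp: space_PiM)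

lemma distr_shift:
  assumes "a < b"
  shows "distr (sample_space a b) (sample_space a b) shift = (sample_space a b :: 'n::finite sample measure)"
proof -
  have eq: "shift = (\<lambda>\<omega> :: 'n sample. \<lambda>n\<in>UNIV. \<omega> (Suc n))" by (simp add: shift_def fun_eq_iff)
  show ?thesis
    unfolding sample_space_def eq
    using distr_PiM_reindex[of UNIV "\<lambda>_. step_space a b" Suc UNIV] prob_space_step_space[OF assms] by simp
qed

lemma shift_pow: "(shift ^^ m) \<omega> = (\<lambda>t. \<omega> (m + t))"
  by (induction m) (auto simp: shift_def)

section \<open>The cocycle as a product of coordinate steps\<close>

lemma coord_proj_mult: "coord_proj i *v y = y $ i *\<^sub>R axis i 1"
proof -
  have cp: "coord_proj i $ r $ c = (if r = i \<and> c = i then 1 else 0)" for r c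
    by (simp add: coord_proj_def matrix_matrix_mult_def columnvector_def rowvector_def axis_def)
  have "(\<Sum>c\<in>UNIV. coord_proj i $ r $ c * y $ c) = (\<Sum>c\<in>UNIV. if c = i then if r = i then y $ i else 0 else 0)" for r
    by (intro sum.cong) (auto simp: cp)
  then show ?thesis
    by (simp add: vec_eq_iff matrix_vector_mult_def axis_def)
qed

lemma lin_step_mult: "lin_step H \<omega> *v x = coord_step H (snd (\<omega> 0)) (fst (\<omega> 0)) x"
  by (simp add: lin_step_def coord_step_def matrix_vector_mult_diff_rdistrib scaleR_matrix_vector_assoc[symmetric]
      matrix_vector_mul_assoc[symmetric] coord_proj_mult)

lemma cocycle_add: "cocycle H (m + n) \<omega> = cocycle H n ((shift ^^ m) \<omega>) ** cocycle H m \<omega>"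
proof (induction n)
  case (Suc n)
  have "(shift ^^ n) ((shift ^^ m) \<omega>) = (shift ^^ (m + n)) \<omega>"
    by (simp add: shift_pow add.assoc)
  then show ?case using Suc by (simp add: matrix_mul_assoc)
qed simp

lemma cocycle_fold:
  "cocycle H t \<omega> *v x = fold (\<lambda>(b, i). coord_step H b i) (map (\<lambda>j. (snd (\<omega> j), fst (\<omega> j))) [0..<t]) x"
proof (induction t)
  case (Suc t)
  then show ?case by (simp add: matrix_vector_mul_assoc[symmetric] lin_step_mult shift_pow)
qed simp

lemma lin_step_measurable [measurable]:
  fixes H :: "real ^ 'n ^ 'n"
  shows "lin_step H \<in> borel_measurable (sample_space a b)"
proof -
  have "(\<lambda>i. coord_proj i ** H) \<in> borel_measurable (count_space UNIV)" by simp
  then have "(\<lambda>\<omega>. coord_proj (fst (\<omega> 0)) ** H) \<in> borel_measurable (sample_space a b)"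
    by (rule measurable_compose_rev) measurable
  then show ?thesis unfolding lin_step_def[abs_def] by measurable
qed

lemma matrix_mult_measurable:
  fixes A B :: "'a \<Rightarrow> real ^ 'n ^ 'n"
  assumes "A \<in> borel_measurable M" "B \<in> borel_measurable M"
  shows "(\<lambda>x. A x ** B x) \<in> borel_measurable M"
proof (rule borel_measurable_continuous_Pair[OF assms])
  show "continuous_on UNIV (\<lambda>x :: (real ^ 'n ^ 'n) \<times> (real ^ 'n ^ 'n). fst x ** snd x)"
    unfolding matrix_matrix_mult_def by (intro continuous_intros)
qed

lemma shift_pow_measurable [measurable]: "(shift ^^ m) \<in> measurable (sample_space a b) (sample_space a b)"
  by (induction m) (simp_all add: measurable_comp[OF _ shift_measurable, unfolded comp_def])

lemma cocycle_measurable: "cocycle H t \<in> borel_measurable (sample_space a b)"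
proof (induction t)
  case (Suc t)
  have "(\<lambda>\<omega>. lin_step H ((shift ^^ t) \<omega>)) \<in> borel_measurable (sample_space a b)"
    by measurable
  from matrix_mult_measurable[OF this Suc] show ?case by simp
qed simp

text \<open>The norm bounds give the upper estimate for \<open>A\<close> and for its inverse; the
  lower one follows because the growths of \<open>A\<close> and \<open>B\<close> have product at
  least 1.\<close>

lemma growth_single_bound:
  fixes A B :: "real ^ 'n ^ 'n"
  assumes AB: "A ** B = mat 1" "B ** A = mat 1"
    and A: "\<And>x. norm (A *v x) \<le> c * norm x" and B: "\<And>x. norm (B *v x) \<le> c * norm x" and c: "1 \<le> c"
  shows "\<bar>ln (growth K A)\<bar> \<le> ln (fact CARD('n) * c ^ CARD('n) * c ^ CARD('n))"
proof -
  let ?G = "fact CARD('n) * c ^ CARD('n) * c ^ CARD('n)"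
  have *: "growth K A \<le> ?G" if AB: "A ** B = mat 1" and A: "\<And>x. norm (A *v x) \<le> c * norm x"
    and B: "\<And>x. norm (B *v x) \<le> c * norm x" for A B :: "real ^ 'n ^ 'n"
  proof -
    have "det (\<chi> i. A *v axis i (1::real)) = det A * det ((\<chi> i. axis i 1) :: real ^ 'n ^ 'n)"
      by (rule det_map_rows)
    then have "\<bar>det A\<bar> = \<bar>det (\<chi> i. A *v axis i (1::real))\<bar>"
      using abs_det_orthonormal_rows[OF onb_axis[where 'a='n]] by (simp add: abs_mult)
    also have "\<dots> \<le> fact CARD('n) * c ^ CARD('n)"
    proof (rule abs_det_le)
      show "norm ((\<chi> i. A *v axis i (1::real)) $ i) \<le> c" for i
        using A[of "axis i 1"] by simp
    qed
    finally have "\<bar>det A\<bar> \<le> fact CARD('n) * c ^ CARD('n)" .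
    then have "\<bar>det A\<bar> * c ^ CARD('n) \<le> ?G" using c by (intro mult_right_mono) auto
    then show ?thesis using growth_bound[OF AB B c, of K] by linarith
  qed
  have inv: "invertible A" "invertible B" using AB invertibleI by blast+
  have pos: "0 < growth K A" "0 < growth K B" by (rule growth_pos; rule inv)+
  have "1 \<le> growth K A * growth K B"
    using growth_mult[OF inv, of K] AB growth_mat_1[of K] by metis
  then have "0 \<le> ln (growth K A) + ln (growth K B)"
    by (metis ln_ge_zero ln_mult_pos pos)
  moreover have "ln (growth K A) \<le> ln ?G" "ln (growth K B) \<le> ln ?G"
    using *[OF AB(1) A B] *[OF AB(2) B A] pos by (simp_all add: ln_mono)
  ultimately show ?thesis by linarith
qed

locale coordinate_cocycle =
  fixes H :: "real ^ 'n ^ 'n" and amin amax :: real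
  assumes amin: "0 < amin" and amax: "amin < amax" and diag: "\<And>i. amax * H $ i $ i < 1"
begin

abbreviation "\<Omega> \<equiv> (sample_space amin amax :: 'n sample measure)"

abbreviation "cocycle_root t \<omega> \<equiv> mat_root (2 * t) (transpose (cocycle H t \<omega>) ** cocycle H t \<omega>)"

text \<open>The rank-one inverse formula of Sherman and Morrison: the inverse of a coordinate step
  is again a coordinate step, with size \<open>- b / (1 - b * H $ i $ i)\<close>.\<close>

definition step_inv :: "real \<Rightarrow> 'n \<Rightarrow> real ^ 'n ^ 'n" where
  "step_inv b i = matrix (coord_step H (- (b / (1 - b * H $ i $ i))) i)"

lemma step_inv_mult: "step_inv b i *v x = coord_step H (- (b / (1 - b * H $ i $ i))) i x"
  unfolding step_inv_def by (rule fun_cong[OF matrix_vector_mul(2)[OF linear_coord_step]])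

lemma diag_step: "b \<in> {amin..amax} \<Longrightarrow> b * H $ i $ i < 1"
proof (cases "0 \<le> H $ i $ i")
  case True
  assume "b \<in> {amin..amax}"
  then show ?thesis using mult_right_mono[of b amax, OF _ True] diag[of i] by auto
next
  case False
  assume "b \<in> {amin..amax}"
  then have "b * H $ i $ i < 0" using False amin by (intro mult_pos_neg) auto
  then show ?thesis by linarith
qed

lemma coord_step_inverse:
  assumes b: "b * H $ i $ i \<noteq> 1"
  shows "coord_step H (- (b / (1 - b * H $ i $ i))) i (coord_step H b i x) = x"
    and "coord_step H b i (coord_step H (- (b / (1 - b * H $ i $ i))) i x) = x"
proof -
  have ii: "(H *v axis i 1) $ i = H $ i $ i"
    by (simp add: matrix_vector_mult_basis column_def)
  have *: "(H *v coord_step H c i x) $ i = (1 - c * H $ i $ i) * (H *v x) $ i" for c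
    by (simp add: coord_step_def matrix_vector_mult_diff_distrib matrix_vector_mult_scaleR ii algebra_simps)
  have comp: "coord_step H c' i (coord_step H c i x) = x - ((c + c' * (1 - c * H $ i $ i)) * (H *v x) $ i) *\<^sub>R axis i 1" for c c'
    unfolding coord_step_def[of H c'] *
    by (simp add: coord_step_def diff_diff_eq scaleR_add_left[symmetric] distrib_right mult.assoc)
  let ?c = "- (b / (1 - b * H $ i $ i))"
  have "b + ?c * (1 - b * H $ i $ i) = 0" using b by simp
  moreover have "?c + b * (1 - ?c * H $ i $ i) = 0"
  proof -
    have "- (b / d) + b * (1 - - (b / d) * h) = 0" if "d \<noteq> 0" "d = 1 - b * h" for d h :: real
      using that by (simp add: field_simps)
    then show ?thesis using b by simp
  qed
  ultimately show "coord_step H ?c i (coord_step H b i x) = x" "coord_step H b i (coord_step H ?c i x) = x"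
    unfolding comp by simp_all
qed

lemma step_inverse:
  assumes "\<omega> \<in> space \<Omega>"
  shows "lin_step H \<omega> ** step_inv (snd (\<omega> 0)) (fst (\<omega> 0)) = mat 1"
    and "step_inv (snd (\<omega> 0)) (fst (\<omega> 0)) ** lin_step H \<omega> = mat 1"
proof -
  have ne: "snd (\<omega> 0) * H $ i $ i \<noteq> 1" for i
    using diag_step[OF sample_space_range[OF assms]] by (metis less_irrefl)
  show "lin_step H \<omega> ** step_inv (snd (\<omega> 0)) (fst (\<omega> 0)) = mat 1"
    "step_inv (snd (\<omega> 0)) (fst (\<omega> 0)) ** lin_step H \<omega> = mat 1"
    by (simp_all add: matrix_eq matrix_vector_mul_assoc[symmetric] lin_step_mult step_inv_mult coord_step_inverse[OF ne])
qed

lemma norm_coord_step_le: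
  assumes "\<And>x. norm (H *v x) \<le> norm x * k" "\<bar>c\<bar> \<le> m"
  shows "norm (coord_step H c i x) \<le> (1 + m * \<bar>k\<bar>) * norm x"
proof -
  have "norm (coord_step H c i x) \<le> norm x + \<bar>c\<bar> * \<bar>(H *v x) $ i\<bar>"
    unfolding coord_step_def by (rule order_trans[OF norm_triangle_ineq4]) (simp add: abs_mult)
  also have "\<bar>(H *v x) $ i\<bar> \<le> \<bar>k\<bar> * norm x"
  proof -
    have "\<bar>(H *v x) $ i\<bar> \<le> norm x * k"
      using component_le_norm_cart[of "H *v x" i] assms(1)[of x] by linarith
    also have "\<dots> \<le> norm x * \<bar>k\<bar>" by (intro mult_left_mono) auto
    finally show ?thesis by (simp add: mult.commute)
  qed
  then have "\<bar>c\<bar> * \<bar>(H *v x) $ i\<bar> \<le> m * (\<bar>k\<bar> * norm x)"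
    using assms(2) by (intro mult_mono) auto
  finally show ?thesis by (simp add: algebra_simps)
qed

lemma uniform_bounds:
  obtains c where "1 \<le> c"
    "\<And>\<omega> x. \<omega> \<in> space \<Omega> \<Longrightarrow> norm (lin_step H \<omega> *v x) \<le> c * norm x"
    "\<And>\<omega> x. \<omega> \<in> space \<Omega> \<Longrightarrow> norm (step_inv (snd (\<omega> 0)) (fst (\<omega> 0)) *v x) \<le> c * norm x"
proof -
  obtain k where k: "\<And>x. norm (H *v x) \<le> norm x * k"
    using bounded_linear.bounded[OF matrix_vector_mul_bounded_linear[of H]] by blast
  define \<eta> where "\<eta> = Min (insert 1 (range (\<lambda>i. 1 - amax * H $ i $ i)))"
  have \<eta>: "0 < \<eta>" "\<eta> \<le> 1"
    using diag by (auto simp: \<eta>_def)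
  have \<eta>3: "\<eta> \<le> 1 - amax * H $ i $ i" for i
    unfolding \<eta>_def by (rule Min_le) auto
  have gap: "\<eta> \<le> 1 - b * H $ i $ i" if "b \<in> {amin..amax}" for b i
  proof (cases "0 \<le> H $ i $ i")
    case True
    then show ?thesis using mult_right_mono[of b amax, OF _ True] \<eta>3[of i] that by auto
  next
    case False
    then have "b * H $ i $ i \<le> 0" using that amin by (intro mult_nonneg_nonpos) auto
    then show ?thesis using \<eta>(2) by linarith
  qed
  \<comment> \<open>Bounds the step sizes of the inverse steps, whose denominators are at least
    \<open>\<eta>\<close>.\<close>
  define m where "m = amax / \<eta>"
  have m: "amax \<le> m" using \<eta> amin amax by (simp add: m_def field_simps)
  let ?c = "1 + m * \<bar>k\<bar>"
  show ?thesis
  proof (rule that[of ?c])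
    show "1 \<le> ?c" using m amin amax by simp
    fix \<omega> :: "'n sample" and x assume "\<omega> \<in> space \<Omega>"
    then have b: "snd (\<omega> 0) \<in> {amin..amax}" by (rule sample_space_range)
    show "norm (lin_step H \<omega> *v x) \<le> ?c * norm x"
      unfolding lin_step_mult by (rule norm_coord_step_le[OF k]) (use b m amin in auto)
    have "\<bar>- (snd (\<omega> 0) / (1 - snd (\<omega> 0) * H $ i $ i))\<bar> \<le> m" for i
    proof -
      have "0 < 1 - snd (\<omega> 0) * H $ i $ i" "0 < snd (\<omega> 0)"
        using gap[OF b, of i] \<eta>(1) b amin by auto
      then have "\<bar>- (snd (\<omega> 0) / (1 - snd (\<omega> 0) * H $ i $ i))\<bar> = snd (\<omega> 0) / (1 - snd (\<omega> 0) * H $ i $ i)"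
        by simp
      also have "\<dots> \<le> m"
        unfolding m_def by (rule frac_le) (use gap[OF b, of i] \<eta>(1) b amin amax in auto)
      finally show ?thesis .
    qed
    then show "norm (step_inv (snd (\<omega> 0)) (fst (\<omega> 0)) *v x) \<le> ?c * norm x"
      unfolding step_inv_mult by (intro norm_coord_step_le[OF k])
  qed
qed

lemma shift_space: "\<omega> \<in> space \<Omega> \<Longrightarrow> (shift ^^ m) \<omega> \<in> space \<Omega>"
  using measurable_space[OF shift_pow_measurable] .

lemma invertible_cocycle: "\<omega> \<in> space \<Omega> \<Longrightarrow> invertible (cocycle H t \<omega>)"
proof (induction t)
  case (Suc t)
  have "invertible (lin_step H ((shift ^^ t) \<omega>))"
    using step_inverse(1)[OF shift_space[OF Suc.prems]] invertibleI by blast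
  then show ?case using Suc by (simp add: invertible_mult)
qed (simp add: invertible_def)

lemma growth_subadditive: "\<exists>C. bounded_subadditive \<Omega> shift (\<lambda>n \<omega>. ln (growth K (cocycle H n \<omega>))) C"
proof -
  obtain c where c: "1 \<le> c"
    "\<And>\<omega> x. \<omega> \<in> space \<Omega> \<Longrightarrow> norm (lin_step H \<omega> *v x) \<le> c * norm x"
    "\<And>\<omega> x. \<omega> \<in> space \<Omega> \<Longrightarrow> norm (step_inv (snd (\<omega> 0)) (fst (\<omega> 0)) *v x) \<le> c * norm x"
    using uniform_bounds by blast
  define C where "C = ln (fact CARD('n) * c ^ CARD('n) * c ^ CARD('n))"
  let ?g = "\<lambda>n \<omega>. ln (growth K (cocycle H n \<omega>))"
  have single: "\<bar>ln (growth K (lin_step H \<omega>))\<bar> \<le> C" "\<bar>ln (growth K (step_inv (snd (\<omega> 0)) (fst (\<omega> 0))))\<bar> \<le> C"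
    if "\<omega> \<in> space \<Omega>" for \<omega>
    unfolding C_def using growth_single_bound[OF step_inverse[OF that] c(2,3)[OF that] c(1)]
      growth_single_bound[OF step_inverse(2,1)[OF that] c(3,2)[OF that] c(1)] by blast+
  have ln_mult_le: "ln (growth K (A ** B)) \<le> ln (growth K A) + ln (growth K B)"
    if "invertible A" "invertible B" for A B :: "real ^ 'n ^ 'n"
    using growth_mult[OF that, of K] growth_pos[OF that(1), of K] growth_pos[OF that(2), of K]
      growth_pos[OF invertible_mult[OF that], of K]
    by (metis ln_mono ln_mult_pos mult_pos_pos)
  have shift: "\<bar>?g (Suc n) \<omega> - ?g n (shift \<omega>)\<bar> \<le> C" if \<omega>: "\<omega> \<in> space \<Omega>" for n \<omega>
  proof -
    let ?A = "lin_step H \<omega>" and ?B = "step_inv (snd (\<omega> 0)) (fst (\<omega> 0))" and ?P = "cocycle H n (shift \<omega>)"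
    have eq: "cocycle H (Suc n) \<omega> = ?P ** ?A"
      using cocycle_add[of H 1 n \<omega>] by simp
    have P: "invertible ?P" using invertible_cocycle[OF shift_space[OF \<omega>, of 1]] by simp
    have inv: "invertible ?A" "invertible ?B" using step_inverse[OF \<omega>] invertibleI by blast+
    have "?P = (?P ** ?A) ** ?B"
      by (simp add: matrix_mul_assoc[symmetric] step_inverse[OF \<omega>])
    then have "ln (growth K ?P) \<le> ln (growth K (?P ** ?A)) + ln (growth K ?B)"
      using ln_mult_le[OF invertible_mult[OF P inv(1)] inv(2)] by simp
    moreover have "ln (growth K (?P ** ?A)) \<le> ln (growth K ?P) + ln (growth K ?A)"
      by (rule ln_mult_le[OF P inv(1)])
    ultimately show ?thesis using single[OF \<omega>] unfolding eq by linarith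
  qed
  have bound: "\<bar>?g n \<omega>\<bar> \<le> C * real n" if "\<omega> \<in> space \<Omega>" for n \<omega>
    using that
  proof (induction n arbitrary: \<omega>)
    case (Suc n)
    have "shift \<omega> \<in> space \<Omega>" using shift_space[OF Suc.prems, of 1] by simp
    from Suc.IH[OF this] shift[OF Suc.prems, of n] show ?case by (simp add: algebra_simps)
  qed (simp add: growth_mat_1)
  interpret prob_space \<Omega> by (rule prob_space_sample_space[OF amax])
  have "bounded_subadditive \<Omega> shift ?g C"
  proof
    show "distr \<Omega> \<Omega> shift = sample_space amin amax"
      by (rule distr_shift[OF amax])
    show "?g n \<in> borel_measurable \<Omega>" for n
      by (intro borel_measurable_ln borel_measurable_growth cocycle_measurable invertible_cocycle)
    show "?g (m + n) \<omega> \<le> ?g m \<omega> + ?g n ((shift ^^ m) \<omega>)" if "\<omega> \<in> space \<Omega>" for m n \<omega>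
      unfolding cocycle_add
      using ln_mult_le[OF invertible_cocycle[OF shift_space[OF that, of m], of n] invertible_cocycle[OF that, of m]] by simp
  qed (use shift bound in auto)
  then show ?thesis by blast
qed

lemma AE_growth_convergent:
  "AE \<omega> in \<Omega>. \<forall>K. convergent (\<lambda>n. ln (growth K (cocycle H n \<omega>)) / real n)"
proof -
  have "AE \<omega> in \<Omega>. convergent (\<lambda>n. ln (growth K (cocycle H n \<omega>)) / real n)" for K
  proof -
    obtain C where "bounded_subadditive \<Omega> shift (\<lambda>n \<omega>. ln (growth K (cocycle H n \<omega>))) C"
      using growth_subadditive by blast
    from bounded_subadditive.AE_convergent[OF this] show ?thesis .
  qed
  then show ?thesis by (rule eventually_all_finite)
qed

lemma root_square_eq_exp:
  assumes "0 < s" "0 < t"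
  shows "root (2 * t) (s\<^sup>2) = exp (ln s / real t)"
proof (rule real_root_pos_unique)
  show "exp (ln s / real t) ^ (2 * t) = s\<^sup>2"
  proof -
    have "exp (ln s / real t) ^ (2 * t) = (exp (ln s / real t) ^ t)\<^sup>2"
      by (simp add: power_mult[symmetric] mult.commute)
    also have "exp (ln s / real t) ^ t = s"
      using assms by (simp add: exp_of_nat_mult[symmetric])
    finally show ?thesis .
  qed
qed (use assms in auto)

text \<open>With \<open>K\<close> the set of the \<open>j\<close> top-ranked indices, the growth is
  the product of the \<open>j\<close> largest singular values up to constants, so the averaged
  logarithms of these products converge. Differences for consecutive \<open>j\<close> isolate a
  single singular value.\<close>

lemma singular_exponents_converge:
  fixes s :: "nat \<Rightarrow> 'n \<Rightarrow> real"
  assumes e: "bij_betw e {..<CARD('n)} UNIV"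
    and conv: "\<And>K. convergent (\<lambda>n. ln (growth K (A n)) / real n)"
    and inv: "\<And>n. invertible (A n :: real ^ 'n ^ 'n)"
    and b: "\<And>t. onb (b t)" "\<And>t i. (transpose (A t) ** A t) *v b t i = (s t i)\<^sup>2 *\<^sub>R b t i" and s: "\<And>t i. 0 < s t i"
    and decr: "\<And>t j k. j \<le> k \<Longrightarrow> k < CARD('n) \<Longrightarrow> s t (e k) \<le> s t (e j)"
  shows "convergent (\<lambda>t. ln (s t i) / real t)"
proof -
  have top: "convergent (\<lambda>t. (\<Sum>i\<in>e ` {..<j}. ln (s t i)) / real t)" if j: "j \<le> CARD('n)" for j
  proof -
    let ?K = "e ` {..<j}"
    define D where "D = ln (fact CARD('n) :: real) + ln (real CARD('n \<Rightarrow> 'n))"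
    have top: "s t k \<le> s t i" if ik: "i \<in> ?K" "k \<notin> ?K" for t i k
    proof -
      obtain k' where k': "k' < CARD('n)" "k = e k'" using bij_betw_imp_surj_on[OF e] by (metis UNIV_I imageE lessThan_iff)
      obtain i' where i': "i' < j" "i = e i'" using ik by auto
      have "j \<le> k'" using ik(2) k' by (auto simp: not_le[symmetric])
      then show ?thesis using decr[of i' k' t] i' k' by simp
    qed
    have close: "\<bar>(\<Sum>i\<in>?K. ln (s t i)) - ln (growth ?K (A t))\<bar> \<le> D" for t
    proof -
      have sum: "(\<Sum>i\<in>?K. ln (s t i)) = ln (prod (s t) ?K)"
        by (rule ln_prod[symmetric]) (use less_imp_neq[OF s, symmetric] in auto)
      have pos: "0 < prod (s t) ?K" "0 < growth ?K (A t)"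
        using s by (auto intro!: prod_pos growth_pos inv)
      have "ln (prod (s t) ?K) \<le> ln (fact CARD('n) * growth ?K (A t))"
        using growth_lower[OF inv b s, of t ?K] pos by (intro ln_mono) auto
      then have 1: "ln (prod (s t) ?K) \<le> ln (fact CARD('n)) + ln (growth ?K (A t))"
        using pos(2) by (simp add: ln_mult_pos)
      have "ln (growth ?K (A t)) \<le> ln (real CARD('n \<Rightarrow> 'n) * prod (s t) ?K)"
        using growth_upper[OF inv b s top, of ?K t] pos by (intro ln_mono) auto
      then have 2: "ln (growth ?K (A t)) \<le> ln (real CARD('n \<Rightarrow> 'n)) + ln (prod (s t) ?K)"
        using pos(1) by (subst (asm) ln_mult_pos) auto
      have "0 \<le> ln (fact CARD('n) :: real)" "0 \<le> ln (real CARD('n \<Rightarrow> 'n))"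
        by (simp_all add: Suc_leI)
      then show ?thesis using 1 2 unfolding sum D_def by linarith
    qed
    have "(\<lambda>t. (\<Sum>i\<in>?K. ln (s t i)) / real t - ln (growth ?K (A t)) / real t) \<longlonglongrightarrow> 0"
    proof (rule Lim_null_comparison)
      show "(\<lambda>t. D / real t) \<longlonglongrightarrow> 0" by real_asymp
      show "\<forall>\<^sub>F t in sequentially. norm ((\<Sum>i\<in>?K. ln (s t i)) / real t - ln (growth ?K (A t)) / real t) \<le> D / real t"
        using close by (intro always_eventually allI) (simp add: diff_divide_distrib[symmetric] divide_right_mono)
    qed
    from convergent_add[OF convergentI[OF this] conv[of ?K]] show ?thesis by simp
  qed
  obtain j where j: "j < CARD('n)" "i = e j" using bij_betw_imp_surj_on[OF e] by (metis UNIV_I imageE lessThan_iff)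
  have "e j \<notin> e ` {..<j}" using inj_on_image_mem_iff[of e "{..<CARD('n)}" j "{..<j}"] bij_betw_imp_inj_on[OF e] j(1) by auto
  then have "(\<Sum>i\<in>e ` {..<Suc j}. ln (s t i)) = ln (s t i) + (\<Sum>i\<in>e ` {..<j}. ln (s t i))" for t
    by (simp add: lessThan_Suc j)
  then have "(\<Sum>i\<in>e ` {..<Suc j}. ln (s t i)) / real t - (\<Sum>i\<in>e ` {..<j}. ln (s t i)) / real t = ln (s t i) / real t" for t
    by (simp add: diff_divide_distrib[symmetric])
  then show ?thesis
    using convergent_diff[OF top[of "Suc j"] top[of j]] j by simp
qed

theorem multiplicative_ergodic:
  "AE \<omega> in \<Omega>.
    convergent (\<lambda>t. cocycle_root t \<omega>)"
  using AE_growth_convergent AE_space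
proof eventually_elim
  case (elim \<omega>)
  obtain e :: "nat \<Rightarrow> 'n" where e: "bij_betw e {..<CARD('n)} UNIV"
    using ex_bij_betw_nat_finite[of "UNIV :: 'n set"] by (auto simp: atLeast0LessThan)
  let ?A = "\<lambda>t. cocycle H t \<omega>"
  have inv: "invertible (?A t)" for t by (rule invertible_cocycle[OF elim(2)])
  have "\<forall>t. \<exists>b s. onb b \<and> (\<forall>i. (transpose (?A t) ** ?A t) *v b i = (s i)\<^sup>2 *\<^sub>R b i) \<and> (\<forall>i. 0 < s i)
      \<and> (\<forall>j k. j \<le> k \<longrightarrow> k < CARD('n) \<longrightarrow> s (e k) \<le> s (e j))"
    by (intro allI singular_values[OF e inv])
  from choice[OF this] obtain b where
    "\<forall>t. \<exists>s. onb (b t) \<and> (\<forall>i. (transpose (?A t) ** ?A t) *v b t i = (s i)\<^sup>2 *\<^sub>R b t i) \<and> (\<forall>i. 0 < s i)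
      \<and> (\<forall>j k. j \<le> k \<longrightarrow> k < CARD('n) \<longrightarrow> s (e k) \<le> s (e j))" ..
  from choice[OF this] obtain s where
    bs: "\<forall>t. onb (b t) \<and> (\<forall>i. (transpose (?A t) ** ?A t) *v b t i = (s t i)\<^sup>2 *\<^sub>R b t i) \<and> (\<forall>i. 0 < s t i)
      \<and> (\<forall>j k. j \<le> k \<longrightarrow> k < CARD('n) \<longrightarrow> s t (e k) \<le> s t (e j))" ..
  then have b: "\<And>t. onb (b t)" "\<And>t i. (transpose (?A t) ** ?A t) *v b t i = (s t i)\<^sup>2 *\<^sub>R b t i"
    and s: "\<And>t i. 0 < s t i" "\<And>t j k. j \<le> k \<Longrightarrow> k < CARD('n) \<Longrightarrow> s t (e k) \<le> s t (e j)"
    by blast+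
  have "convergent (\<lambda>t. ln (s t i) / real t)" for i
    by (rule singular_exponents_converge[OF e _ inv b s]) (use elim(1) in auto)
  then have "\<forall>i. \<exists>l. (\<lambda>t. ln (s t i) / real t) \<longlonglongrightarrow> l" by (simp add: convergent_def)
  from choice[OF this] obtain \<kappa> where lim: "\<And>i. (\<lambda>t. ln (s t i) / real t) \<longlonglongrightarrow> \<kappa> i" by blast
  obtain c where c: "1 \<le> c"
    "\<And>\<omega> x. \<omega> \<in> space \<Omega> \<Longrightarrow> norm (lin_step H \<omega> *v x) \<le> c * norm x"
    "\<And>\<omega> x. \<omega> \<in> space \<Omega> \<Longrightarrow> norm (step_inv (snd (\<omega> 0)) (fst (\<omega> 0)) *v x) \<le> c * norm x"
    using uniform_bounds by blast
  have step1: "norm (?A (Suc t) *v x) \<le> c * norm (?A t *v x)" for t x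
    using c(2)[OF shift_space[OF elim(2), of t], of "?A t *v x"] by (simp add: matrix_vector_mul_assoc)
  have step2: "norm (?A t *v x) \<le> c * norm (?A (Suc t) *v x)" for t x
  proof -
    let ?\<omega> = "(shift ^^ t) \<omega>"
    have eq: "step_inv (snd (?\<omega> 0)) (fst (?\<omega> 0)) *v (lin_step H ?\<omega> *v y) = y" for y
      by (simp only: matrix_vector_mul_assoc step_inverse(2)[OF shift_space[OF elim(2)]] matrix_vector_mul_lid)
    have "norm (?A t *v x) \<le> c * norm (lin_step H ?\<omega> *v (?A t *v x))"
      using c(3)[OF shift_space[OF elim(2), of t], of "lin_step H ?\<omega> *v (?A t *v x)"] unfolding eq .
    then show ?thesis by (simp add: matrix_vector_mul_assoc)
  qed
  have conv: "convergent (\<lambda>t. spec_matrix (b t) (\<lambda>i. exp (ln (s t i) / real t)))"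
    by (rule singular_value_root_convergent[OF b s(1) step1 step2 lim])
  have ev: "\<forall>\<^sub>F t in sequentially. spec_matrix (b t) (\<lambda>i. exp (ln (s t i) / real t))
      = mat_root (2 * t) (transpose (?A t) ** ?A t)"
    using eventually_ge_at_top[of 1]
  proof eventually_elim
    case (elim t)
    have "mat_root (2 * t) (transpose (?A t) ** ?A t) = spec_matrix (b t) (\<lambda>i. root (2 * t) ((s t i)\<^sup>2))"
      by (rule mat_root_spec[OF b]) (use elim in auto)
    also have "(\<lambda>i. root (2 * t) ((s t i)\<^sup>2)) = (\<lambda>i. exp (ln (s t i) / real t))"
      using root_square_eq_exp[OF s(1)] elim by auto
    finally show ?case by simp
  qed
  show ?case
    using conv unfolding convergent_cong[OF ev] .
qed

text \<open>In the singular basis at time \<open>t\<close>, each term of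
  \<open>w \<bullet> u\<close> is small for one of two reasons. A direction of rate at least
  \<open>\<nu>\<close> has a small component of \<open>u\<close>, whose orbit is bounded. A
  direction of rate below \<open>\<nu>\<close> has a small component of \<open>w\<close>, since the
  root matrix nearly multiplies \<open>w\<close> by \<open>\<mu>\<close>.\<close>

lemma slow_vector_orthogonal:
  assumes \<omega>: "\<omega> \<in> space \<Omega>"
    and conv: "convergent (\<lambda>t. cocycle_root t \<omega>)"
    and bounded: "\<And>t. norm (cocycle H t \<omega> *v u) \<le> B"
    and w: "Lambda H \<omega> *v w = \<mu> *\<^sub>R w" "1 < \<mu>"
  shows "w \<bullet> u = 0"
proof -
  let ?A = "\<lambda>t. cocycle H t \<omega>"
  let ?R = "\<lambda>t. mat_root (2 * t) (transpose (?A t) ** ?A t)"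
  have R: "?R \<longlonglongrightarrow> Lambda H \<omega>"
    using conv unfolding Lambda_def by (simp add: convergent_LIMSEQ_iff)
  \<comment> \<open>A threshold strictly between 1 and \<open>\<mu>\<close>: powers of
    \<open>\<nu>\<close> grow, and \<open>\<mu> - \<nu>\<close> stays away from 0.\<close>
  define \<nu> where "\<nu> = (1 + \<mu>) / 2"
  have \<nu>: "1 < \<nu>" "\<nu> < \<mu>" using w(2) by (auto simp: \<nu>_def)
  have B: "0 \<le> B" using bounded[of 0] norm_ge_zero order_trans by blast
  let ?d = "\<lambda>t. norm (Lambda H \<omega> *v w - ?R t *v w)"
  let ?h = "\<lambda>t. norm w * (B / \<nu> ^ t) + ?d t / (\<mu> - \<nu>) * norm u"
  have le: "\<bar>w \<bullet> u\<bar> \<le> real CARD('n) * ?h t" if t: "t \<ge> 1" for t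
  proof -
    obtain e :: "nat \<Rightarrow> 'n" where e: "bij_betw e {..<CARD('n)} UNIV"
      using ex_bij_betw_nat_finite[of "UNIV :: 'n set"] by (auto simp: atLeast0LessThan)
    obtain b s where b: "onb b" "\<And>i. (transpose (?A t) ** ?A t) *v b i = (s i)\<^sup>2 *\<^sub>R b i" and s: "\<And>i. 0 < s i"
      using singular_values[OF e invertible_cocycle[OF \<omega>]] by blast
    define r where "r i = root (2 * t) ((s i)\<^sup>2)" for i
    have Rt: "?R t = spec_matrix b r"
      unfolding r_def by (rule mat_root_spec[OF b]) (use t in auto)
    have r_pow: "r i ^ t = s i" for i
      using t s[of i] by (simp add: r_def root_square_eq_exp exp_of_nat_mult[symmetric])
    have bound: "\<bar>(b i \<bullet> w) * (b i \<bullet> u)\<bar> \<le> ?h t" for i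
    proof (cases "\<nu> \<le> r i")
      case True
      have "\<bar>b i \<bullet> u\<bar> * s i \<le> B"
        using norm_singular_vector(3)[OF b s, of i u] bounded[of t] by linarith
      moreover have "\<nu> ^ t \<le> s i" unfolding r_pow[symmetric] using True \<nu> by (intro power_mono) auto
      ultimately have "\<bar>b i \<bullet> u\<bar> * \<nu> ^ t \<le> B"
        using mult_left_mono[of "\<nu> ^ t" "s i" "\<bar>b i \<bullet> u\<bar>"] by linarith
      then have "\<bar>b i \<bullet> u\<bar> \<le> B / \<nu> ^ t" using \<nu> by (simp add: pos_le_divide_eq)
      moreover have "\<bar>b i \<bullet> w\<bar> \<le> norm w"
        using Cauchy_Schwarz_ineq2[of "b i" w] onb_norm[OF b(1), of i] by simp
      ultimately have "\<bar>b i \<bullet> w\<bar> * \<bar>b i \<bullet> u\<bar> \<le> norm w * (B / \<nu> ^ t)" by (intro mult_mono) auto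
      moreover have "0 \<le> ?d t / (\<mu> - \<nu>) * norm u" using \<nu> by simp
      ultimately show ?thesis unfolding abs_mult by linarith
    next
      case False
      have "b i \<bullet> (?R t *v w) = r i * (b i \<bullet> w)"
        unfolding Rt using symmetric_inner[OF transpose_spec_matrix, of "b i" b r w]
        by (simp add: spec_matrix_eigen[OF b(1)])
      then have "b i \<bullet> (Lambda H \<omega> *v w - ?R t *v w) = (\<mu> - r i) * (b i \<bullet> w)"
        by (simp add: w(1) inner_diff_right algebra_simps)
      moreover have "\<bar>b i \<bullet> (Lambda H \<omega> *v w - ?R t *v w)\<bar> \<le> ?d t"
        using Cauchy_Schwarz_ineq2[of "b i" "Lambda H \<omega> *v w - ?R t *v w"] onb_norm[OF b(1), of i] by simp
      ultimately have "(\<mu> - r i) * \<bar>b i \<bullet> w\<bar> \<le> ?d t"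
        using False \<nu> by (simp add: abs_mult)
      moreover have "(\<mu> - \<nu>) * \<bar>b i \<bullet> w\<bar> \<le> (\<mu> - r i) * \<bar>b i \<bullet> w\<bar>"
        using False by (intro mult_right_mono) auto
      ultimately have "\<bar>b i \<bullet> w\<bar> \<le> ?d t / (\<mu> - \<nu>)"
        using \<nu> by (simp add: pos_le_divide_eq mult.commute)
      moreover have "\<bar>b i \<bullet> u\<bar> \<le> norm u"
        using Cauchy_Schwarz_ineq2[of "b i" u] onb_norm[OF b(1), of i] by simp
      ultimately have "\<bar>b i \<bullet> w\<bar> * \<bar>b i \<bullet> u\<bar> \<le> ?d t / (\<mu> - \<nu>) * norm u"
        using \<nu> by (intro mult_mono) auto
      moreover have "0 \<le> norm w * (B / \<nu> ^ t)" using B \<nu> by simp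
      ultimately show ?thesis unfolding abs_mult by linarith
    qed
    have "w \<bullet> u = (\<Sum>i\<in>UNIV. (b i \<bullet> w) *\<^sub>R b i) \<bullet> u"
      by (simp add: onb_expand[OF b(1)])
    also have "\<dots> = (\<Sum>i\<in>UNIV. (b i \<bullet> w) * (b i \<bullet> u))" by (simp add: inner_sum_left)
    finally have "\<bar>w \<bullet> u\<bar> \<le> (\<Sum>i\<in>(UNIV :: 'n set). ?h t)"
      using bound by (simp only:) (rule order_trans[OF sum_abs sum_mono], auto)
    then show ?thesis by simp
  qed
  have d: "?d \<longlonglongrightarrow> norm (Lambda H \<omega> *v w - Lambda H \<omega> *v w)"
  proof (intro tendsto_norm tendsto_diff tendsto_const)
    have "bounded_linear (\<lambda>A :: real ^ 'n ^ 'n. A *v w)"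
      by (rule linear_conv_bounded_linear[THEN iffD1], rule linearI)
        (simp_all add: matrix_vector_mult_add_rdistrib scaleR_matrix_vector_assoc)
    from bounded_linear.tendsto[OF this R] show "(\<lambda>t. ?R t *v w) \<longlonglongrightarrow> Lambda H \<omega> *v w" .
  qed
  have "(\<lambda>t. B / \<nu> ^ t) \<longlonglongrightarrow> 0"
    using \<nu> by (intro tendsto_divide_0[OF tendsto_const] filterlim_at_top_imp_at_infinity filterlim_realpow_sequentially_gt1) auto
  then have "(\<lambda>t. real CARD('n) * ?h t) \<longlonglongrightarrow> real CARD('n) * (norm w * 0 + norm (Lambda H \<omega> *v w - Lambda H \<omega> *v w) / (\<mu> - \<nu>) * norm u)"
    using \<nu> by (intro tendsto_intros d) auto
  then have "(\<lambda>t. real CARD('n) * ?h t) \<longlonglongrightarrow> 0" by simp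
  then have "\<bar>w \<bullet> u\<bar> \<le> 0"
    by (rule LIMSEQ_le_const) (use le in blast)
  then show ?thesis by simp
qed

lemma P_plus_slow_vector:
  assumes \<omega>: "\<omega> \<in> space \<Omega>"
    and conv: "convergent (\<lambda>t. cocycle_root t \<omega>)"
    and bounded: "\<And>t. norm (cocycle H t \<omega> *v u) \<le> B"
  shows "P_plus H \<omega> u = 0"
proof -
  have gen: "w \<bullet> u = 0" if "w \<in> W_plus H \<omega>" for w
    using that unfolding W_plus_def
  proof (induction rule: span_induct)
    case base
    show ?case by (rule subspaceI) (auto simp: inner_add_left)
  next
    case (step w)
    then obtain l where "0 < l" "Lambda H \<omega> *v w = exp l *\<^sub>R w" by (auto simp: eigenspace_def)
    then show ?case by (intro slow_vector_orthogonal[OF \<omega> conv bounded, of w "exp l"]) auto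
  qed
  show ?thesis
    unfolding P_plus_def orth_proj_def
  proof (rule the_equality)
    show "0 \<in> W_plus H \<omega> \<and> u - 0 \<in> (W_plus H \<omega>)\<^sup>\<bottom>"
      using gen by (simp add: W_plus_def span_0 orthogonal_comp_def orthogonal_def)
    fix w assume w: "w \<in> W_plus H \<omega> \<and> u - w \<in> (W_plus H \<omega>)\<^sup>\<bottom>"
    then have "w \<bullet> (u - w) = 0" by (auto simp: orthogonal_comp_def orthogonal_def)
    then have "w \<bullet> w = 0" using gen[of w] w by (simp add: inner_diff_right)
    then show "w = 0" by simp
  qed
qed

end

theorem no_trapped_directions:
  fixes H :: "real ^ 'n ^ 'n"
  assumes "transpose H = H" and "\<And>v. H *v v = 0 \<Longrightarrow> v = 0"
    and a: "0 < amin" "amin < amax" "\<And>i. amax * H $ i $ i < 1" and b: "0 < b" "b \<le> amax"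
    and proj: "\<And>i. AE \<omega> in sample_space amin amax. P_plus H \<omega> (axis i 1) \<noteq> 0"
    and v: "v \<noteq> 0"
  shows "\<exists>w. energy H (fold (coord_step H b) w v) < 0"
proof (rule ccontr)
  interpret nondegenerate_form H b
  proof
    show "b * H $ i $ i < 1" for i
      using mult_right_mono[OF b(2), of "H $ i $ i"] mult_pos_neg[OF b(1), of "H $ i $ i"] a(3)[of i]
      by (cases "0 \<le> H $ i $ i") auto
  qed (use assms in auto)
  interpret coordinate_cocycle H amin amax by standard (use a in auto)
  interpret prob_space "sample_space amin amax :: 'n sample measure" by (rule prob_space_sample_space[OF a(2)])
  assume "\<not> ?thesis"
  then have "v \<in> trapped" by (auto simp: trapped_def not_less)
  then obtain i where i: "axis i 1 \<in> trapped" using ex_trapped_axis v by blast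
  obtain B where B: "\<And>w. \<forall>(b, i)\<in>set w. 0 < b \<and> b \<le> amax \<Longrightarrow>
      norm (fold (\<lambda>(b, i). coord_step H b i) w (axis i 1)) \<le> B"
    using trapped_bounded_orbits[OF i a(3)] by blast
  have "AE \<omega> in sample_space amin amax :: 'n sample measure. False"
    using multiplicative_ergodic proj[of i] AE_space
  proof eventually_elim
    case (elim \<omega>)
    have "norm (cocycle H t \<omega> *v axis i 1) \<le> B" for t
      unfolding cocycle_fold by (rule B) (use sample_space_range[OF elim(3)] less_le_trans[OF a(1)] in auto)
    from P_plus_slow_vector[OF elim(3,1) this] elim(2) show ?case by simp
  qed
  then show False by simp
qed

section \<open>Descent and local escape\<close>

lemma linear_functional_inner:
  fixes D :: "real ^ 'n \<Rightarrow> real"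
  assumes "linear D"
  shows "D = (\<lambda>h. h \<bullet> (\<chi> i. D (axis i 1)))"
proof
  fix h
  have "D h = D (\<Sum>i\<in>UNIV. h $ i *\<^sub>R axis i 1)"
    using basis_expansion[of h] by (simp add: scalar_mult_eq_scaleR)
  also have "\<dots> = h \<bullet> (\<chi> i. D (axis i 1))"
    by (simp add: linear_sum[OF assms] linear_scale[OF assms] inner_vec_def)
  finally show "D h = h \<bullet> (\<chi> i. D (axis i 1))" .
qed

lemma inner_right_unique:
  fixes a b :: "'a::real_inner"
  assumes "(\<lambda>h. h \<bullet> a) = (\<lambda>h. h \<bullet> b)"
  shows "a = b"
  using fun_cong[OF assms, of "a - b"] by (metis inner_diff_right inner_eq_zero_iff right_minus_eq)

lemma has_derivative_grad:
  fixes f :: "real ^ 'n \<Rightarrow> real"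
  assumes "f differentiable at x"
  shows "(f has_derivative (\<lambda>h. grad f x \<bullet> h)) (at x)"
proof -
  obtain D where D: "(f has_derivative D) (at x)" using assms by (auto simp: differentiable_def)
  then have "linear D" using has_derivative_linear by blast
  then have G: "GDERIV f x :> (\<chi> i. D (axis i 1))"
    using D linear_functional_inner[of D] by (simp add: gderiv_def)
  have "\<exists>!D. GDERIV f x :> D"
  proof (rule ex1I[of _ "\<chi> i. D (axis i 1)"], rule G)
    fix D' assume "GDERIV f x :> D'"
    with G have "(\<lambda>h. h \<bullet> D') = (\<lambda>h. h \<bullet> (\<chi> i. D (axis i 1)))"
      unfolding gderiv_def by (rule has_derivative_unique[rotated])
    then show "D' = (\<chi> i. D (axis i 1))" by (rule inner_right_unique)
  qed
  then have "GDERIV f x :> grad f x"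
    unfolding grad_def by (rule theI')
  then show ?thesis by (simp add: gderiv_def inner_commute)
qed

lemma has_derivative_hessian:
  fixes f :: "real ^ 'n \<Rightarrow> real"
  assumes "grad f differentiable at x"
  shows "(grad f has_derivative ((*v) (hessian f x))) (at x)"
  using assms unfolding hessian_def jacobian_works by simp

lemma grad_linear_approx:
  fixes f :: "real ^ 'n \<Rightarrow> real"
  assumes "grad f differentiable at x" "0 < e"
  obtains d where "0 < d" "\<And>y. norm y < d \<Longrightarrow> norm (grad f (x + y) - grad f x - hessian f x *v y) \<le> e * norm y"
proof -
  obtain d where d: "0 < d" "\<And>y. norm (y - x) < d \<Longrightarrow>
      norm (grad f y - grad f x - hessian f x *v (y - x)) \<le> e * norm (y - x)"
    using has_derivative_hessian[OF assms(1)] assms(2) unfolding has_derivative_at_alt by blast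
  show ?thesis
    by (rule that[OF d(1)]) (use d(2)[of "x + _"] in simp)
qed

lemma line_mvt:
  fixes f :: "real ^ 'n \<Rightarrow> real"
  assumes "\<And>x. f differentiable at x"
  shows "\<exists>s. 0 < s \<and> s < 1 \<and> f (x + h) - f x = grad f (x + s *\<^sub>R h) \<bullet> h"
proof -
  have "((\<lambda>t. f (x + t *\<^sub>R h)) has_real_derivative grad f (x + t *\<^sub>R h) \<bullet> h) (at t)" for t
  proof -
    have "((\<lambda>t. x + t *\<^sub>R h) has_derivative (\<lambda>t. t *\<^sub>R h)) (at t)"
      by (auto intro!: derivative_eq_intros)
    from has_derivative_compose[OF this has_derivative_grad[OF assms]]
    show ?thesis by (simp add: has_field_derivative_def mult_commute_abs)
  qed
  from MVT2[of 0 1 "\<lambda>t. f (x + t *\<^sub>R h)", OF _ this]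
  show ?thesis by auto
qed

text \<open>The second difference is the increment over \<open>[0, 1]\<close> of
  \<open>\<phi>\<close>, which is \<open>f\<close> shifted by \<open>t *\<^sub>R w\<close> minus
  \<open>f\<close>, along \<open>u\<close>. The mean value theorem reduces it to two gradients near
  \<open>x\<close>, which the derivative of \<open>grad f\<close> at \<open>x\<close>
  approximates.\<close>

lemma second_difference_bound:
  fixes f :: "real ^ 'n \<Rightarrow> real"
  assumes f: "\<And>x. f differentiable at x" and g: "grad f differentiable at x" and e: "0 < e"
  obtains d where "0 < d" "\<And>t. 0 < t \<Longrightarrow> t < d \<Longrightarrow>
    \<bar>(f (x + t *\<^sub>R u + t *\<^sub>R w) - f (x + t *\<^sub>R u) - f (x + t *\<^sub>R w) + f x) - t\<^sup>2 * (u \<bullet> (hessian f x *v w))\<bar>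
      \<le> t\<^sup>2 * (e * (norm u * (2 * norm u + norm w)))"
proof -
  let ?H = "hessian f x"
  obtain d where d: "0 < d" "\<And>y. norm y < d \<Longrightarrow> norm (grad f (x + y) - grad f x - ?H *v y) \<le> e * norm y"
    using grad_linear_approx[OF g e] by blast
  define K where "K = norm u + norm w + 1"
  have K: "0 < K" by (simp add: K_def add_nonneg_pos)
  show ?thesis
  proof (rule that[of "d / K"])
    show "0 < d / K" using d K by simp
    fix t :: real assume t: "0 < t" "t < d / K"
    then have tK: "t * K < d" using K by (simp add: pos_less_divide_eq)
    define \<phi> where "\<phi> s = f (x + s *\<^sub>R (t *\<^sub>R u) + t *\<^sub>R w) - f (x + s *\<^sub>R (t *\<^sub>R u))" for s
    have der: "(\<phi> has_real_derivative
        (grad f (x + s *\<^sub>R (t *\<^sub>R u) + t *\<^sub>R w) - grad f (x + s *\<^sub>R (t *\<^sub>R u))) \<bullet> (t *\<^sub>R u)) (at s)" for s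
    proof -
      have "((\<lambda>s. x + s *\<^sub>R (t *\<^sub>R u) + t *\<^sub>R w) has_derivative (\<lambda>s. s *\<^sub>R (t *\<^sub>R u))) (at s)"
        "((\<lambda>s. x + s *\<^sub>R (t *\<^sub>R u)) has_derivative (\<lambda>s. s *\<^sub>R (t *\<^sub>R u))) (at s)"
        by (auto intro!: derivative_eq_intros)
      from has_derivative_diff[OF has_derivative_compose[OF this(1) has_derivative_grad[OF f]]
          has_derivative_compose[OF this(2) has_derivative_grad[OF f]]]
      show ?thesis
        unfolding has_field_derivative_def \<phi>_def[abs_def]
        by (rule has_derivative_eq_rhs) (auto simp: fun_eq_iff inner_diff_left algebra_simps)
    qed
    obtain s where s: "0 < s" "s < 1" "\<phi> 1 - \<phi> 0 =
        (grad f (x + s *\<^sub>R (t *\<^sub>R u) + t *\<^sub>R w) - grad f (x + s *\<^sub>R (t *\<^sub>R u))) \<bullet> (t *\<^sub>R u)"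
      using MVT2[of 0 1 \<phi>, OF _ der] by auto
    define y1 where "y1 = s *\<^sub>R (t *\<^sub>R u) + t *\<^sub>R w"
    define y2 where "y2 = s *\<^sub>R (t *\<^sub>R u)"
    have n2: "norm y2 \<le> t * norm u"
      using s t by (simp add: y2_def mult_left_le_one_le)
    have n1: "norm y1 \<le> t * norm u + t * norm w"
      using norm_triangle_ineq[of y2 "t *\<^sub>R w"] n2 t by (simp add: y1_def y2_def)
    have tK': "t * norm u + t * norm w < d"
      using tK t by (simp add: K_def algebra_simps)
    moreover have "0 \<le> t * norm w" using t by simp
    ultimately have "norm y1 < d" "norm y2 < d" using n1 n2 by linarith+
    note r = d(2)[OF this(1)] d(2)[OF this(2)]
    define r1 where "r1 = grad f (x + y1) - grad f x - ?H *v y1"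
    define r2 where "r2 = grad f (x + y2) - grad f x - ?H *v y2"
    have gd: "grad f (x + y1) - grad f (x + y2) = t *\<^sub>R (?H *v w) + (r1 - r2)"
    proof -
      have "?H *v y1 - ?H *v y2 = t *\<^sub>R (?H *v w)"
        by (simp add: y1_def y2_def matrix_vector_right_distrib matrix_vector_mult_scaleR)
      then show ?thesis by (simp add: r1_def r2_def algebra_simps)
    qed
    have "\<phi> 1 - \<phi> 0 = (grad f (x + y1) - grad f (x + y2)) \<bullet> (t *\<^sub>R u)"
      using s(3) by (simp add: y1_def y2_def add.assoc)
    then have eq: "\<phi> 1 - \<phi> 0 = t\<^sup>2 * (u \<bullet> (?H *v w)) + t * ((r1 - r2) \<bullet> u)"
      unfolding gd by (simp add: inner_add_left inner_add_right inner_commute[of _ u] power2_eq_square distrib_left)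
    have "\<bar>(r1 - r2) \<bullet> u\<bar> \<le> e * (t * (2 * norm u + norm w)) * norm u"
    proof -
      have "norm (r1 - r2) \<le> norm r1 + norm r2" by (rule norm_triangle_ineq4)
      also have "\<dots> \<le> e * norm y1 + e * norm y2" using r by (simp add: r1_def r2_def add_mono)
      also have "\<dots> \<le> e * (t * norm u + t * norm w) + e * (t * norm u)"
        using n1 n2 e by (intro add_mono mult_left_mono) auto
      finally have "norm (r1 - r2) \<le> e * (t * (2 * norm u + norm w))" by (simp add: algebra_simps)
      then show ?thesis
        using Cauchy_Schwarz_ineq2[of "r1 - r2" u] mult_right_mono[of "norm (r1 - r2)" _ "norm u"] by fastforce
    qed
    then have "t * \<bar>(r1 - r2) \<bullet> u\<bar> \<le> t * (e * (t * (2 * norm u + norm w)) * norm u)"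
      using t by (intro mult_left_mono) auto
    also have "\<dots> = t\<^sup>2 * (e * (norm u * (2 * norm u + norm w)))"
      by (simp add: power2_eq_square)
    finally have "\<bar>(\<phi> 1 - \<phi> 0) - t\<^sup>2 * (u \<bullet> (?H *v w))\<bar> \<le> t\<^sup>2 * (e * (norm u * (2 * norm u + norm w)))"
      unfolding eq using t by (simp add: abs_mult)
    then show "\<bar>(f (x + t *\<^sub>R u + t *\<^sub>R w) - f (x + t *\<^sub>R u) - f (x + t *\<^sub>R w) + f x) - t\<^sup>2 * (u \<bullet> (?H *v w))\<bar>
      \<le> t\<^sup>2 * (e * (norm u * (2 * norm u + norm w)))"
      by (simp add: \<phi>_def algebra_simps)
  qed
qed

text \<open>The second difference is symmetric in \<open>u\<close> and \<open>w\<close>, and in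
  either order it approximates its own bilinear value up to an arbitrarily small multiple of
  \<open>t^2\<close>.\<close>

lemma hessian_inner_commute:
  fixes f :: "real ^ 'n \<Rightarrow> real"
  assumes f: "\<And>x. f differentiable at x" and g: "grad f differentiable at x"
  shows "u \<bullet> (hessian f x *v w) = w \<bullet> (hessian f x *v u)"
proof -
  let ?H = "hessian f x"
  define K where "K = norm u * (2 * norm u + norm w) + norm w * (2 * norm w + norm u)"
  have K: "0 \<le> K" by (simp add: K_def)
  have "\<bar>u \<bullet> (?H *v w) - w \<bullet> (?H *v u)\<bar> \<le> 0 + e'" if "0 < e'" for e'
  proof -
    define e where "e = e' / (K + 1)"
    have e: "0 < e" using that K by (simp add: e_def)
    obtain d1 where d1: "0 < d1" "\<And>t. 0 < t \<Longrightarrow> t < d1 \<Longrightarrow>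
      \<bar>(f (x + t *\<^sub>R u + t *\<^sub>R w) - f (x + t *\<^sub>R u) - f (x + t *\<^sub>R w) + f x) - t\<^sup>2 * (u \<bullet> (?H *v w))\<bar>
      \<le> t\<^sup>2 * (e * (norm u * (2 * norm u + norm w)))"
      using second_difference_bound[OF f g e] by blast
    obtain d2 where d2: "0 < d2" "\<And>t. 0 < t \<Longrightarrow> t < d2 \<Longrightarrow>
      \<bar>(f (x + t *\<^sub>R w + t *\<^sub>R u) - f (x + t *\<^sub>R w) - f (x + t *\<^sub>R u) + f x) - t\<^sup>2 * (w \<bullet> (?H *v u))\<bar>
      \<le> t\<^sup>2 * (e * (norm w * (2 * norm w + norm u)))"
      using second_difference_bound[OF f g e] by blast
    define t where "t = min d1 d2 / 2"
    have t: "0 < t" "t < d1" "t < d2" using d1(1) d2(1) by (auto simp: t_def)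
    define \<Delta> where "\<Delta> = f (x + t *\<^sub>R u + t *\<^sub>R w) - f (x + t *\<^sub>R u) - f (x + t *\<^sub>R w) + f x"
    have "\<bar>\<Delta> - t\<^sup>2 * (u \<bullet> (?H *v w))\<bar> \<le> t\<^sup>2 * (e * (norm u * (2 * norm u + norm w)))"
      "\<bar>\<Delta> - t\<^sup>2 * (w \<bullet> (?H *v u))\<bar> \<le> t\<^sup>2 * (e * (norm w * (2 * norm w + norm u)))"
      using d1(2)[OF t(1,2)] d2(2)[OF t(1,3)] by (simp_all add: \<Delta>_def algebra_simps)
    then have "\<bar>t\<^sup>2 * (u \<bullet> (?H *v w)) - t\<^sup>2 * (w \<bullet> (?H *v u))\<bar>
      \<le> t\<^sup>2 * (e * (norm u * (2 * norm u + norm w))) + t\<^sup>2 * (e * (norm w * (2 * norm w + norm u)))"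
      by linarith
    also have "\<dots> = t\<^sup>2 * (e * K)"
      unfolding K_def by (simp only: distrib_left)
    finally have "\<bar>t\<^sup>2 * (u \<bullet> (?H *v w)) - t\<^sup>2 * (w \<bullet> (?H *v u))\<bar> \<le> t\<^sup>2 * (e * K)" .
    then have "t\<^sup>2 * \<bar>u \<bullet> (?H *v w) - w \<bullet> (?H *v u)\<bar> \<le> t\<^sup>2 * (e * K)"
      by (simp add: right_diff_distrib[symmetric] abs_mult)
    then have "\<bar>u \<bullet> (?H *v w) - w \<bullet> (?H *v u)\<bar> \<le> e * K" using t(1) by simp
    also have "\<dots> \<le> e * (K + 1)" using e by simp
    also have "\<dots> = e'" using K by (simp add: e_def)
    finally show ?thesis by simp
  qed
  then have "\<bar>u \<bullet> (?H *v w) - w \<bullet> (?H *v u)\<bar> \<le> 0" by (rule field_le_epsilon)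
  then show ?thesis by simp
qed

lemma transpose_hessian:
  fixes f :: "real ^ 'n \<Rightarrow> real"
  assumes "\<And>x. f differentiable at x" and "grad f differentiable at x"
  shows "transpose (hessian f x) = hessian f x"
proof -
  have "axis i 1 \<bullet> (hessian f x *v axis j 1) = hessian f x $ i $ j" for i j
    by (simp add: inner_axis' matrix_vector_mult_basis column_def)
  then have "hessian f x $ i $ j = hessian f x $ j $ i" for i j
    using hessian_inner_commute[OF assms, of "axis i 1" "axis j 1"] by metis
  then show ?thesis by (simp add: vec_eq_iff transpose_def)
qed

locale smooth_objective =
  fixes f :: "real ^ 'n \<Rightarrow> real" and M amin amax :: real
  assumes C2: "C2 f" and M_pos: "0 < M" and hess_bound: "\<And>x. onorm ((*v) (hessian f x)) \<le> M"
    and amin: "0 < amin" and amax: "amin < amax" and amax_M: "amax * M < 1"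
begin

lemma f_diff: "f differentiable at x" and g_diff: "grad f differentiable at x"
  using C2 by (auto simp: C2_def)

lemma hessian_norm: "norm (hessian f x *v y) \<le> M * norm y"
  using onorm[OF matrix_vector_mul_bounded_linear, of "hessian f x" y] hess_bound[of x]
    mult_right_mono[of "onorm ((*v) (hessian f x))" M "norm y"] by fastforce

lemma hessian_diag: "amax * hessian f x $ i $ i < 1"
proof -
  have "hessian f x $ i $ i = (hessian f x *v axis i 1) $ i"
    by (simp add: matrix_vector_mult_basis column_def)
  also have "\<dots> \<le> M"
    using component_le_norm_cart[of "hessian f x *v axis i 1" i] hessian_norm[of x "axis i 1"] by simp
  finally have "amax * hessian f x $ i $ i \<le> amax * M"
    using amin amax by (intro mult_left_mono) auto
  then show ?thesis using amax_M by linarith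
qed

lemma grad_lipschitz: "norm (grad f x - grad f y) \<le> M * norm (x - y)"
  by (rule differentiable_bound[of UNIV "grad f" "\<lambda>x. (*v) (hessian f x)"])
    (use has_derivative_hessian[OF g_diff] hess_bound in auto)

lemma continuous_f: "continuous_on S f" and continuous_grad: "continuous_on S (grad f)"
  by (intro differentiable_imp_continuous_on;
      simp add: differentiable_on_def f_diff g_diff differentiable_at_withinI)+

definition gstep :: "real ^ 'n \<Rightarrow> 'n \<times> real \<Rightarrow> real ^ 'n" where
  "gstep x p = x - (snd p * grad f x $ fst p) *\<^sub>R axis (fst p) 1"

abbreviation "gsteps \<equiv> fold (\<lambda>p x. gstep x p)"

text \<open>A lower bound for \<open>b * (1 - b * M)\<close> over the admissible sizes
  \<open>b\<close>. The customary \<open>b * M / 2\<close> becomes \<open>b * M\<close> because the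
  mean value theorem is used in place of integrating the gradient along the step.\<close>

definition rate :: real where
  "rate = amin * (1 - amax * M)"

lemma rate_pos: "0 < rate"
  using amin amax_M by (simp add: rate_def)

lemma gstep_descent:
  assumes b: "snd p \<in> {amin..amax}"
  shows "f (gstep x p) \<le> f x - rate * (grad f x $ fst p)\<^sup>2"
proof -
  let ?b = "snd p" and ?g = "grad f x $ fst p"
  define h where "h = - (?b * ?g) *\<^sub>R axis (fst p) (1 :: real)"
  obtain s where s: "0 < s" "s < 1" "f (x + h) - f x = grad f (x + s *\<^sub>R h) \<bullet> h"
    using line_mvt[OF f_diff] by blast
  have gh: "grad f x \<bullet> h = - (?b * ?g\<^sup>2)"
    by (simp add: h_def inner_axis power2_eq_square)
  have nh: "(norm h)\<^sup>2 = ?b\<^sup>2 * ?g\<^sup>2" by (simp add: h_def power_mult_distrib)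
  have "grad f (x + s *\<^sub>R h) \<bullet> h = grad f x \<bullet> h + (grad f (x + s *\<^sub>R h) - grad f x) \<bullet> h"
    by (simp add: inner_diff_left)
  also have "(grad f (x + s *\<^sub>R h) - grad f x) \<bullet> h \<le> norm (grad f (x + s *\<^sub>R h) - grad f x) * norm h"
    by (rule norm_cauchy_schwarz)
  also have "\<dots> \<le> (M * norm h) * norm h"
  proof (rule mult_right_mono)
    have "norm (grad f (x + s *\<^sub>R h) - grad f x) \<le> M * norm (s *\<^sub>R h)"
      using grad_lipschitz[of "x + s *\<^sub>R h" x] by simp
    also have "\<dots> \<le> M * norm h" using s M_pos by (intro mult_left_mono) (auto simp: mult_left_le_one_le)
    finally show "norm (grad f (x + s *\<^sub>R h) - grad f x) \<le> M * norm h" .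
  qed simp
  finally have "f (x + h) \<le> f x - ?b * ?g\<^sup>2 + M * (?b\<^sup>2 * ?g\<^sup>2)"
    using s(3) gh nh by (simp add: power2_eq_square mult.assoc)
  also have "\<dots> = f x - (?b * (1 - ?b * M)) * ?g\<^sup>2"
    by (simp add: power2_eq_square algebra_simps)
  also have "\<dots> \<le> f x - rate * ?g\<^sup>2"
  proof -
    have "rate \<le> ?b * (1 - ?b * M)"
      unfolding rate_def using b amin amax_M M_pos by (intro mult_mono) (auto simp: mult_right_mono)
    then show ?thesis by (simp add: mult_right_mono)
  qed
  finally show ?thesis by (simp add: gstep_def h_def)
qed

lemma gstep_le: "snd p \<in> {amin..amax} \<Longrightarrow> f (gstep x p) \<le> f x"
  using gstep_descent[of p x] mult_nonneg_nonneg[OF less_imp_le[OF rate_pos] zero_le_power2, of "grad f x $ fst p"]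
  by linarith

text \<open>As \<open>amax * M < 1\<close>, a step is shorter than the distance to any critical
  point, so none can be hit in finite time from outside.\<close>

lemma gstep_eq_critical:
  assumes "grad f xs = 0" "snd p \<in> {amin..amax}" "gstep x p = xs"
  shows "x = xs"
proof (rule ccontr)
  assume ne: "x \<noteq> xs"
  have "x - xs = (snd p * grad f x $ fst p) *\<^sub>R axis (fst p) 1"
    using assms(3) by (auto simp: gstep_def algebra_simps)
  then have "norm (x - xs) = \<bar>snd p\<bar> * \<bar>grad f x $ fst p\<bar>" by (simp add: abs_mult)
  also have "\<dots> \<le> amax * norm (grad f x - grad f xs)"
    using assms component_le_norm_cart[of "grad f x" "fst p"] amin by (intro mult_mono) auto
  also have "\<dots> \<le> amax * (M * norm (x - xs))"
    using grad_lipschitz amin amax by (intro mult_left_mono) auto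
  also have "\<dots> < 1 * norm (x - xs)"
    unfolding mult.assoc[symmetric] using amax_M ne by (intro mult_strict_right_mono) auto
  finally show False by simp
qed

section \<open>Linearization near a critical point\<close>

lemma quadratic_upper_bound:
  assumes xs: "grad f xs = 0" and e: "0 < e"
  obtains d where "0 < d" "\<And>y. norm y < d \<Longrightarrow> f (xs + y) - f xs \<le> energy (hessian f xs) y / 2 + e * (norm y)\<^sup>2"
proof -
  let ?H = "hessian f xs"
  obtain d where d: "0 < d" "\<And>y. norm y < d \<Longrightarrow> norm (grad f (xs + y) - grad f xs - ?H *v y) \<le> e * norm y"
    using grad_linear_approx[OF g_diff e] by blast
  show ?thesis
  proof (rule that[OF d(1)])
    fix y :: "real ^ 'n" assume y: "norm y < d"
    \<comment> \<open>With the quadratic part removed, the derivative of \<open>\<phi>\<close> is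
      just the linearization error of the gradient, so a mean value theorem of first order
      suffices.\<close>
    define \<phi> where "\<phi> t = f (xs + t *\<^sub>R y) - t\<^sup>2 * (energy ?H y / 2)" for t
    have der: "(\<phi> has_real_derivative (grad f (xs + t *\<^sub>R y) \<bullet> y - t * energy ?H y)) (at t)" for t
    proof -
      have "((\<lambda>t. xs + t *\<^sub>R y) has_derivative (\<lambda>t. t *\<^sub>R y)) (at t)"
        by (auto intro!: derivative_eq_intros)
      from has_derivative_compose[OF this has_derivative_grad[OF f_diff]]
      have "((\<lambda>t. f (xs + t *\<^sub>R y)) has_real_derivative grad f (xs + t *\<^sub>R y) \<bullet> y) (at t)"
        by (simp add: has_field_derivative_def mult_commute_abs)
      then show ?thesis unfolding \<phi>_def[abs_def] by (auto intro!: derivative_eq_intros)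
    qed
    obtain s where s: "0 < s" "s < 1" "\<phi> 1 - \<phi> 0 = grad f (xs + s *\<^sub>R y) \<bullet> y - s * energy ?H y"
      using MVT2[of 0 1 \<phi>, OF _ der] by auto
    have sy: "norm (s *\<^sub>R y) \<le> norm y" using s by (simp add: mult_left_le_one_le)
    have "grad f (xs + s *\<^sub>R y) \<bullet> y - s * energy ?H y = (grad f (xs + s *\<^sub>R y) - grad f xs - ?H *v (s *\<^sub>R y)) \<bullet> y"
      by (simp add: xs energy_def inner_diff_left inner_diff_right matrix_vector_mult_scaleR inner_commute)
    also have "\<dots> \<le> norm (grad f (xs + s *\<^sub>R y) - grad f xs - ?H *v (s *\<^sub>R y)) * norm y"
      by (rule norm_cauchy_schwarz)
    also have "\<dots> \<le> (e * norm y) * norm y"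
    proof (rule mult_right_mono)
      have "norm (grad f (xs + s *\<^sub>R y) - grad f xs - ?H *v (s *\<^sub>R y)) \<le> e * norm (s *\<^sub>R y)"
        using sy y by (intro d(2)) simp
      also have "\<dots> \<le> e * norm y" using sy e by (intro mult_left_mono) auto
      finally show "norm (grad f (xs + s *\<^sub>R y) - grad f xs - ?H *v (s *\<^sub>R y)) \<le> e * norm y" .
    qed simp
    finally show "f (xs + y) - f xs \<le> energy ?H y / 2 + e * (norm y)\<^sup>2"
      using s(3) by (simp add: \<phi>_def power2_eq_square mult.assoc)
  qed
qed

text \<open>All errors are measured relative to the scale \<open>r\<close>, so a single tolerance
  \<open>d\<close> serves all small distances from the critical point.\<close>

lemma gstep_tracks_linear:
  assumes xs: "grad f xs = 0" and b0: "0 < b0" and e: "0 < e"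
  shows "\<exists>d>0. \<forall>r y b. 0 < r \<longrightarrow> r < d \<longrightarrow> norm (y - r *\<^sub>R v) \<le> d * r \<longrightarrow> \<bar>b - b0\<bar> \<le> d \<longrightarrow>
    norm (gstep (xs + y) (i, b) - xs - r *\<^sub>R coord_step (hessian f xs) b0 i v) \<le> e * r"
proof -
  let ?H = "hessian f xs"
  define V where "V = norm v + 1"
  have V: "1 \<le> V" by (simp add: V_def)
  define e' where "e' = e / (4 * b0 * V)"
  have e': "0 < e'" using e b0 V by (simp add: e'_def)
  obtain d2 where d2: "0 < d2" "\<And>y. norm y < d2 \<Longrightarrow> norm (grad f (xs + y) - grad f xs - ?H *v y) \<le> e' * norm y"
    using grad_linear_approx[OF g_diff e'] by blast
  \<comment> \<open>The bound 1 gives \<open>norm y \<le> r * V\<close>, and \<open>d2 / V\<close>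
    keeps \<open>y\<close> inside the linearization radius. The other three make the initial
    deviation, the wrong step size and the image of the deviation under \<open>H\<close> cost at
    most \<open>e / 4 * r\<close> each; the fourth quarter, the linearization error, is governed by
    \<open>e'\<close>.\<close>
  define d where "d = Min {1, e / 4, e / (4 * M * V), e / (4 * b0 * M), d2 / V}"
  have "0 < d" using e b0 M_pos V d2(1) by (auto simp: d_def)
  moreover have "d \<le> 1" "d \<le> e / 4" "d \<le> e / (4 * M * V)" "d \<le> e / (4 * b0 * M)" "d \<le> d2 / V"
    unfolding d_def by (rule Min_le; simp)+
  ultimately have d: "0 < d" "d \<le> 1" "d \<le> e / 4" "d \<le> e / (4 * M * V)" "d \<le> e / (4 * b0 * M)" "d \<le> d2 / V"
    by auto
  have "norm (gstep (xs + y) (i, b) - xs - r *\<^sub>R coord_step ?H b0 i v) \<le> e * r"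
    if r: "0 < r" "r < d" and y: "norm (y - r *\<^sub>R v) \<le> d * r" and b: "\<bar>b - b0\<bar> \<le> d" for r y b
  proof -
    let ?g = "grad f (xs + y)"
    have "norm y \<le> norm (y - r *\<^sub>R v) + norm (r *\<^sub>R v)" using norm_triangle_sub by (metis add.commute)
    also have "\<dots> \<le> d * r + r * norm v" using y r by simp
    also have "\<dots> \<le> r * V" using mult_right_mono[OF d(2), of r] r by (simp add: V_def algebra_simps)
    finally have ny: "norm y \<le> r * V" .
    also have "r * V < d * V" using r V by (intro mult_strict_right_mono) auto
    also have "d * V \<le> d2" using d(6) V by (simp add: pos_le_divide_eq)
    finally have "norm y < d2" .
    from d2(2)[OF this] have "norm (?g - ?H *v y) \<le> e' * norm y" by (simp add: xs)
    also have "\<dots> \<le> e' * (r * V)" using ny e' by (intro mult_left_mono) auto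
    finally have 1: "b0 * norm (?g - ?H *v y) \<le> e / 4 * r"
      using b0 V by (simp add: e'_def field_simps)
    have "norm ?g \<le> M * norm y" using grad_lipschitz[of "xs + y" xs] by (simp add: xs)
    also have "\<dots> \<le> M * (r * V)" using ny M_pos by (intro mult_left_mono) auto
    finally have "\<bar>b - b0\<bar> * norm ?g \<le> d * (M * (r * V))" using b d(1) by (intro mult_mono) auto
    also have "\<dots> = (d * (4 * M * V)) / 4 * r" by simp
    also have "\<dots> \<le> e / 4 * r" using d(4) r M_pos V by (intro mult_right_mono divide_right_mono) (auto simp: pos_le_divide_eq)
    finally have 2: "\<bar>b - b0\<bar> * norm ?g \<le> e / 4 * r" .
    have "norm (?H *v (y - r *\<^sub>R v)) \<le> M * (d * r)"
      using hessian_norm[of xs "y - r *\<^sub>R v"] mult_left_mono[OF y, of M] M_pos by linarith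
    then have "b0 * norm (?H *v (y - r *\<^sub>R v)) \<le> b0 * (M * (d * r))" using b0 by (intro mult_left_mono) auto
    also have "\<dots> = (d * (4 * b0 * M)) / 4 * r" by simp
    also have "\<dots> \<le> e / 4 * r" using d(5) r M_pos b0 by (intro mult_right_mono divide_right_mono) (auto simp: pos_le_divide_eq)
    finally have 3: "b0 * norm (?H *v (y - r *\<^sub>R v)) \<le> e / 4 * r" .
    have 4: "norm (y - r *\<^sub>R v) \<le> e / 4 * r"
      using y mult_right_mono[OF d(3), of r] r by linarith
    have comp: "\<bar>b0 * u $ i\<bar> \<le> b0 * norm u" for u :: "real ^ 'n"
      using mult_left_mono[OF component_le_norm_cart[of u i] less_imp_le[OF b0]] b0 by (simp add: abs_mult)
    let ?c = "b * ?g $ i - b0 * (?H *v (r *\<^sub>R v)) $ i"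
    have eq: "gstep (xs + y) (i, b) - xs - r *\<^sub>R coord_step ?H b0 i v = (y - r *\<^sub>R v) - ?c *\<^sub>R axis i 1"
      by (simp add: gstep_def coord_step_def matrix_vector_mult_scaleR algebra_simps scaleR_diff_left)
    have "?c = (b - b0) * ?g $ i + b0 * (?g - ?H *v y) $ i + b0 * (?H *v (y - r *\<^sub>R v)) $ i"
      by (simp add: matrix_vector_mult_diff_distrib algebra_simps)
    moreover have "\<bar>(b - b0) * ?g $ i\<bar> \<le> e / 4 * r"
      using 2 mult_left_mono[OF component_le_norm_cart[of ?g i], of "\<bar>b - b0\<bar>"] by (simp add: abs_mult)
    moreover have "\<bar>b0 * (?g - ?H *v y) $ i\<bar> \<le> e / 4 * r"
      by (rule order_trans[OF comp 1])
    moreover have "\<bar>b0 * (?H *v (y - r *\<^sub>R v)) $ i\<bar> \<le> e / 4 * r"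
      by (rule order_trans[OF comp 3])
    ultimately have "\<bar>?c\<bar> \<le> 3 * (e / 4 * r)" by linarith
    then have "norm ((y - r *\<^sub>R v) - ?c *\<^sub>R axis i 1) \<le> e / 4 * r + 3 * (e / 4 * r)"
    proof -
      have "norm (?c *\<^sub>R axis i (1 :: real)) = \<bar>?c\<bar>" by simp
      then show ?thesis
        using norm_triangle_ineq4[of "y - r *\<^sub>R v" "?c *\<^sub>R axis i 1"] 4 \<open>\<bar>?c\<bar> \<le> 3 * (e / 4 * r)\<close> by linarith
    qed
    then show ?thesis unfolding eq by simp
  qed
  with d(1) show ?thesis by blast
qed

text \<open>Tolerances are fixed from the end of the word backwards: the remaining word prescribes
  the accuracy \<open>d1\<close> that its predecessor step has to deliver.\<close>

lemma fold_gstep_tracks_linear: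
  assumes xs: "grad f xs = 0" and b0: "0 < b0" and e: "0 < e"
  shows "\<exists>d>0. \<forall>r y ps. 0 < r \<longrightarrow> r < d \<longrightarrow> norm (y - r *\<^sub>R v) \<le> d * r \<longrightarrow> map fst ps = w \<longrightarrow>
    (\<forall>p\<in>set ps. \<bar>snd p - b0\<bar> \<le> d) \<longrightarrow>
    norm (gsteps ps (xs + y) - xs - r *\<^sub>R fold (coord_step (hessian f xs) b0) w v) \<le> e * r"
proof (induction w arbitrary: v)
  case Nil
  show ?case by (rule exI[of _ e]) (use e in auto)
next
  case (Cons i w)
  let ?v = "coord_step (hessian f xs) b0 i v"
  obtain d1 where d1: "0 < d1" "\<And>r y ps. 0 < r \<Longrightarrow> r < d1 \<Longrightarrow> norm (y - r *\<^sub>R ?v) \<le> d1 * r \<Longrightarrow> map fst ps = w \<Longrightarrow>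
    (\<forall>p\<in>set ps. \<bar>snd p - b0\<bar> \<le> d1) \<Longrightarrow>
    norm (gsteps ps (xs + y) - xs - r *\<^sub>R fold (coord_step (hessian f xs) b0) w ?v) \<le> e * r"
    using Cons.IH[of ?v] by blast
  obtain d2 where d2: "0 < d2" "\<And>r y b. 0 < r \<Longrightarrow> r < d2 \<Longrightarrow> norm (y - r *\<^sub>R v) \<le> d2 * r \<Longrightarrow> \<bar>b - b0\<bar> \<le> d2 \<Longrightarrow>
    norm (gstep (xs + y) (i, b) - xs - r *\<^sub>R ?v) \<le> d1 * r"
    using gstep_tracks_linear[OF xs b0 d1(1), of v i] by blast
  show ?case
  proof (intro exI[of _ "min d1 d2"] conjI allI impI)
    show "0 < min d1 d2" using d1 d2 by simp
    fix r y ps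
    assume r: "0 < r" "r < min d1 d2" and y: "norm (y - r *\<^sub>R v) \<le> min d1 d2 * r" and ps: "map fst ps = i # w"
      and b: "\<forall>p\<in>set ps. \<bar>snd p - b0\<bar> \<le> min d1 d2"
    obtain b' ps' where ps': "ps = (i, b') # ps'" "map fst ps' = w"
      using ps by (cases ps) auto
    define z where "z = gstep (xs + y) (i, b') - xs"
    have "min d1 d2 * r \<le> d2 * r" using r by (intro mult_right_mono) auto
    then have "norm (y - r *\<^sub>R v) \<le> d2 * r" using y by linarith
    then have "norm (z - r *\<^sub>R ?v) \<le> d1 * r"
      unfolding z_def using r b ps' by (intro d2(2)) auto
    then have "norm (gsteps ps' (xs + z) - xs - r *\<^sub>R fold (coord_step (hessian f xs) b0) w ?v) \<le> e * r"
      using r b ps' by (intro d1(2)) auto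
    then show "norm (gsteps ps (xs + y) - xs - r *\<^sub>R fold (coord_step (hessian f xs) b0) (i # w) v) \<le> e * r"
      by (simp add: ps' z_def)
  qed
qed

text \<open>A single \<open>d\<close> serves as the aperture and the length of a cone at
  \<open>xs\<close> around the direction \<open>v\<close>, and as the tolerance for step sizes. Such
  cones are stable under small changes of direction, so finitely many cover a punctured
  neighbourhood.\<close>

definition escapes :: "real ^ 'n \<Rightarrow> real \<Rightarrow> real ^ 'n \<Rightarrow> 'n list \<Rightarrow> real \<Rightarrow> bool" where
  "escapes xs b v w d \<longleftrightarrow> (\<forall>r y ps. 0 < r \<longrightarrow> r < d \<longrightarrow> norm (y - r *\<^sub>R v) \<le> d * r \<longrightarrow> map fst ps = w \<longrightarrow>
    (\<forall>p\<in>set ps. \<bar>snd p - b\<bar> \<le> d) \<longrightarrow> f (gsteps ps (xs + y)) < f xs)"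

lemma local_escape_word:
  assumes xs: "grad f xs = 0" and b0: "0 < b0" and w: "energy (hessian f xs) (fold (coord_step (hessian f xs) b0) w v) < 0"
  shows "\<exists>d>0. escapes xs b0 v w d"
proof -
  let ?H = "hessian f xs"
  define v1 where "v1 = fold (coord_step ?H b0) w v"
  define \<eta> where "\<eta> = - energy ?H v1 / 2"
  have \<eta>: "0 < \<eta>" "energy ?H v1 < - \<eta>" using w by (auto simp: \<eta>_def v1_def)
  have "isCont (energy ?H) v1"
    using continuous_energy[of UNIV ?H] by (simp add: continuous_on_eq_continuous_at)
  then have "eventually (\<lambda>z. energy ?H z < - \<eta>) (nhds v1)"
    using \<eta>(2) by (metis isCont_def order_tendstoD(2) tendsto_at_iff_tendsto_nhds)
  then obtain e0 where e0: "0 < e0" "\<And>z. dist z v1 < e0 \<Longrightarrow> energy ?H z < - \<eta>"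
    by (auto simp: eventually_nhds_metric)
  define e where "e = min 1 (e0 / 2)"
  have e: "0 < e" "e \<le> 1" "e < e0" using e0 by (auto simp: e_def)
  define V where "V = norm v1 + 1"
  have V: "1 \<le> V" by (simp add: V_def)
  \<comment> \<open>Keeps the remainder at \<open>\<eta> / 4\<close>, below the gain
    \<open>\<eta> / 2\<close> from the quadratic part, as long as the rescaled point has norm at
    most \<open>V\<close>.\<close>
  define e2 where "e2 = \<eta> / (4 * V\<^sup>2)"
  have e2: "0 < e2" using \<eta> V by (simp add: e2_def)
  obtain d2 where d2: "0 < d2" "\<And>y. norm y < d2 \<Longrightarrow> f (xs + y) - f xs \<le> energy ?H y / 2 + e2 * (norm y)\<^sup>2"
    using quadratic_upper_bound[OF xs e2] by blast
  obtain d1 where d1: "0 < d1" "\<And>r y ps. 0 < r \<Longrightarrow> r < d1 \<Longrightarrow> norm (y - r *\<^sub>R v) \<le> d1 * r \<Longrightarrow> map fst ps = w \<Longrightarrow>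
    (\<forall>p\<in>set ps. \<bar>snd p - b0\<bar> \<le> d1) \<Longrightarrow>
    norm (gsteps ps (xs + y) - xs - r *\<^sub>R v1) \<le> e * r"
    using fold_gstep_tracks_linear[OF xs b0 e(1), of v w] unfolding v1_def by blast
  define d where "d = min d1 (d2 / V)"
  have d: "0 < d" "d \<le> d1" "d \<le> d2 / V" using d1 d2 V by (auto simp: d_def)
  have "f (gsteps ps (xs + y)) < f xs"
    if r: "0 < r" "r < d" and y: "norm (y - r *\<^sub>R v) \<le> d * r" and ps: "map fst ps = w" "\<forall>p\<in>set ps. \<bar>snd p - b0\<bar> \<le> d" for r y ps
  proof -
    define z where "z = gsteps ps (xs + y) - xs"
    have z: "norm (z - r *\<^sub>R v1) \<le> e * r"
      unfolding z_def
    proof (rule d1(2))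
      show "norm (y - r *\<^sub>R v) \<le> d1 * r" using y mult_right_mono[OF d(2), of r] r by linarith
    qed (use r ps d(2) in auto)
    define u where "u = z /\<^sub>R r"
    have zu: "z = r *\<^sub>R u" using r by (simp add: u_def)
    have "r * norm (u - v1) \<le> r * e"
      using z r by (simp add: zu scaleR_diff_right[symmetric] mult.commute)
    then have uv: "norm (u - v1) \<le> e" using r by simp
    then have q: "energy ?H u < - \<eta>" using e by (intro e0(2)) (simp add: dist_norm)
    have nu: "norm u \<le> V"
      using uv e norm_triangle_sub[of u v1] by (simp add: V_def)
    have "norm z = r * norm u" using r by (simp add: zu)
    also have "\<dots> \<le> r * V" using nu r by (intro mult_left_mono) auto
    also have "\<dots> < d * V" using r V by (intro mult_strict_right_mono) auto
    also have "\<dots> \<le> d2" using d(3) V by (simp add: pos_le_divide_eq)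
    finally have "norm z < d2" .
    from d2(2)[OF this] have "f (xs + z) - f xs \<le> r\<^sup>2 * (energy ?H u / 2 + e2 * (norm u)\<^sup>2)"
      using r by (simp add: zu energy_scaleR power_mult_distrib algebra_simps)
    also have "\<dots> < 0"
    proof -
      have "e2 * (norm u)\<^sup>2 \<le> e2 * V\<^sup>2" using nu e2 by (intro mult_left_mono power_mono) auto
      also have "\<dots> = \<eta> / 4" using V by (simp add: e2_def)
      finally have "energy ?H u / 2 + e2 * (norm u)\<^sup>2 < 0" using q \<eta>(1) by linarith
      then show ?thesis using r by (intro mult_pos_neg) auto
    qed
    finally show ?thesis by (simp add: z_def)
  qed
  with d(1) show ?thesis unfolding escapes_def by blast
qed

end

text \<open>Away from the zeros \<open>norm (g z)\<close> has a positive minimum by compactness, so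
  the sequence is eventually near the finite zero set; with steps shorter than the separation of the
  zeros it cannot change from one to another.\<close>

lemma tends_to_isolated_zero:
  fixes x :: "nat \<Rightarrow> 'a::metric_space" and g :: "'a \<Rightarrow> 'b::real_normed_vector"
  assumes K: "compact K" "\<And>t. x t \<in> K" and g: "continuous_on K g" "(\<lambda>t. g (x t)) \<longlonglongrightarrow> 0"
    and step: "(\<lambda>t. dist (x (Suc t)) (x t)) \<longlonglongrightarrow> 0" and fin: "finite {z \<in> K. g z = 0}"
  shows "\<exists>z\<in>K. g z = 0 \<and> x \<longlonglongrightarrow> z"
proof -
  define Z where "Z = {z \<in> K. g z = 0}"
  have near: "eventually (\<lambda>t. \<exists>z\<in>Z. dist (x t) z < e) sequentially" if e: "0 < e" for e
  proof -
    let ?K = "K - (\<Union>z\<in>Z. ball z e)"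
    have comp: "compact ?K" by (intro compact_diff K open_UN) auto
    show ?thesis
    proof (cases "?K = {}")
      case True
      have "\<exists>z\<in>Z. dist (x t) z < e" for t
      proof -
        have "x t \<in> (\<Union>z\<in>Z. ball z e)" using K(2)[of t] True by blast
        then show ?thesis by (auto simp: dist_commute)
      qed
      then show ?thesis by simp
    next
      case False
      have "continuous_on ?K (\<lambda>z. norm (g z))"
        by (intro continuous_on_norm continuous_on_subset[OF g(1)]) auto
      from continuous_attains_inf[OF comp False this]
      obtain m where m: "m \<in> ?K" and m_le: "\<forall>z\<in>?K. norm (g m) \<le> norm (g z)" ..
      have "g m \<noteq> 0"
      proof
        assume "g m = 0"
        then have "m \<in> Z" using m by (auto simp: Z_def)
        then have "m \<in> (\<Union>z\<in>Z. ball z e)" using e by (intro UN_I[of m]) auto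
        then show False using m by blast
      qed
      then have "eventually (\<lambda>t. norm (g (x t)) < norm (g m)) sequentially"
        using order_tendstoD(2)[OF tendsto_norm_zero[OF g(2)], of "norm (g m)"] by simp
      then show ?thesis
      proof eventually_elim
        case (elim t)
        then have "x t \<notin> ?K" using m_le by (auto simp: not_le[symmetric])
        then show ?case using K(2)[of t] by (auto simp: dist_commute)
      qed
    qed
  qed
  \<comment> \<open>The factor 3 accounts for the two distances to zeros and the step between
    consecutive terms.\<close>
  obtain e0 where e0: "0 < e0" "\<And>z z'. z \<in> Z \<Longrightarrow> z' \<in> Z \<Longrightarrow> dist z z' < 3 * e0 \<Longrightarrow> z = z'"
  proof -
    define D where "D = insert 1 ((\<lambda>(z, z'). dist z z') ` {(z, z') \<in> Z \<times> Z. z \<noteq> z'})"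
    have finD: "finite D" unfolding D_def
      using fin by (intro finite.insertI finite_imageI finite_subset[OF _ finite_cartesian_product[of Z Z]]) (auto simp: Z_def)
    have pos: "0 < Min D" using finD by (subst Min_gr_iff) (auto simp: D_def)
    show ?thesis
    proof (rule that[of "Min D / 3"])
      show "0 < Min D / 3" using pos by simp
      fix z z' assume z: "z \<in> Z" "z' \<in> Z" "dist z z' < 3 * (Min D / 3)"
      show "z = z'"
      proof (rule ccontr)
        assume "z \<noteq> z'"
        then have "dist z z' \<in> D" using z by (auto simp: D_def)
        then show False using z(3) Min_le[OF finD] by fastforce
      qed
    qed
  qed
  have "eventually (\<lambda>t. (\<exists>z\<in>Z. dist (x t) z < e0) \<and> dist (x (Suc t)) (x t) < e0) sequentially"
    using near[OF e0(1)] order_tendstoD(2)[OF step e0(1)] by eventually_elim auto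
  then obtain N where N: "\<And>t. t \<ge> N \<Longrightarrow> \<exists>z\<in>Z. dist (x t) z < e0" "\<And>t. t \<ge> N \<Longrightarrow> dist (x (Suc t)) (x t) < e0"
    by (auto simp: eventually_sequentially)
  obtain z where z: "z \<in> Z" "dist (x N) z < e0" using N(1)[of N] by auto
  have stay: "dist (x t) z < e0" if "t \<ge> N" for t
    using that
  proof (induction t rule: dec_induct)
    case (step t)
    obtain z' where z': "z' \<in> Z" "dist (x (Suc t)) z' < e0" using N(1)[of "Suc t"] step by auto
    have "dist z z' \<le> dist (x t) z + dist (x (Suc t)) (x t) + dist (x (Suc t)) z'"
      using dist_triangle[of z z' "x t"] dist_triangle[of "x t" z' "x (Suc t)"] by (simp add: dist_commute)
    also have "\<dots> < 3 * e0" using step z' N(2)[of t] by linarith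
    finally have "z = z'" using e0(2) z z' by blast
    then show ?case using z' by simp
  qed (rule z)
  have "x \<longlonglongrightarrow> z"
  proof (rule tendstoI)
    fix e :: real assume "0 < e"
    then have "eventually (\<lambda>t. \<exists>z\<in>Z. dist (x t) z < min e e0) sequentially" using e0 by (intro near) simp
    then show "eventually (\<lambda>t. dist (x t) z < e) sequentially"
      using eventually_ge_at_top[of N]
    proof eventually_elim
      case (elim t)
      then obtain z' where z': "z' \<in> Z" "dist (x t) z' < min e e0" by blast
      have "dist z z' \<le> dist (x t) z + dist (x t) z'" by (metis dist_commute dist_triangle)
      also have "\<dots> < 3 * e0" using stay[OF elim(2)] z' e0(1) by linarith
      finally have "z = z'" using e0(2) z z' by blast
      then show ?case using z' by simp
    qed
  qed
  then show ?thesis using z by (auto simp: Z_def)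
qed

section \<open>Almost sure convergence\<close>

context smooth_objective
begin

lemma rcgd_Suc: "rcgd f x \<omega> (Suc t) = gstep (rcgd f x \<omega> t) (\<omega> t)"
  by (simp add: gstep_def coord_proj_mult)

lemma rcgd_add: "rcgd f x \<omega> (m + n) = rcgd f (rcgd f x \<omega> m) ((shift ^^ m) \<omega>) n"
  by (induction n) (simp_all add: rcgd_Suc shift_pow del: rcgd.simps(2))

lemma rcgd_case_nat: "rcgd f x (case_nat s \<omega>) (Suc t) = rcgd f (gstep x s) \<omega> t"
proof -
  have "shift (case_nat s \<omega>) = \<omega>" by (simp add: shift_def)
  then show ?thesis using rcgd_add[of x "case_nat s \<omega>" 1 t] by (simp add: rcgd_Suc del: rcgd.simps(2))
qed

lemma rcgd_fold: "rcgd f x \<omega> t = gsteps (map \<omega> [0..<t]) x"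
  by (induction t) (simp_all add: rcgd_Suc del: rcgd.simps(2))

lemma rcgd_comb_seq: "rcgd f x (comb_seq n \<omega> \<omega>') n = rcgd f x \<omega> n"
proof -
  have "map (comb_seq n \<omega> \<omega>') [0..<n] = map \<omega> [0..<n]" by (simp add: comb_seq_less)
  then show ?thesis unfolding rcgd_fold by (simp only:)
qed

lemma shift_comb_seq: "(shift ^^ n) (comb_seq n \<omega> \<omega>') = \<omega>'"
  using comb_seq_add[of n \<omega> \<omega>'] by (simp add: shift_pow fun_eq_iff add.commute)

lemma gstep_measurable:
  assumes X: "X \<in> borel_measurable N" and P: "P \<in> measurable N (step_space a b)"
  shows "(\<lambda>\<omega>. gstep (X \<omega>) (P \<omega>)) \<in> borel_measurable N"
proof -
  have "(\<lambda>\<omega>. grad f (X \<omega>)) \<in> borel_measurable N"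
    by (rule measurable_compose[OF X borel_measurable_continuous_onI[OF continuous_grad]])
  then have "(\<lambda>\<omega>. grad f (X \<omega>) $ i) \<in> borel_measurable N" for i
    by (rule borel_measurable_continuous_on[rotated]) (intro continuous_intros)
  moreover have "(\<lambda>\<omega>. snd (P \<omega>)) \<in> borel_measurable N" by (rule measurable_compose[OF P snd_step_space])
  ultimately have "(\<lambda>\<omega>. X \<omega> - (snd (P \<omega>) * grad f (X \<omega>) $ i) *\<^sub>R axis i 1) \<in> borel_measurable N" for i
    using X by simp
  from measurable_compose_countable'[OF this measurable_compose[OF P fst_step_space]]
  show ?thesis unfolding gstep_def by (simp add: countable_finite)
qed

abbreviation "\<Omega> \<equiv> (sample_space amin amax :: 'n sample measure)"

lemma rcgd_measurable: "(\<lambda>\<omega>. rcgd f x \<omega> t) \<in> borel_measurable \<Omega>"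
  by (induction t) (simp_all add: rcgd_Suc gstep_measurable[OF _ component_sample_space] del: rcgd.simps(2))

lemma f_rcgd_antimono:
  assumes "\<omega> \<in> space \<Omega>"
  shows "s \<le> t \<Longrightarrow> f (rcgd f x \<omega> t) \<le> f (rcgd f x \<omega> s)"
proof (induction t rule: dec_induct)
  case (step t)
  have "f (rcgd f x \<omega> (Suc t)) \<le> f (rcgd f x \<omega> t)"
    unfolding rcgd_Suc by (rule gstep_le) (rule sample_space_range[OF assms])
  then show ?case using step by simp
qed simp

section \<open>Expected descent and convergence to critical points\<close>

lemma step_space_nn_integral_fst:
  fixes h :: "'n \<Rightarrow> real"
  assumes "\<And>i. 0 \<le> h i"
  shows "(\<integral>\<^sup>+p. ennreal (h (fst p)) \<partial>step_space amin amax) = ennreal ((\<Sum>i\<in>UNIV. h i) / CARD('n))"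
proof -
  let ?U = "uniform_measure (restrict_space lborel {amin..amax}) {amin..amax}"
  interpret U: prob_space ?U
    by (rule prob_space_uniform_measure) (use amax in \<open>simp_all add: emeasure_restrict_space\<close>)
  have "(\<integral>\<^sup>+p. ennreal (h (fst p)) \<partial>step_space amin amax)
      = (\<integral>\<^sup>+i. ennreal (h i) \<partial>distr (step_space amin amax) (uniform_count_measure UNIV) fst)"
    by (subst nn_integral_distr) (auto simp: step_space_def)
  also have "distr (step_space amin amax) (uniform_count_measure UNIV) fst = uniform_count_measure (UNIV :: 'n set)"
    unfolding step_space_def by (rule U.distr_pair_fst)
  also have "(\<integral>\<^sup>+i. ennreal (h i) \<partial>uniform_count_measure UNIV) = (\<Sum>i\<in>(UNIV :: 'n set). ennreal (1 / CARD('n)) * ennreal (h i))"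
    unfolding uniform_count_measure_def by (subst nn_integral_point_measure_finite) auto
  also have "\<dots> = (\<Sum>i\<in>(UNIV :: 'n set). ennreal (h i / CARD('n)))"
    using assms by (simp add: ennreal_mult[symmetric])
  also have "\<dots> = ennreal ((\<Sum>i\<in>UNIV. h i) / CARD('n))"
    using assms by (simp add: sum_ennreal sum_divide_distrib)
  finally show ?thesis .
qed

text \<open>Splitting off the initial sample and inducting over all starting points takes the place
  of conditional expectations. On average over the coordinate, \<open>CARD('n)\<close> times the
  squared partial derivative is the squared gradient norm, which the descent, weighted by
  \<open>CARD('n) / rate\<close>, pays for.\<close>

lemma expected_gradient_sum:
  assumes m: "\<And>x. m \<le> f x"
  shows "(\<integral>\<^sup>+\<omega>. (\<Sum>t<n. ennreal ((norm (grad f (rcgd f x \<omega> t)))\<^sup>2)) \<partial>\<Omega>) \<le> ennreal (CARD('n) / rate * (f x - m))"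
proof (induction n arbitrary: x)
  case (Suc n)
  interpret sequence_space "step_space amin amax :: ('n \<times> real) measure" by (rule sequence_space_step_space[OF amax])
  interpret prob_space \<Omega> by (rule prob_space_sample_space[OF amax])
  let ?M = "step_space amin amax :: ('n \<times> real) measure"
  let ?C = "CARD('n) / rate"
  have C: "0 < ?C" using rate_pos by simp
  have alg: "?C * (a - rate * b - m) = ?C * (a - m) - real CARD('n) * b" for a b :: real
    using rate_pos by (simp add: field_simps)
  let ?F = "\<lambda>k x \<omega>. \<Sum>t<k. ennreal ((norm (grad f (rcgd f x \<omega> t)))\<^sup>2)"
  have meas: "?F k x \<in> borel_measurable \<Omega>" for k x
  proof -
    have "(\<lambda>\<omega>. grad f (rcgd f x \<omega> t)) \<in> borel_measurable \<Omega>" for t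
      by (rule measurable_compose[OF rcgd_measurable borel_measurable_continuous_onI[OF continuous_grad]])
    then show ?thesis by measurable
  qed
  have meas2: "(\<lambda>(s, \<omega>). case_nat s \<omega>) \<in> measurable (?M \<Otimes>\<^sub>M \<Omega>) \<Omega>"
    unfolding sample_space_def by measurable
  have iter: "distr (?M \<Otimes>\<^sub>M \<Omega>) \<Omega> (\<lambda>(s, \<omega>). case_nat s \<omega>) = \<Omega>"
    using PiM_iter by (simp add: sample_space_def)
  have split: "?F (Suc n) x (case_nat s \<omega>) = ennreal ((norm (grad f x))\<^sup>2) + ?F n (gstep x s) \<omega>" for s \<omega>
    by (subst sum.lessThan_Suc_shift) (simp add: rcgd_case_nat del: rcgd.simps(2))
  have bound: "(\<integral>\<^sup>+\<omega>. ?F (Suc n) x (case_nat s \<omega>) \<partial>\<Omega>)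
      \<le> ennreal ((norm (grad f x))\<^sup>2 + ?C * (f x - m) - CARD('n) * (grad f x $ fst s)\<^sup>2)" if s: "s \<in> space ?M" for s
  proof -
    have "(\<integral>\<^sup>+\<omega>. ?F (Suc n) x (case_nat s \<omega>) \<partial>\<Omega>) = ennreal ((norm (grad f x))\<^sup>2) + (\<integral>\<^sup>+\<omega>. ?F n (gstep x s) \<omega> \<partial>\<Omega>)"
      unfolding split using meas by (subst nn_integral_add) (auto simp: emeasure_space_1)
    also have "\<dots> \<le> ennreal ((norm (grad f x))\<^sup>2) + ennreal (?C * (f (gstep x s) - m))"
      by (intro add_left_mono Suc.IH)
    also have "\<dots> = ennreal ((norm (grad f x))\<^sup>2 + ?C * (f (gstep x s) - m))"
    proof -
      have "0 \<le> ?C * (f (gstep x s) - m)" using m[of "gstep x s"] C by (intro mult_nonneg_nonneg) auto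
      then show ?thesis by (subst ennreal_plus) auto
    qed
    also have "\<dots> \<le> ennreal ((norm (grad f x))\<^sup>2 + ?C * (f x - m) - CARD('n) * (grad f x $ fst s)\<^sup>2)"
    proof (rule ennreal_leI)
      have "snd s \<in> {amin..amax}" using s by (auto simp: space_step_space)
      then have "?C * (f (gstep x s) - m) \<le> ?C * (f x - rate * (grad f x $ fst s)\<^sup>2 - m)"
        using gstep_descent[of s x] C by (intro mult_left_mono) auto
      also have "\<dots> = ?C * (f x - m) - CARD('n) * (grad f x $ fst s)\<^sup>2"
        by (simp only: alg)
      finally show "(norm (grad f x))\<^sup>2 + ?C * (f (gstep x s) - m)
          \<le> (norm (grad f x))\<^sup>2 + ?C * (f x - m) - CARD('n) * (grad f x $ fst s)\<^sup>2" by simp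
    qed
    finally show ?thesis .
  qed
  let ?h = "\<lambda>i. (norm (grad f x))\<^sup>2 + ?C * (f x - m) - CARD('n) * (grad f x $ i)\<^sup>2"
  \<comment> \<open>Needed because \<open>ennreal\<close> truncates negative values at 0; it is read
    off an actual step of size \<open>amin\<close>.\<close>
  have h: "0 \<le> ?h i" for i
  proof -
    have "0 \<le> ?C * (f (gstep x (i, amin)) - m)" using m[of "gstep x (i, amin)"] C by (intro mult_nonneg_nonneg) auto
    also have "\<dots> \<le> ?C * (f x - rate * (grad f x $ i)\<^sup>2 - m)"
      using gstep_descent[of "(i, amin)" x] C amax by (intro mult_left_mono) auto
    also have "\<dots> = ?C * (f x - m) - CARD('n) * (grad f x $ i)\<^sup>2"
      by (simp only: alg)
    finally show ?thesis by (simp add: add_increasing)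
  qed
  have "(\<integral>\<^sup>+\<omega>. ?F (Suc n) x \<omega> \<partial>\<Omega>) = (\<integral>\<^sup>+z. ?F (Suc n) x (case z of (s, \<omega>) \<Rightarrow> case_nat s \<omega>) \<partial>(?M \<Otimes>\<^sub>M \<Omega>))"
    by (subst iter[symmetric], rule nn_integral_distr[OF meas2]) (simp only: measurable_distr_eq1, rule meas)
  also have "\<dots> = (\<integral>\<^sup>+s. \<integral>\<^sup>+\<omega>. ?F (Suc n) x (case_nat s \<omega>) \<partial>\<Omega> \<partial>?M)"
    using nn_integral_fst[OF measurable_compose[OF meas2 meas[of x "Suc n"]]] by simp
  also have "\<dots> \<le> (\<integral>\<^sup>+s. ennreal (?h (fst s)) \<partial>?M)"
    by (rule nn_integral_mono) (rule bound)
  also have "\<dots> = ennreal ((\<Sum>i\<in>UNIV. ?h i) / CARD('n))"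
    by (rule step_space_nn_integral_fst[OF h])
  also have "(\<Sum>i\<in>UNIV. ?h i) / CARD('n) = ?C * (f x - m)"
  proof -
    have "(norm (grad f x))\<^sup>2 = (\<Sum>i\<in>UNIV. (grad f x $ i)\<^sup>2)"
      by (simp add: norm_vec_def L2_set_def sum_nonneg)
    then have "(\<Sum>i\<in>UNIV. ?h i) = CARD('n) * (?C * (f x - m))"
      by (simp add: sum.distrib sum_subtractf sum_distrib_left[symmetric] algebra_simps)
    then show ?thesis by simp
  qed
  finally show ?case .
qed simp

lemma AE_gradient_tendsto_0:
  assumes m: "\<And>x. m \<le> f x"
  shows "AE \<omega> in \<Omega>. (\<lambda>t. grad f (rcgd f x \<omega> t)) \<longlonglongrightarrow> 0"
proof -
  let ?a = "\<lambda>t \<omega>. (norm (grad f (rcgd f x \<omega> t)))\<^sup>2"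
  have [measurable]: "(\<lambda>\<omega>. grad f (rcgd f x \<omega> t)) \<in> borel_measurable \<Omega>" for t
    by (rule measurable_compose[OF rcgd_measurable borel_measurable_continuous_onI[OF continuous_grad]])
  have "(\<integral>\<^sup>+\<omega>. (\<Sum>t. ennreal (?a t \<omega>)) \<partial>\<Omega>) = (\<integral>\<^sup>+\<omega>. (SUP n. \<Sum>t<n. ennreal (?a t \<omega>)) \<partial>\<Omega>)"
    by (simp add: suminf_eq_SUP)
  also have "\<dots> = (SUP n. \<integral>\<^sup>+\<omega>. (\<Sum>t<n. ennreal (?a t \<omega>)) \<partial>\<Omega>)"
    by (rule nn_integral_monotone_convergence_SUP) (auto simp: incseq_def le_fun_def simp del: sum_ennreal intro!: sum_mono2)
  also have "\<dots> \<le> ennreal (CARD('n) / rate * (f x - m))"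
    by (rule SUP_least) (rule expected_gradient_sum[OF m])
  also have "\<dots> < \<infinity>" by simp
  finally have "(\<integral>\<^sup>+\<omega>. (\<Sum>t. ennreal (?a t \<omega>)) \<partial>\<Omega>) \<noteq> \<infinity>" by simp
  then have "AE \<omega> in \<Omega>. (\<Sum>t. ennreal (?a t \<omega>)) \<noteq> \<infinity>"
    by (intro nn_integral_noteq_infinite) auto
  then show ?thesis
  proof eventually_elim
    case (elim \<omega>)
    then have "summable (\<lambda>t. ?a t \<omega>)" by (intro summable_suminf_not_top) auto
    then have "(\<lambda>t. sqrt (?a t \<omega>)) \<longlonglongrightarrow> sqrt 0" by (intro tendsto_real_sqrt summable_LIMSEQ_zero)
    then show ?case by (simp add: tendsto_norm_zero_iff)
  qed
qed

lemma AE_tends_to_critical: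
  assumes level: "bounded {x. f x \<le> f x0}" and iso: "\<And>x. x \<in> Crit f \<Longrightarrow> x isolated_in Crit f"
  shows "AE \<omega> in \<Omega>. \<exists>z \<in> Crit f. f z \<le> f x0 \<and> rcgd f x0 \<omega> \<longlonglongrightarrow> z"
    and "finite {z \<in> Crit f. f z \<le> f x0}"
proof -
  let ?L = "{x. f x \<le> f x0}"
  have L: "compact ?L"
    using level continuous_f[of UNIV] by (auto simp: compact_eq_bounded_closed intro!: closed_Collect_le continuous_on_const)
  \<comment> \<open>A minimum over the level set is a global one, since \<open>f\<close> exceeds
    \<open>f x0\<close> outside.\<close>
  obtain z where "z \<in> ?L" "\<And>x. x \<in> ?L \<Longrightarrow> f z \<le> f x"
    using continuous_attains_inf[OF L _ continuous_f] by (metis (mono_tags, lifting) empty_iff mem_Collect_eq order_refl)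
  then have m: "f z \<le> f x" for x by (metis mem_Collect_eq nle_le order_trans)
  have closed: "closed (Crit f)"
    unfolding Crit_def by (intro closed_Collect_eq continuous_on_const continuous_grad)
  show fin: "finite {z \<in> Crit f. f z \<le> f x0}"
  proof (rule ccontr)
    assume inf: "infinite {z \<in> Crit f. f z \<le> f x0}"
    have "compact (Crit f \<inter> ?L)" by (rule closed_Int_compact[OF closed L])
    from Heine_Borel_imp_Bolzano_Weierstrass[OF this inf]
    obtain y where y: "y \<in> Crit f" "y islimpt {z \<in> Crit f. f z \<le> f x0}" by blast
    have lim: "y islimpt Crit f" by (rule islimpt_subset[OF y(2)]) auto
    obtain T where T: "open T" "T \<inter> Crit f = {y}" using iso[OF y(1)] by (auto simp: isolated_in_def)
    then have "y \<in> T" by blast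
    from islimptE[OF lim this T(1)] show False using T(2) by blast
  qed
  show "AE \<omega> in \<Omega>. \<exists>z \<in> Crit f. f z \<le> f x0 \<and> rcgd f x0 \<omega> \<longlonglongrightarrow> z"
    using AE_gradient_tendsto_0[OF m, of x0] AE_space
  proof eventually_elim
    case (elim \<omega>)
    have in_L: "rcgd f x0 \<omega> t \<in> ?L" for t using f_rcgd_antimono[OF elim(2), of 0 t x0] by simp
    have step: "(\<lambda>t. dist (rcgd f x0 \<omega> (Suc t)) (rcgd f x0 \<omega> t)) \<longlonglongrightarrow> 0"
    proof (rule Lim_null_comparison)
      show "(\<lambda>t. amax * norm (grad f (rcgd f x0 \<omega> t))) \<longlonglongrightarrow> 0"
        using tendsto_mult_right_zero[OF tendsto_norm_zero[OF elim(1)]] by simp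
      show "\<forall>\<^sub>F t in sequentially. norm (dist (rcgd f x0 \<omega> (Suc t)) (rcgd f x0 \<omega> t)) \<le> amax * norm (grad f (rcgd f x0 \<omega> t))"
      proof (rule always_eventually, rule allI)
        fix t
        let ?x = "rcgd f x0 \<omega> t"
        have "norm (dist (gstep ?x (\<omega> t)) ?x) = \<bar>snd (\<omega> t)\<bar> * \<bar>grad f ?x $ fst (\<omega> t)\<bar>"
          by (simp add: gstep_def dist_norm abs_mult)
        also have "\<dots> \<le> amax * norm (grad f ?x)"
          using sample_space_range[OF elim(2), of t] amin component_le_norm_cart[of "grad f ?x" "fst (\<omega> t)"]
          by (intro mult_mono) auto
        finally show "norm (dist (rcgd f x0 \<omega> (Suc t)) ?x) \<le> amax * norm (grad f ?x)" unfolding rcgd_Suc .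
      qed
    qed
    have "finite {z \<in> ?L. grad f z = 0}"
      by (rule finite_subset[OF _ fin]) (auto simp: Crit_def)
    from tends_to_isolated_zero[OF L in_L continuous_grad elim(1) step this]
    show ?case by (auto simp: Crit_def)
  qed
qed

section \<open>Escape from a strict saddle\<close>

text \<open>The Markov property at time \<open>n\<close>: \<open>comb_seq\<close> glues the initial
  \<open>n\<close> samples to an independent tail. For a fixed beginning, membership in
  \<open>E\<close> confines the tail to a set of measure at most \<open>c\<close>, whatever position
  has been reached.\<close>

lemma markov_bound:
  fixes B :: "real ^ 'n \<Rightarrow> 'n sample set"
  assumes E: "E \<in> sets \<Omega>" and B: "\<And>y. B y \<in> sets \<Omega>" "\<And>y. emeasure \<Omega> (B y) \<le> c" and D: "D \<in> sets borel"
    and EB: "\<And>\<omega>. \<omega> \<in> E \<Longrightarrow> rcgd f x \<omega> n \<in> D \<and> (shift ^^ n) \<omega> \<in> B (rcgd f x \<omega> n)"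
  shows "emeasure \<Omega> E \<le> c * emeasure \<Omega> {\<omega> \<in> space \<Omega>. rcgd f x \<omega> n \<in> D}"
proof -
  interpret sequence_space "step_space amin amax :: ('n \<times> real) measure" by (rule sequence_space_step_space[OF amax])
  interpret prob_space \<Omega> by (rule prob_space_sample_space[OF amax])
  let ?c = "\<lambda>(\<omega>, \<omega>'). comb_seq n \<omega> \<omega>'"
  have meas: "?c \<in> measurable (\<Omega> \<Otimes>\<^sub>M \<Omega>) \<Omega>"
    unfolding sample_space_def by (rule measurable_comb_seq)
  have "distr (\<Omega> \<Otimes>\<^sub>M \<Omega>) \<Omega> ?c = \<Omega>"
    using PiM_comb_seq by (simp add: sample_space_def)
  then have "emeasure \<Omega> E = emeasure (distr (\<Omega> \<Otimes>\<^sub>M \<Omega>) \<Omega> ?c) E" by simp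
  also have "\<dots> = emeasure (\<Omega> \<Otimes>\<^sub>M \<Omega>) (?c -` E \<inter> space (\<Omega> \<Otimes>\<^sub>M \<Omega>))"
    by (rule emeasure_distr[OF meas E])
  also have "\<dots> = (\<integral>\<^sup>+\<omega>. emeasure \<Omega> (Pair \<omega> -` (?c -` E \<inter> space (\<Omega> \<Otimes>\<^sub>M \<Omega>))) \<partial>\<Omega>)"
    by (rule emeasure_pair_measure_alt) (rule measurable_sets[OF meas E])
  also have "\<dots> \<le> (\<integral>\<^sup>+\<omega>. c * indicator {\<omega> \<in> space \<Omega>. rcgd f x \<omega> n \<in> D} \<omega> \<partial>\<Omega>)"
  proof (rule nn_integral_mono)
    fix \<omega> assume \<omega>: "\<omega> \<in> space \<Omega>"
    have sub: "Pair \<omega> -` (?c -` E \<inter> space (\<Omega> \<Otimes>\<^sub>M \<Omega>)) \<subseteq> (if rcgd f x \<omega> n \<in> D then B (rcgd f x \<omega> n) else {})"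
      using EB by (auto simp: rcgd_comb_seq shift_comb_seq dest!: EB split: if_splits)
    then have "emeasure \<Omega> (Pair \<omega> -` (?c -` E \<inter> space (\<Omega> \<Otimes>\<^sub>M \<Omega>)))
        \<le> emeasure \<Omega> (if rcgd f x \<omega> n \<in> D then B (rcgd f x \<omega> n) else {})"
      by (rule emeasure_mono) (use B in auto)
    also have "\<dots> \<le> c * indicator {\<omega> \<in> space \<Omega>. rcgd f x \<omega> n \<in> D} \<omega>"
      using \<omega> B(2) by (auto simp: indicator_def)
    finally show "emeasure \<Omega> (Pair \<omega> -` (?c -` E \<inter> space (\<Omega> \<Otimes>\<^sub>M \<Omega>)))
        \<le> c * indicator {\<omega> \<in> space \<Omega>. rcgd f x \<omega> n \<in> D} \<omega>" .
  qed
  also have "\<dots> = c * emeasure \<Omega> {\<omega> \<in> space \<Omega>. rcgd f x \<omega> n \<in> D}"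
  proof -
    have "{\<omega> \<in> space \<Omega>. rcgd f x \<omega> n \<in> D} \<in> sets \<Omega>"
      using measurable_sets[OF rcgd_measurable D] by (simp add: vimage_def Int_def conj_commute)
    then show ?thesis by (rule nn_integral_cmult_indicator)
  qed
  finally show ?thesis .
qed

text \<open>Only multiples of \<open>T\<close> are inspected, since escape is guaranteed merely over
  stretches of \<open>T\<close> steps; \<open>j = 0\<close> is left out because the start is treated
  separately.\<close>

definition stays :: "(real ^ 'n) set \<Rightarrow> nat \<Rightarrow> nat \<Rightarrow> real ^ 'n \<Rightarrow> 'n sample set" where
  "stays D T m x = {\<omega> \<in> space \<Omega>. \<forall>j\<in>{1..m}. rcgd f x \<omega> (j * T) \<in> D}"

lemma rcgd_sets: "D \<in> sets borel \<Longrightarrow> {\<omega> \<in> space \<Omega>. rcgd f x \<omega> n \<in> D} \<in> sets \<Omega>"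
  using measurable_sets[OF rcgd_measurable] by (simp add: vimage_def Int_def conj_commute)

lemma stays_sets: "D \<in> sets borel \<Longrightarrow> stays D T m x \<in> sets \<Omega>"
  unfolding stays_def by (intro sets.sets_Collect_finite_All rcgd_sets) auto

lemma emeasure_stays_le:
  assumes D: "D \<in> sets borel" and esc: "\<And>x. x \<in> D \<Longrightarrow> emeasure \<Omega> {\<omega> \<in> space \<Omega>. rcgd f x \<omega> T \<in> D} \<le> c"
  shows "x \<in> D \<Longrightarrow> emeasure \<Omega> (stays D T m x) \<le> c ^ m"
proof (induction m arbitrary: x)
  case 0
  interpret prob_space \<Omega> by (rule prob_space_sample_space[OF amax])
  show ?case by (simp add: emeasure_le_1)
next
  case (Suc m)
  define B where "B y = (if y \<in> D then stays D T m y else {})" for y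
  have "emeasure \<Omega> (stays D T (Suc m) x) \<le> c ^ m * emeasure \<Omega> {\<omega> \<in> space \<Omega>. rcgd f x \<omega> T \<in> D}"
  proof (rule markov_bound[where B=B])
    show "B y \<in> sets \<Omega>" "emeasure \<Omega> (B y) \<le> c ^ m" for y
      using stays_sets[OF D] Suc.IH by (auto simp: B_def)
    fix \<omega> assume \<omega>: "\<omega> \<in> stays D T (Suc m) x"
    have 1: "rcgd f x \<omega> T \<in> D" using \<omega> by (auto simp: stays_def dest: bspec[of _ _ 1])
    have "rcgd f (rcgd f x \<omega> T) ((shift ^^ T) \<omega>) (j * T) \<in> D" if "j \<in> {1..m}" for j
    proof -
      have "rcgd f x \<omega> (Suc j * T) \<in> D" using \<omega> that by (auto simp: stays_def dest: bspec[of _ _ "Suc j"])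
      then show ?thesis using rcgd_add[of x \<omega> T "j * T"] by simp
    qed
    moreover have "(shift ^^ T) \<omega> \<in> space \<Omega>"
      using measurable_space[OF shift_pow_measurable] \<omega> by (auto simp: stays_def)
    ultimately show "rcgd f x \<omega> T \<in> D \<and> (shift ^^ T) \<omega> \<in> B (rcgd f x \<omega> T)"
      using 1 by (simp add: B_def stays_def)
  qed (use stays_sets[OF D] D in auto)
  also have "\<dots> \<le> c ^ m * c" by (intro mult_left_mono esc Suc.prems) auto
  finally show ?case by (simp add: mult.commute)
qed

text \<open>Remaining in \<open>D\<close> from time \<open>n\<close> on entails, after a restart at
  \<open>n\<close>, being in \<open>D\<close> at \<open>m\<close> further multiples of
  \<open>T\<close> for every \<open>m\<close>. This has probability at most
  \<open>q ^ m\<close>.\<close>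

lemma AE_leaves:
  assumes D: "D \<in> sets borel" and esc: "\<And>x. x \<in> D \<Longrightarrow> emeasure \<Omega> {\<omega> \<in> space \<Omega>. rcgd f x \<omega> T \<in> D} \<le> ennreal q"
    and q: "0 \<le> q" "q < 1"
  shows "AE \<omega> in \<Omega>. \<not> eventually (\<lambda>t. rcgd f x \<omega> t \<in> D) sequentially"
proof -
  define E where "E n = {\<omega> \<in> space \<Omega>. \<forall>t\<in>{n..}. rcgd f x \<omega> t \<in> D}" for n
  have E_sets: "E n \<in> sets \<Omega>" for n
    unfolding E_def by (intro sets.sets_Collect_countable_Ball rcgd_sets[OF D])
  have "emeasure \<Omega> (E n) = 0" for n
  proof -
    have le: "emeasure \<Omega> (E n) \<le> ennreal (q ^ m)" for m
    proof -
      interpret prob_space \<Omega> by (rule prob_space_sample_space[OF amax])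
      define B where "B y = (if y \<in> D then stays D T m y else {})" for y
      have "emeasure \<Omega> (E n) \<le> ennreal (q ^ m) * emeasure \<Omega> {\<omega> \<in> space \<Omega>. rcgd f x \<omega> n \<in> D}"
      proof (rule markov_bound[where B=B])
        show "B y \<in> sets \<Omega>" "emeasure \<Omega> (B y) \<le> ennreal (q ^ m)" for y
          using stays_sets[OF D] emeasure_stays_le[OF D esc, of y m] q by (auto simp: B_def ennreal_power)
        fix \<omega> assume \<omega>: "\<omega> \<in> E n"
        have "(shift ^^ n) \<omega> \<in> space \<Omega>"
          using measurable_space[OF shift_pow_measurable] \<omega> by (auto simp: E_def)
        moreover have "rcgd f (rcgd f x \<omega> n) ((shift ^^ n) \<omega>) (j * T) \<in> D" for j
        proof -
          have "n + j * T \<in> {n..}" by simp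
          then have "rcgd f x \<omega> (n + j * T) \<in> D" using \<omega> unfolding E_def by blast
          then show ?thesis unfolding rcgd_add .
        qed
        ultimately show "rcgd f x \<omega> n \<in> D \<and> (shift ^^ n) \<omega> \<in> B (rcgd f x \<omega> n)"
          using \<omega> by (auto simp: B_def stays_def E_def)
      qed (use E_sets D in auto)
      also have "\<dots> \<le> ennreal (q ^ m) * 1" by (intro mult_left_mono emeasure_le_1) auto
      finally show ?thesis by simp
    qed
    have "(\<lambda>m. ennreal (q ^ m)) \<longlonglongrightarrow> ennreal 0"
      using q by (intro tendsto_ennrealI LIMSEQ_power_zero) auto
    then have "emeasure \<Omega> (E n) \<le> ennreal 0"
      by (rule LIMSEQ_le_const) (use le in blast)
    then show ?thesis by simp
  qed
  then have "AE \<omega> in \<Omega>. \<forall>n. \<omega> \<notin> E n"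
    using E_sets by (intro AE_all_countable[THEN iffD2] allI AE_not_in) (auto simp: null_sets_def)
  then show ?thesis
    using AE_space
  proof eventually_elim
    case (elim \<omega>)
    then show ?case by (auto simp: E_def eventually_sequentially)
  qed
qed

lemma cylinder_positive:
  fixes w :: "'n list"
  assumes d: "0 < d" and b0: "b0 \<in> {amin<..<amax}"
  defines "A \<equiv> {\<omega> \<in> space \<Omega>. \<forall>t\<in>{..<length w}. \<omega> t \<in> {w ! t} \<times> {max amin (b0 - d)..min amax (b0 + d)}}"
  shows "A \<in> sets \<Omega>" "0 < measure \<Omega> A"
proof -
  let ?I = "{max amin (b0 - d)..min amax (b0 + d)}"
  let ?U = "uniform_measure (restrict_space lborel {amin..amax}) {amin..amax}"
  interpret sequence_space "step_space amin amax :: ('n \<times> real) measure" by (rule sequence_space_step_space[OF amax])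
  interpret U: prob_space ?U
    by (rule prob_space_uniform_measure) (use amax in \<open>simp_all add: emeasure_restrict_space\<close>)
  interpret prob_space \<Omega> by (rule prob_space_sample_space[OF amax])
  have I_sub: "?I \<subseteq> {amin..amax}" by auto
  have I_sets: "?I \<in> sets (restrict_space lborel {amin..amax})"
    using I_sub by (subst sets_restrict_space_iff) auto
  have full_sets: "{amin..amax} \<in> sets (restrict_space lborel {amin..amax})"
    by (subst sets_restrict_space_iff) auto
  have X_sets: "{i} \<times> ?I \<in> sets (step_space amin amax)" for i :: 'n
    unfolding step_space_def by (intro pair_measureI) (use I_sets in \<open>auto simp: sets_uniform_count_measure\<close>)
  have pos: "emeasure (step_space amin amax) ({i} \<times> ?I) \<noteq> 0" for i :: 'n
  proof -
    have "emeasure (step_space amin amax) ({i} \<times> ?I) = emeasure (uniform_count_measure UNIV) {i} * emeasure ?U ?I"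
      unfolding step_space_def by (rule U.emeasure_pair_measure_Times) (use I_sets in \<open>auto simp: sets_uniform_count_measure\<close>)
    moreover have "emeasure (uniform_count_measure (UNIV :: 'n set)) {i} \<noteq> 0"
      by (subst emeasure_uniform_count_measure) auto
    moreover have "emeasure ?U ?I \<noteq> 0"
    proof -
      have nz: "emeasure lborel {l..u} \<noteq> 0" if "l < u" for l u :: real using that by simp
      have "emeasure (restrict_space lborel {amin..amax}) ({amin..amax} \<inter> ?I) = emeasure lborel ?I"
        using I_sub by (subst emeasure_restrict_space) (auto simp: Int_absorb1)
      also have "\<dots> \<noteq> 0"
        \<comment> \<open>The truncated interval is nondegenerate because \<open>b0\<close> is an
          interior point.\<close>
        by (rule nz) (use d b0 in auto)
      finally have "emeasure (restrict_space lborel {amin..amax}) ({amin..amax} \<inter> ?I) \<noteq> 0" .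
      moreover have "emeasure (restrict_space lborel {amin..amax}) {amin..amax} = ennreal (amax - amin)"
        using amax by (subst emeasure_restrict_space) auto
      ultimately show ?thesis
        using I_sets full_sets by (subst emeasure_uniform_measure) (auto simp: ennreal_divide_eq_0_iff)
    qed
    ultimately show ?thesis by simp
  qed
  have "emeasure \<Omega> A = (\<Prod>t\<in>{..<length w}. emeasure (step_space amin amax) ({w ! t} \<times> ?I))"
    unfolding A_def sample_space_def by (rule emeasure_PiM_Collect) (use X_sets in auto)
  also have "\<dots> \<noteq> 0" using pos by simp
  finally have "emeasure \<Omega> A \<noteq> 0" .
  then show "0 < measure \<Omega> A"
    by (simp add: emeasure_eq_measure zero_less_measure_iff)
  \<comment> \<open>By convention a set outside the sigma-algebra has measure 0.\<close>
  then show "A \<in> sets \<Omega>"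
    by (metis measure_notin_sets less_irrefl)
qed

text \<open>Compactness of the sphere of directions leaves finitely many cones, each with its own
  word. Radius and probability are minima over these, and the direction of \<open>x - xs\<close>
  selects the word that is used.\<close>

lemma local_escape:
  assumes xs: "grad f xs = 0" and b0: "b0 \<in> {amin<..<amax}"
    and words: "\<And>v. v \<noteq> 0 \<Longrightarrow> \<exists>w. energy (hessian f xs) (fold (coord_step (hessian f xs) b0) w v) < 0"
  obtains \<rho> T q where "0 < \<rho>" "0 \<le> q" "q < 1"
    "\<And>x. x \<noteq> xs \<Longrightarrow> norm (x - xs) < \<rho> \<Longrightarrow> emeasure \<Omega> {\<omega> \<in> space \<Omega>. f xs \<le> f (rcgd f x \<omega> T)} \<le> ennreal q"
proof -
  interpret prob_space \<Omega> by (rule prob_space_sample_space[OF amax])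
  let ?S = "sphere (0 :: real ^ 'n) 1"
  have b0_pos: "0 < b0" using b0 amin by simp
  have "\<exists>w d. 0 < d \<and> escapes xs b0 v w d" if "v \<in> ?S" for v
  proof -
    have "v \<noteq> 0" using that by auto
    then obtain w where "energy (hessian f xs) (fold (coord_step (hessian f xs) b0) w v) < 0" using words by blast
    from local_escape_word[OF xs b0_pos this] show ?thesis by blast
  qed
  then obtain W d where d: "\<forall>v\<in>?S. 0 < d v \<and> escapes xs b0 v (W v) (d v)" by metis
  have cover: "?S \<subseteq> (\<Union>v\<in>?S. ball v (d v))" using d by (auto intro!: bexI)
  have "compact ?S" by simp
  from compactE_image[OF this open_ball cover]
  obtain F where F: "F \<subseteq> ?S" "finite F" "?S \<subseteq> (\<Union>v\<in>F. ball v (d v))" by metis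
  have "?S \<noteq> {}" by simp
  then have F0: "F \<noteq> {}" using F(3) by auto
  define A where "A v = {\<omega> \<in> space \<Omega>. \<forall>t\<in>{..<length (W v)}. \<omega> t \<in> {W v ! t} \<times> {max amin (b0 - d v)..min amax (b0 + d v)}}" for v
  have A: "A v \<in> sets \<Omega>" "0 < measure \<Omega> (A v)" if "v \<in> F" for v
    unfolding A_def using d F(1) that by (intro cylinder_positive b0; blast)+
  define \<rho> where "\<rho> = Min (d ` F)"
  \<comment> \<open>Words have different lengths; because \<open>f\<close> only decreases, a drop
    achieved by a shorter word is still present at time \<open>T\<close>.\<close>
  define T where "T = Max ((\<lambda>v. length (W v)) ` F)"
  define p where "p = Min ((\<lambda>v. measure \<Omega> (A v)) ` F)"
  have \<rho>: "0 < \<rho>" unfolding \<rho>_def using F F0 d by (subst Min_gr_iff) auto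
  have p: "0 < p" unfolding p_def using F F0 A by (subst Min_gr_iff) auto
  have p1: "p \<le> 1"
  proof -
    obtain v where v: "v \<in> F" using F0 by blast
    then have "p \<le> measure \<Omega> (A v)" unfolding p_def using F by (intro Min_le) auto
    then show ?thesis using prob_le_1 order_trans by blast
  qed
  show ?thesis
  proof (rule that[OF \<rho>, of "1 - p" T])
    show "0 \<le> 1 - p" "1 - p < 1" using p p1 by auto
    fix x assume x: "x \<noteq> xs" "norm (x - xs) < \<rho>"
    define r where "r = norm (x - xs)"
    have r: "0 < r" using x by (simp add: r_def)
    have "(x - xs) /\<^sub>R r \<in> ?S" using r by (simp add: r_def)
    then have "(x - xs) /\<^sub>R r \<in> (\<Union>v\<in>F. ball v (d v))" using F(3) by blast
    then obtain v where v: "v \<in> F" "(x - xs) /\<^sub>R r \<in> ball v (d v)" by blast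
    then have v2: "norm ((x - xs) /\<^sub>R r - v) < d v"
      by (simp add: mem_ball dist_norm norm_minus_commute)
    have "(x - xs) - r *\<^sub>R v = r *\<^sub>R ((x - xs) /\<^sub>R r - v)" using r by (simp add: scaleR_diff_right)
    then have close: "norm ((x - xs) - r *\<^sub>R v) \<le> d v * r"
      using v2 r by (simp add: mult.commute)
    have "\<rho> \<le> d v" unfolding \<rho>_def using F v(1) by (intro Min_le) auto
    then have rd: "r < d v" using x(2) by (simp add: r_def)
    have esc: "f (rcgd f x \<omega> T) < f xs" if \<omega>: "\<omega> \<in> A v" for \<omega>
    proof -
      let ?ps = "map \<omega> [0..<length (W v)]"
      have \<omega>s: "\<omega> \<in> space \<Omega>" using \<omega> by (simp add: A_def)
      have wt: "fst (\<omega> t) = W v ! t" "\<bar>snd (\<omega> t) - b0\<bar> \<le> d v" if "t < length (W v)" for t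
      proof -
        have "\<omega> t \<in> {W v ! t} \<times> {max amin (b0 - d v)..min amax (b0 + d v)}" using \<omega> that by (simp add: A_def)
        then show "fst (\<omega> t) = W v ! t" "\<bar>snd (\<omega> t) - b0\<bar> \<le> d v" by (auto simp: abs_le_iff)
      qed
      have "map fst ?ps = W v" using wt(1) by (intro nth_equalityI) auto
      moreover have "\<forall>p\<in>set ?ps. \<bar>snd p - b0\<bar> \<le> d v" using wt(2) by auto
      moreover have "v \<in> ?S" using v(1) F(1) by blast
      ultimately have "f (gsteps ?ps (xs + (x - xs))) < f xs"
        using d r rd close unfolding escapes_def by blast
      then have "f (rcgd f x \<omega> (length (W v))) < f xs" by (simp add: rcgd_fold)
      moreover have "length (W v) \<le> T" unfolding T_def using F v(1) by (intro Max_ge) auto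
      ultimately show ?thesis using f_rcgd_antimono[OF \<omega>s, of "length (W v)" T x] by linarith
    qed
    have "emeasure \<Omega> {\<omega> \<in> space \<Omega>. f xs \<le> f (rcgd f x \<omega> T)} \<le> emeasure \<Omega> (space \<Omega> - A v)"
      using esc A(1)[OF v(1)] by (intro emeasure_mono) (auto simp: not_le[symmetric])
    also have "\<dots> = ennreal (1 - measure \<Omega> (A v))"
      using A(1)[OF v(1)] by (simp add: emeasure_eq_measure prob_compl)
    also have "\<dots> \<le> ennreal (1 - p)"
      unfolding p_def using F v(1) by (intro ennreal_leI diff_left_mono Min_le) auto
    finally show "emeasure \<Omega> {\<omega> \<in> space \<Omega>. f xs \<le> f (rcgd f x \<omega> T)} \<le> ennreal (1 - p)" .
  qed
qed

text \<open>An orbit converging to \<open>xs\<close> keeps \<open>f\<close> at or above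
  \<open>f xs\<close> by monotonicity and never reaches \<open>xs\<close>. It would eventually
  remain in \<open>D\<close>, which has probability 0.\<close>

lemma AE_not_tends_to_saddle:
  assumes xs: "grad f xs = 0" and b0: "b0 \<in> {amin<..<amax}"
    and words: "\<And>v. v \<noteq> 0 \<Longrightarrow> \<exists>w. energy (hessian f xs) (fold (coord_step (hessian f xs) b0) w v) < 0"
    and x0: "x0 \<noteq> xs"
  shows "AE \<omega> in \<Omega>. \<not> rcgd f x0 \<omega> \<longlonglongrightarrow> xs"
proof -
  obtain \<rho> T q where q: "0 < \<rho>" "0 \<le> q" "q < 1"
    and esc: "\<And>x. x \<noteq> xs \<Longrightarrow> norm (x - xs) < \<rho> \<Longrightarrow> emeasure \<Omega> {\<omega> \<in> space \<Omega>. f xs \<le> f (rcgd f x \<omega> T)} \<le> ennreal q"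
    by (rule local_escape[OF xs b0 words]) (assumption | rule that)+
  define D where "D = (ball xs \<rho> - {xs}) \<inter> {x. f xs \<le> f x}"
  have "closed {x. f xs \<le> f x}" by (intro closed_Collect_le continuous_on_const continuous_f)
  then have D: "D \<in> sets borel"
    unfolding D_def by (intro sets.Int sets.Diff borel_open borel_closed) auto
  have esc_D: "emeasure \<Omega> {\<omega> \<in> space \<Omega>. rcgd f x \<omega> T \<in> D} \<le> ennreal q" if "x \<in> D" for x
  proof -
    have "{x. f xs \<le> f x} \<in> sets borel" using \<open>closed {x. f xs \<le> f x}\<close> by auto
    from rcgd_sets[OF this]
    have "emeasure \<Omega> {\<omega> \<in> space \<Omega>. rcgd f x \<omega> T \<in> D} \<le> emeasure \<Omega> {\<omega> \<in> space \<Omega>. f xs \<le> f (rcgd f x \<omega> T)}"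
      by (intro emeasure_mono) (auto simp: D_def)
    also have "\<dots> \<le> ennreal q"
      by (rule esc) (use that in \<open>auto simp: D_def dist_norm norm_minus_commute\<close>)
    finally show ?thesis .
  qed
  have "AE \<omega> in \<Omega>. \<not> eventually (\<lambda>t. rcgd f x0 \<omega> t \<in> D) sequentially"
    by (rule AE_leaves[OF D esc_D q(2,3)])
  then show ?thesis
    using AE_space
  proof eventually_elim
    case (elim \<omega>)
    show ?case
    proof
      assume lim: "rcgd f x0 \<omega> \<longlonglongrightarrow> xs"
      have ne: "rcgd f x0 \<omega> t \<noteq> xs" for t
      proof (induction t)
        case (Suc t)
        then show ?case
          unfolding rcgd_Suc using gstep_eq_critical[OF xs sample_space_range[OF elim(2)]] by blast
      qed (use x0 in simp)
      have "(\<lambda>t. f (rcgd f x0 \<omega> t)) \<longlonglongrightarrow> f xs"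
        by (rule continuous_on_tendsto_compose[OF continuous_f[of UNIV] lim]) auto
      then have le: "f xs \<le> f (rcgd f x0 \<omega> t)" for t
        by (rule LIMSEQ_le_const2) (use f_rcgd_antimono[OF elim(2)] in blast)
      have "eventually (\<lambda>t. dist (rcgd f x0 \<omega> t) xs < \<rho>) sequentially"
        using lim q(1) by (rule tendstoD)
      then have "eventually (\<lambda>t. rcgd f x0 \<omega> t \<in> D) sequentially"
        by eventually_elim (use ne le in \<open>auto simp: D_def dist_commute\<close>)
      then show False using elim(1) by blast
    qed
  qed
qed

end

theorem corollary3p3:
  fixes f :: "real ^ 'n::finite \<Rightarrow> real" and M \<alpha>min \<alpha>max :: real and x0 :: "real ^ 'n"
  assumes C2: "C2 f"
    and M_pos: "M > 0"
    and hess_bound: "\<forall>x. onorm ((*v) (hessian f x)) \<le> M"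
    and nondegenerate: "\<forall>xs \<in> Crit_s f. \<forall>\<mu> \<in> eigenvals (hessian f xs). \<mu> \<noteq> 0"
    and projection: "\<forall>xs \<in> Crit_s f. \<forall>i :: 'n.
      AE \<omega> in sample_space \<alpha>min \<alpha>max. P_plus (hessian f xs) \<omega> (axis i 1) \<noteq> 0"
    and isolated: "\<forall>xs \<in> Crit f. xs isolated_in Crit f"
    and step_sizes: "0 < \<alpha>min" "\<alpha>min < \<alpha>max" "\<alpha>max < 1 / M"
    and x0: "x0 \<notin> Crit_s f"
    and level_set: "bounded {x. f x \<le> f x0}"
  shows "AE \<omega> in sample_space \<alpha>min \<alpha>max.
    \<exists>x \<in> Crit f - Crit_s f. rcgd f x0 \<omega> \<longlonglongrightarrow> x"
proof -
  interpret smooth_objective f M \<alpha>min \<alpha>max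
    by standard (use assms in \<open>auto simp: pos_less_divide_eq\<close>)
  \<comment> \<open>Any interior point would do; perturbations to both sides must remain admissible
    step sizes.\<close>
  define b0 where "b0 = (\<alpha>min + \<alpha>max) / 2"
  have b0: "b0 \<in> {\<alpha>min<..<\<alpha>max}" using step_sizes by (simp add: b0_def)
  have avoid: "AE \<omega> in \<Omega>. \<not> rcgd f x0 \<omega> \<longlonglongrightarrow> xs" if xs: "xs \<in> Crit_s f" for xs
  proof (rule AE_not_tends_to_saddle[OF _ b0])
    show "grad f xs = 0" using xs by (simp add: Crit_s_def)
    show "x0 \<noteq> xs" using xs x0 by blast
    fix v :: "real ^ 'n" assume "v \<noteq> 0"
    then show "\<exists>w. energy (hessian f xs) (fold (coord_step (hessian f xs) b0) w v) < 0"
    proof (rule no_trapped_directions[rotated -1])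
      show "transpose (hessian f xs) = hessian f xs" by (rule transpose_hessian[OF f_diff g_diff])
      show "u = 0" if "hessian f xs *v u = 0" for u
      proof (rule ccontr)
        assume "u \<noteq> 0"
        then have "0 \<in> eigenvals (hessian f xs)" using that by (auto simp: eigenvals_def)
        then show False using nondegenerate xs by blast
      qed
      show "AE \<omega> in sample_space \<alpha>min \<alpha>max. P_plus (hessian f xs) \<omega> (axis i 1) \<noteq> 0" for i
        using projection xs by blast
    qed (use step_sizes b0 hessian_diag in auto)
  qed
  have conv: "AE \<omega> in \<Omega>. \<exists>z \<in> Crit f. f z \<le> f x0 \<and> rcgd f x0 \<omega> \<longlonglongrightarrow> z"
    and fin: "finite {z \<in> Crit f. f z \<le> f x0}"
    using AE_tends_to_critical[OF level_set] isolated by blast+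
  \<comment> \<open>Only the finitely many saddles in the level set can be limits, so their
    exceptional null sets can be united.\<close>
  have "AE \<omega> in \<Omega>. \<forall>z\<in>{z \<in> Crit f. f z \<le> f x0} \<inter> Crit_s f. \<not> rcgd f x0 \<omega> \<longlonglongrightarrow> z"
    by (rule AE_finite_allI) (use fin avoid in auto)
  with conv show ?thesis
    by eventually_elim blast
qed

end
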